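(* Let $H_D(s;m,d,f,\alpha)=V(s)\,H_D(m,d,f,\alpha)\,V^\dagger(s)$, $s\in[0,1]$, be the family of time dependent Dicke models with $f$ square integrable, with square root singularity at $k=0$; $m>\alpha^2\,\langle f|\frac1{|k|}|f\rangle$; $d\ge3$; and $V(s)=\exp(i\,s\,\sigma)$, $\sigma=\sigma_x\otimes\mathbf 1$. Then $U_A$, the adiabatic evolution associated with the ground state of $H_D(s;m,d,f,\alpha)$, and $U_\tau$, the Schrödinger evolution, are close in the sense that $$\|(U_A(s)-U_\tau(s))P(0)\|\le C\left\{\begin{array}{ll}\dfrac1\tau&\text{if }d>3,\\[2mm] \dfrac{\sqrt{\log\tau}}{\tau}&\text{if } d=3.\end{array}\right.$$ The time scale is determined by $m-\alpha^2\mathcal E$ and coincides with the gap without photons, $m$, up to a correction by the Lamb shift, $\alpha^2\mathcal E$, where $\mathcal E=\langle f|\frac1{|k|}|f\rangle$.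
   Context: Dicke model: let $\mathcal F$ be the symmetric Fock space over $L^2(\mathbb R^d,d^dk)$, with creation and annihilation operators satisfying $[a(f),a^\dagger(g)]=\langle f|g\rangle$, and let $\Omega$ be the projection on the field vacuum. On $\mathbb C^2\otimes\mathcal F$, $$H_D(m,d,f,\alpha)=m\,(1-p)\otimes\mathbf 1+\alpha^{-1}\,\mathbf 1\otimes E+\sqrt\alpha\,\sigma_+\otimes a^\dagger(f)+\sqrt\alpha\,\sigma_-\otimes a(f),$$ $$p=\begin{pmatrix}1&0\\0&0\end{pmatrix},\quad \sigma_+=\begin{pmatrix}0&1\\0&0\end{pmatrix},\quad \sigma_-=\begin{pmatrix}0&0\\1&0\end{pmatrix},\quad \sigma_x=\begin{pmatrix}0&1\\1&0\end{pmatrix},\quad E=\int|k|\,a^\dagger(k)a(k)\,d^dk .$$ Here $m>0$ is the gap of the two level system without photons, and $\alpha>0$ is the fine structure constant. The square root singularity means $f(k)=K\sqrt{1/|k|}$ for small $k$, with $K$ a constant. Under the condition $\alpha^2\mathcal E<m$ the ground state of $H_D(m,d,f,\alpha)$ has energy zero and projection $P=p\otimes\Omega$, and $P(s)=V(s)PV^\dagger(s)$. With dots denoting $d/ds$, $U_\tau(s)$ solves $i\,\dot U_\tau(s)=\tau H_D(s;m,d,f,\alpha)U_\tau(s)$, $U_\tau(0)=1$, and $U_A(s)$ solves $\dot U_A(s)=[\dot P(s),P(s)]U_A(s)$, $U_A(0)=1$, for $s\in[0,1]$. One is concerned with the limit of large $\tau$; $C$ is a constant. "Time scale" refers to the adiabatic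 time scale, which is compared with energies through its inverse (units with $\hbar=1$). The Lamb shift of the model is the real part of the shift from $m$ of the resonance energy $E_r$ in the sector where $N+p$ equals $1$ ($N$ the photon number); to leading order in $\alpha$, $E_r\approx m-\alpha^2\mathcal E$. *)

theory Defs
  imports "HOL-Complex_Analysis.Complex_Analysis" "HOL-Library.Landau_Symbols"
begin

section \<open>Complex inner product spaces\<close>

text \<open>The topology and the operator norm are those of the underlying real inner product space;
  the form is antilinear in its first argument.\<close>

class complex_inner = real_inner +
  fixes scaleC :: "complex \<Rightarrow> 'a \<Rightarrow> 'a" (infixr \<open>*\<^sub>C\<close> 75)
    and cinner :: "'a \<Rightarrow> 'a \<Rightarrow> complex"
  assumes scaleR_scaleC: "r *\<^sub>R x = complex_of_real r *\<^sub>C x"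
    and scaleC_add_right: "c *\<^sub>C (x + y) = c *\<^sub>C x + c *\<^sub>C y"
    and scaleC_add_left: "(b + c) *\<^sub>C x = b *\<^sub>C x + c *\<^sub>C x"
    and scaleC_scaleC: "b *\<^sub>C c *\<^sub>C x = (b * c) *\<^sub>C x"
    and cinner_commute: "cinner x y = cnj (cinner y x)"
    and cinner_add_right: "cinner x (y + z) = cinner x y + cinner x z"
    and cinner_scaleC_right: "cinner x (c *\<^sub>C y) = c * cinner x y"
    and inner_Re_cinner: "inner x y = Re (cinner x y)"

instantiation vec :: (complex_inner, finite) complex_inner
begin
definition "scaleC c (x :: 'a ^ 'b) = (\<chi> j. c *\<^sub>C (x $ j))"
definition "cinner (x :: 'a ^ 'b) y = (\<Sum>j\<in>UNIV. cinner (x $ j) (y $ j))"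
instance
proof
  fix r :: real and b c :: complex and x y z :: "'a ^ 'b"
  show "r *\<^sub>R x = complex_of_real r *\<^sub>C x"
    by (simp add: vec_eq_iff scaleC_vec_def scaleR_scaleC)
  show "c *\<^sub>C (x + y) = c *\<^sub>C x + c *\<^sub>C y"
    by (simp add: vec_eq_iff scaleC_vec_def scaleC_add_right)
  show "(b + c) *\<^sub>C x = b *\<^sub>C x + c *\<^sub>C x"
    by (simp add: vec_eq_iff scaleC_vec_def scaleC_add_left)
  show "b *\<^sub>C c *\<^sub>C x = (b * c) *\<^sub>C x"
    by (simp add: vec_eq_iff scaleC_vec_def scaleC_scaleC)
  show "cinner x y = cnj (cinner y x)"
    unfolding cinner_vec_def cnj_sum by (intro sum.cong refl cinner_commute)
  show "cinner x (y + z) = cinner x y + cinner x z"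
    by (simp add: cinner_vec_def cinner_add_right sum.distrib)
  show "cinner x (c *\<^sub>C y) = c * cinner x y"
    by (simp add: cinner_vec_def scaleC_vec_def cinner_scaleC_right sum_distrib_left)
  show "inner x y = Re (cinner x y)"
    by (simp add: cinner_vec_def inner_vec_def inner_Re_cinner)
qed
end


section \<open>Symmetric Fock space over the square integrable functions on momentum space\<close>

text \<open>A configuration of \<open>n\<close> photons with momenta in the Euclidean space \<open>'a\<close> is a function on
  the indices below \<open>n\<close> (undefined elsewhere).  A Fock vector is a sequence of symmetric square
  integrable wave functions, one for each photon number, modulo equality almost everywhere.\<close>

definition config :: "nat \<Rightarrow> (nat \<Rightarrow> 'a::euclidean_space) measure" where
  "config n = (\<Pi>\<^sub>M i\<in>{..<n}. lborel)"

type_synonym 'a wave = "nat \<Rightarrow> (nat \<Rightarrow> 'a) \<Rightarrow> complex"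

definition square_integrable :: "'b measure \<Rightarrow> ('b \<Rightarrow> complex) \<Rightarrow> bool" where
  "square_integrable M f \<longleftrightarrow>
     f \<in> borel_measurable M \<and> integrable M (\<lambda>x. (cmod (f x))\<^sup>2)"

definition fock_wave :: "('a::euclidean_space) wave \<Rightarrow> bool" where
  "fock_wave \<psi> \<longleftrightarrow>
     (\<forall>n. square_integrable (config n) (\<psi> n)) \<and>
     (\<forall>n \<pi>. \<pi> permutes {..<n} \<longrightarrow> (AE k in config n. \<psi> n (k \<circ> \<pi>) = \<psi> n k)) \<and>
     summable (\<lambda>n. \<integral>k. (cmod (\<psi> n k))\<^sup>2 \<partial>config n)"

definition fock_eq :: "('a::euclidean_space) wave \<Rightarrow> 'a wave \<Rightarrow> bool" where
  "fock_eq \<phi> \<psi> \<longleftrightarrow> fock_wave \<phi> \<and> fock_wave \<psi> \<and> (\<forall>n. AE k in config n. \<phi> n k = \<psi> n k)"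

definition wave_inner :: "('a::euclidean_space) wave \<Rightarrow> 'a wave \<Rightarrow> complex" where
  "wave_inner \<phi> \<psi> = (\<Sum>n. \<integral>k. cnj (\<phi> n k) * \<psi> n k \<partial>config n)"

lemma square_integrable_0: "square_integrable M (\<lambda>_. 0)"
  by (simp add: square_integrable_def)

lemma cmod_add_sq_le: "(cmod (a + b))\<^sup>2 \<le> 2 * (cmod a)\<^sup>2 + 2 * (cmod b)\<^sup>2"
proof -
  have "(cmod (a + b))\<^sup>2 \<le> (cmod a + cmod b)\<^sup>2"
    by (intro power_mono norm_triangle_ineq) auto
  also have "\<dots> \<le> 2 * (cmod a)\<^sup>2 + 2 * (cmod b)\<^sup>2"
    using zero_le_power2[of "cmod a - cmod b"] by (simp add: power2_eq_square algebra_simps)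
  finally show ?thesis .
qed

lemma cmod_cnj_mult_le: "cmod (cnj a * b) \<le> (cmod a)\<^sup>2 + (cmod b)\<^sup>2"
proof -
  have "0 \<le> (cmod a - cmod b)\<^sup>2" "0 \<le> (cmod a)\<^sup>2" "0 \<le> (cmod b)\<^sup>2" by auto
  then have "cmod a * cmod b \<le> (cmod a)\<^sup>2 + (cmod b)\<^sup>2"
    unfolding power2_diff by linarith
  then show ?thesis by (simp add: norm_mult)
qed

lemma square_integrable_add:
  assumes "square_integrable M f" "square_integrable M g"
  shows "square_integrable M (\<lambda>x. f x + g x)"
proof -
  have [measurable]: "f \<in> borel_measurable M" "g \<in> borel_measurable M"
    using assms by (auto simp: square_integrable_def)
  have "integrable M (\<lambda>x. 2 * (cmod (f x))\<^sup>2 + 2 * (cmod (g x))\<^sup>2)"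
    using assms by (auto simp: square_integrable_def)
  then have "integrable M (\<lambda>x. (cmod (f x + g x))\<^sup>2)"
    by (rule Bochner_Integration.integrable_bound) (auto intro: cmod_add_sq_le)
  then show ?thesis by (simp add: square_integrable_def)
qed

lemma square_integrable_mult:
  "square_integrable M f \<Longrightarrow> square_integrable M (\<lambda>x. c * f x)"
  by (auto simp: square_integrable_def norm_mult power_mult_distrib)

lemma square_integrable_cnj_mult:
  assumes "square_integrable M f" "square_integrable M g"
  shows "integrable M (\<lambda>x. cnj (f x) * g x)"
    and "cmod (\<integral>x. cnj (f x) * g x \<partial>M) \<le> (\<integral>x. (cmod (f x))\<^sup>2 \<partial>M) + (\<integral>x. (cmod (g x))\<^sup>2 \<partial>M)"
proof -
  have [measurable]: "f \<in> borel_measurable M" "g \<in> borel_measurable M"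
    and i: "integrable M (\<lambda>x. (cmod (f x))\<^sup>2)" "integrable M (\<lambda>x. (cmod (g x))\<^sup>2)"
    using assms by (auto simp: square_integrable_def)
  have s: "integrable M (\<lambda>x. (cmod (f x))\<^sup>2 + (cmod (g x))\<^sup>2)"
    using i by auto
  have [measurable]: "(\<lambda>x. cnj (f x)) \<in> borel_measurable M"
    by (rule borel_measurable_continuous_on[of cnj]) (auto intro: continuous_intros)
  show *: "integrable M (\<lambda>x. cnj (f x) * g x)"
    by (rule Bochner_Integration.integrable_bound[OF s])
      (auto intro!: order_trans[OF cmod_cnj_mult_le])
  have "cmod (\<integral>x. cnj (f x) * g x \<partial>M) \<le> (\<integral>x. (cmod (f x))\<^sup>2 + (cmod (g x))\<^sup>2 \<partial>M)"
    by (intro order_trans[OF integral_norm_bound] integral_mono integrable_norm * s cmod_cnj_mult_le)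
  then show "cmod (\<integral>x. cnj (f x) * g x \<partial>M) \<le> (\<integral>x. (cmod (f x))\<^sup>2 \<partial>M) + (\<integral>x. (cmod (g x))\<^sup>2 \<partial>M)"
    using i by simp
qed

lemma fock_wave_0: "fock_wave (\<lambda>_ _. 0)"
  by (simp add: fock_wave_def square_integrable_0)

lemma fock_wave_add:
  assumes "fock_wave \<phi>" "fock_wave \<psi>"
  shows "fock_wave (\<lambda>n k. \<phi> n k + \<psi> n k)"
  unfolding fock_wave_def
proof (intro conjI allI impI)
  fix n
  show "square_integrable (config n) (\<lambda>k. \<phi> n k + \<psi> n k)"
    using assms by (auto simp: fock_wave_def intro: square_integrable_add)
next
  fix n \<pi> assume "\<pi> permutes {..<n::nat}"
  then have "AE k in config n. \<phi> n (k \<circ> \<pi>) = \<phi> n k" "AE k in config n. \<psi> n (k \<circ> \<pi>) = \<psi> n k"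
    using assms by (auto simp: fock_wave_def)
  then show "AE k in config n. \<phi> n (k \<circ> \<pi>) + \<psi> n (k \<circ> \<pi>) = \<phi> n k + \<psi> n k"
    by eventually_elim simp
next
  have s: "summable (\<lambda>n. 2 * (\<integral>k. (cmod (\<phi> n k))\<^sup>2 \<partial>config n) + 2 * (\<integral>k. (cmod (\<psi> n k))\<^sup>2 \<partial>config n))"
    using assms by (intro summable_add summable_mult) (auto simp: fock_wave_def)
  show "summable (\<lambda>n. \<integral>k. (cmod (\<phi> n k + \<psi> n k))\<^sup>2 \<partial>config n)"
  proof (rule summable_comparison_test'[OF s, of 0])
    fix n
    have i: "integrable (config n) (\<lambda>k. (cmod (\<phi> n k))\<^sup>2)" "integrable (config n) (\<lambda>k. (cmod (\<psi> n k))\<^sup>2)"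
      "integrable (config n) (\<lambda>k. (cmod (\<phi> n k + \<psi> n k))\<^sup>2)"
      using assms square_integrable_add[of "config n" "\<phi> n" "\<psi> n"]
      unfolding fock_wave_def square_integrable_def by blast+
    have "(\<integral>k. (cmod (\<phi> n k + \<psi> n k))\<^sup>2 \<partial>config n)
        \<le> (\<integral>k. 2 * (cmod (\<phi> n k))\<^sup>2 + 2 * (cmod (\<psi> n k))\<^sup>2 \<partial>config n)"
      using i by (intro integral_mono cmod_add_sq_le) auto
    then show "norm (\<integral>k. (cmod (\<phi> n k + \<psi> n k))\<^sup>2 \<partial>config n)
        \<le> 2 * (\<integral>k. (cmod (\<phi> n k))\<^sup>2 \<partial>config n) + 2 * (\<integral>k. (cmod (\<psi> n k))\<^sup>2 \<partial>config n)"
      using i by (simp add: integral_nonneg_AE)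
  qed
qed

lemma fock_wave_mult:
  assumes "fock_wave \<psi>"
  shows "fock_wave (\<lambda>n k. c * \<psi> n k)"
proof -
  have "AE k in config n. c * \<psi> n (k \<circ> \<pi>) = c * \<psi> n k" if "\<pi> permutes {..<n}" for n \<pi>
  proof -
    have "AE k in config n. \<psi> n (k \<circ> \<pi>) = \<psi> n k"
      using assms that by (auto simp: fock_wave_def)
    then show ?thesis by eventually_elim simp
  qed
  then show ?thesis
    using assms
    by (auto simp: fock_wave_def norm_mult power_mult_distrib
        intro: square_integrable_mult summable_mult simp del: mult_cancel_left)
qed

lemma wave_inner_summable:
  assumes "fock_wave \<phi>" "fock_wave \<psi>"
  shows "summable (\<lambda>n. \<integral>k. cnj (\<phi> n k) * \<psi> n k \<partial>config n)"
proof (rule summable_comparison_test')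
  show "summable (\<lambda>n. (\<integral>k. (cmod (\<phi> n k))\<^sup>2 \<partial>config n) + (\<integral>k. (cmod (\<psi> n k))\<^sup>2 \<partial>config n))"
    using assms by (intro summable_add) (auto simp: fock_wave_def)
  show "norm (\<integral>k. cnj (\<phi> n k) * \<psi> n k \<partial>config n)
      \<le> (\<integral>k. (cmod (\<phi> n k))\<^sup>2 \<partial>config n) + (\<integral>k. (cmod (\<psi> n k))\<^sup>2 \<partial>config n)" for n
    using assms by (intro square_integrable_cnj_mult) (auto simp: fock_wave_def)
qed

lemma wave_inner_cong:
  assumes "fock_eq \<phi> \<phi>'" "fock_eq \<psi> \<psi>'"
  shows "wave_inner \<phi> \<psi> = wave_inner \<phi>' \<psi>'"
  unfolding wave_inner_def
proof (intro suminf_cong)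
  fix n
  have [measurable]: "\<phi> n \<in> borel_measurable (config n)" "\<psi> n \<in> borel_measurable (config n)"
    "\<phi>' n \<in> borel_measurable (config n)" "\<psi>' n \<in> borel_measurable (config n)"
    using assms by (auto simp: fock_eq_def fock_wave_def square_integrable_def)
  have i: "integrable (config n) (\<lambda>k. cnj (\<phi> n k) * \<psi> n k)"
    "integrable (config n) (\<lambda>k. cnj (\<phi>' n k) * \<psi>' n k)"
    using assms by (auto simp: fock_eq_def fock_wave_def intro: square_integrable_cnj_mult)
  have "AE k in config n. \<phi> n k = \<phi>' n k" "AE k in config n. \<psi> n k = \<psi>' n k"
    using assms by (auto simp: fock_eq_def)
  then have "AE k in config n. cnj (\<phi> n k) * \<psi> n k = cnj (\<phi>' n k) * \<psi>' n k"
    by eventually_elim simp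
  then show "(\<integral>k. cnj (\<phi> n k) * \<psi> n k \<partial>config n) = (\<integral>k. cnj (\<phi>' n k) * \<psi>' n k \<partial>config n)"
    using i by (intro integral_cong_AE) auto
qed

quotient_type (overloaded) 'a fock = "('a::euclidean_space) wave" / partial: fock_eq
proof (rule part_equivpI)
  show "\<exists>x :: 'a wave. fock_eq x x"
    by (rule exI[of _ "\<lambda>_ _. 0"]) (simp add: fock_eq_def fock_wave_0)
  show "symp (fock_eq :: 'a wave \<Rightarrow> _)"
  proof (rule sympI)
    fix x y :: "'a wave" assume a: "fock_eq x y"
    have "AE k in config n. y n k = x n k" for n
    proof -
      have "AE k in config n. x n k = y n k" using a by (auto simp: fock_eq_def)
      then show ?thesis by eventually_elim simp
    qed
    with a show "fock_eq y x" by (auto simp: fock_eq_def)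
  qed
  show "transp (fock_eq :: 'a wave \<Rightarrow> _)"
  proof (rule transpI)
    fix x y z :: "'a wave" assume a: "fock_eq x y" "fock_eq y z"
    have "AE k in config n. x n k = z n k" for n
    proof -
      have "AE k in config n. x n k = y n k" "AE k in config n. y n k = z n k"
        using a by (auto simp: fock_eq_def)
      then show ?thesis by eventually_elim simp
    qed
    with a show "fock_eq x z" by (auto simp: fock_eq_def)
  qed
qed

lemma fock_eq_add:
  assumes "fock_eq \<phi> \<phi>'" "fock_eq \<psi> \<psi>'"
  shows "fock_eq (\<lambda>n k. \<phi> n k + \<psi> n k) (\<lambda>n k. \<phi>' n k + \<psi>' n k)"
proof -
  have "AE k in config n. \<phi> n k + \<psi> n k = \<phi>' n k + \<psi>' n k" for n
  proof -
    have "AE k in config n. \<phi> n k = \<phi>' n k" "AE k in config n. \<psi> n k = \<psi>' n k"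
      using assms by (auto simp: fock_eq_def)
    then show ?thesis by eventually_elim simp
  qed
  with assms show ?thesis by (auto simp: fock_eq_def intro: fock_wave_add)
qed

lemma fock_eq_mult:
  assumes "fock_eq \<psi> \<psi>'"
  shows "fock_eq (\<lambda>n k. c * \<psi> n k) (\<lambda>n k. c * \<psi>' n k)"
proof -
  have "AE k in config n. c * \<psi> n k = c * \<psi>' n k" for n
  proof -
    have "AE k in config n. \<psi> n k = \<psi>' n k"
      using assms by (auto simp: fock_eq_def)
    then show ?thesis by eventually_elim simp
  qed
  with assms show ?thesis by (auto simp: fock_eq_def intro: fock_wave_mult)
qed

lemma wave_inner_commute:
  assumes "fock_wave \<phi>" "fock_wave \<psi>"
  shows "wave_inner \<phi> \<psi> = cnj (wave_inner \<psi> \<phi>)"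
proof -
  have "(\<integral>k. cnj (\<phi> n k) * \<psi> n k \<partial>config n) = cnj (\<integral>k. cnj (\<psi> n k) * \<phi> n k \<partial>config n)" for n
    by (subst Bochner_Integration.integral_cnj[symmetric]) (simp add: mult.commute)
  then show ?thesis
    unfolding wave_inner_def
    using bounded_linear.suminf[OF bounded_linear_cnj wave_inner_summable[OF assms(2,1)]] by simp
qed

lemma wave_inner_add_right:
  assumes "fock_wave \<phi>" "fock_wave \<psi>" "fock_wave \<eta>"
  shows "wave_inner \<phi> (\<lambda>n k. \<psi> n k + \<eta> n k) = wave_inner \<phi> \<psi> + wave_inner \<phi> \<eta>"
proof -
  have "(\<integral>k. cnj (\<phi> n k) * (\<psi> n k + \<eta> n k) \<partial>config n)
      = (\<integral>k. cnj (\<phi> n k) * \<psi> n k \<partial>config n) + (\<integral>k. cnj (\<phi> n k) * \<eta> n k \<partial>config n)" for n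
    unfolding distrib_left using assms
    by (intro Bochner_Integration.integral_add square_integrable_cnj_mult) (auto simp: fock_wave_def)
  then show ?thesis
    unfolding wave_inner_def using assms by (simp add: suminf_add wave_inner_summable)
qed

lemma wave_inner_mult_right:
  assumes "fock_wave \<phi>" "fock_wave \<psi>"
  shows "wave_inner \<phi> (\<lambda>n k. c * \<psi> n k) = c * wave_inner \<phi> \<psi>"
proof -
  have "(\<integral>k. cnj (\<phi> n k) * (c * \<psi> n k) \<partial>config n) = c * (\<integral>k. cnj (\<phi> n k) * \<psi> n k \<partial>config n)" for n
    by (simp add: mult.left_commute)
  then show ?thesis
    unfolding wave_inner_def using assms by (simp add: suminf_mult wave_inner_summable)
qed

lemma wave_inner_self:
  assumes "fock_wave \<psi>"
  shows "Re (wave_inner \<psi> \<psi>) = (\<Sum>n. \<integral>k. (cmod (\<psi> n k))\<^sup>2 \<partial>config n)"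
proof -
  have "(\<integral>k. cnj (\<psi> n k) * \<psi> n k \<partial>config n) = complex_of_real (\<integral>k. (cmod (\<psi> n k))\<^sup>2 \<partial>config n)" for n
    unfolding integral_complex_of_real[symmetric]
    by (simp only: complex_norm_square mult.commute)
  then have "wave_inner \<psi> \<psi> = (\<Sum>n. complex_of_real (\<integral>k. (cmod (\<psi> n k))\<^sup>2 \<partial>config n))"
    by (simp add: wave_inner_def)
  also have "\<dots> = complex_of_real (\<Sum>n. \<integral>k. (cmod (\<psi> n k))\<^sup>2 \<partial>config n)"
    using assms by (intro suminf_of_real[symmetric]) (auto simp: fock_wave_def)
  finally show ?thesis by simp
qed

lemma wave_inner_self_ge_0: "fock_wave \<psi> \<Longrightarrow> 0 \<le> Re (wave_inner \<psi> \<psi>)"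
  by (auto simp: wave_inner_self fock_wave_def intro!: suminf_nonneg integral_nonneg_AE)

lemma wave_inner_self_eq_0:
  assumes "fock_wave \<psi>"
  shows "Re (wave_inner \<psi> \<psi>) = 0 \<longleftrightarrow> fock_eq \<psi> (\<lambda>_ _. 0)"
proof -
  have "Re (wave_inner \<psi> \<psi>) = 0 \<longleftrightarrow> (\<forall>n. (\<integral>k. (cmod (\<psi> n k))\<^sup>2 \<partial>config n) = 0)"
    unfolding wave_inner_self[OF assms]
    using assms by (intro suminf_eq_zero_iff) (auto simp: fock_wave_def)
  also have "\<dots> \<longleftrightarrow> (\<forall>n. AE k in config n. \<psi> n k = 0)"
  proof (intro all_cong1)
    fix n
    have "integrable (config n) (\<lambda>k. (cmod (\<psi> n k))\<^sup>2)"
      using assms by (auto simp: fock_wave_def square_integrable_def)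
    then show "(\<integral>k. (cmod (\<psi> n k))\<^sup>2 \<partial>config n) = 0 \<longleftrightarrow> (AE k in config n. \<psi> n k = 0)"
      by (subst integral_nonneg_eq_0_iff_AE) auto
  qed
  also have "\<dots> \<longleftrightarrow> fock_eq \<psi> (\<lambda>_ _. 0)"
    using assms by (auto simp: fock_eq_def fock_wave_0)
  finally show ?thesis .
qed

instantiation fock :: (euclidean_space) complex_inner
begin

lift_definition zero_fock :: "'a fock" is "\<lambda>_ _. 0"
  by (simp add: fock_eq_def fock_wave_0)

lift_definition plus_fock :: "'a fock \<Rightarrow> 'a fock \<Rightarrow> 'a fock" is "\<lambda>\<phi> \<psi> n k. \<phi> n k + \<psi> n k"
  by (rule fock_eq_add)

lift_definition scaleC_fock :: "complex \<Rightarrow> 'a fock \<Rightarrow> 'a fock" is "\<lambda>c \<psi> n k. c * \<psi> n k"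
  by (rule fock_eq_mult)

lift_definition cinner_fock :: "'a fock \<Rightarrow> 'a fock \<Rightarrow> complex" is wave_inner
  by (rule wave_inner_cong)

definition "uminus_fock (\<psi> :: 'a fock) = (-1) *\<^sub>C \<psi>"
definition "minus_fock (\<phi> :: 'a fock) \<psi> = \<phi> + - \<psi>"
definition "scaleR_fock r (\<psi> :: 'a fock) = complex_of_real r *\<^sub>C \<psi>"
definition "inner_fock (\<phi> :: 'a fock) \<psi> = Re (cinner \<phi> \<psi>)"
definition "norm_fock (\<psi> :: 'a fock) = sqrt (inner \<psi> \<psi>)"
definition "sgn_fock (\<psi> :: 'a fock) = inverse (norm \<psi>) *\<^sub>R \<psi>"
definition "dist_fock (\<phi> :: 'a fock) \<psi> = norm (\<phi> - \<psi>)"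
definition [code del]: "(uniformity :: ('a fock \<times> 'a fock) filter) =
  (INF e\<in>{0 <..}. principal {(x, y). dist x y < e})"
definition [code del]: "open (U :: 'a fock set) \<longleftrightarrow>
  (\<forall>x\<in>U. eventually (\<lambda>(x', y). x' = x \<longrightarrow> y \<in> U) uniformity)"

instance
proof
  fix r s :: real and b c :: complex and x y z :: "'a fock"
  have eqI: "fock_eq v w" if "fock_wave v" "v = w" for v w :: "'a wave"
    using that by (simp add: fock_eq_def)
  have w: "fock_wave v" if "fock_eq v v" for v :: "'a wave"
    using that by (simp add: fock_eq_def)
  note W = fock_wave_0 fock_wave_add fock_wave_mult w
  have add_assoc: "x + y + z = x + (y + z)" for x y z :: "'a fock"
    by transfer (simp add: fock_eq_def fock_wave_0 fock_wave_add fock_wave_mult algebra_simps)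
  have add_comm: "x + y = y + x" for x y :: "'a fock"
    by transfer (simp add: fock_eq_def fock_wave_0 fock_wave_add fock_wave_mult algebra_simps)
  have zero_add: "0 + x = x" for x :: "'a fock"
    by transfer (simp add: fock_eq_def fock_wave_0 fock_wave_add fock_wave_mult algebra_simps)
  have Cr: "c *\<^sub>C (x + y) = c *\<^sub>C x + c *\<^sub>C y" for c and x y :: "'a fock"
    by transfer (simp add: fock_eq_def fock_wave_0 fock_wave_add fock_wave_mult algebra_simps)
  have Cl: "(b + c) *\<^sub>C x = b *\<^sub>C x + c *\<^sub>C x" for b c and x :: "'a fock"
    by transfer (simp add: fock_eq_def fock_wave_0 fock_wave_add fock_wave_mult algebra_simps)
  have CC: "b *\<^sub>C c *\<^sub>C x = (b * c) *\<^sub>C x" for b c and x :: "'a fock"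
    by transfer (simp add: fock_eq_def fock_wave_0 fock_wave_add fock_wave_mult algebra_simps)
  have C1: "1 *\<^sub>C x = x" for x :: "'a fock"
    by transfer (simp add: fock_eq_def fock_wave_0 fock_wave_add fock_wave_mult algebra_simps)
  have C0: "0 *\<^sub>C x = 0" for x :: "'a fock"
    by transfer (simp add: fock_eq_def fock_wave_0 fock_wave_add fock_wave_mult algebra_simps)
  have neg: "- x + x = 0" for x :: "'a fock"
    unfolding uminus_fock_def using Cl[of "-1" 1 x] by (simp add: C0 C1)
  have comm: "cinner x y = cnj (cinner y x)" for x y :: "'a fock"
    by transfer (auto intro!: wave_inner_commute w)
  have addr: "cinner x (y + z) = cinner x y + cinner x z" for x y z :: "'a fock"
    by transfer (auto intro!: wave_inner_add_right w)
  have mulr: "cinner x (c *\<^sub>C y) = c * cinner x y" for c and x y :: "'a fock"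
    by transfer (auto intro!: wave_inner_mult_right w)
  show "x + y + z = x + (y + z)" by (rule add_assoc)
  show "x + y = y + x" by (rule add_comm)
  show "0 + x = x" by (rule zero_add)
  show "- x + x = 0" by (rule neg)
  show "x - y = x + - y" by (rule minus_fock_def)
  show "r *\<^sub>R (x + y) = r *\<^sub>R x + r *\<^sub>R y" by (simp add: scaleR_fock_def Cr)
  show "(r + s) *\<^sub>R x = r *\<^sub>R x + s *\<^sub>R x" by (simp add: scaleR_fock_def Cl)
  show "r *\<^sub>R s *\<^sub>R x = (r * s) *\<^sub>R x" by (simp add: scaleR_fock_def CC)
  show "1 *\<^sub>R x = x" by (simp add: scaleR_fock_def C1)
  show "sgn x = inverse (norm x) *\<^sub>R x" by (rule sgn_fock_def)
  show "dist x y = norm (x - y)" by (rule dist_fock_def)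
  show "(uniformity :: ('a fock \<times> 'a fock) filter)
      = (INF e\<in>{0 <..}. principal {(x, y). dist x y < e})"
    by (rule uniformity_fock_def)
  show "open U \<longleftrightarrow> (\<forall>x\<in>U. eventually (\<lambda>(x', y). x' = x \<longrightarrow> y \<in> U) uniformity)"
    for U :: "'a fock set" by (rule open_fock_def)
  show "inner x y = inner y x"
    unfolding inner_fock_def by (subst comm) simp
  show "inner (x + y) z = inner x z + inner y z"
    unfolding inner_fock_def by (subst (1 2 3) comm) (simp add: addr)
  show "inner (r *\<^sub>R x) y = r * inner x y"
    unfolding inner_fock_def scaleR_fock_def by (subst (1 2) comm) (simp add: mulr)
  show "0 \<le> inner x x"
    unfolding inner_fock_def by transfer (auto intro: wave_inner_self_ge_0 w)
  show "inner x x = 0 \<longleftrightarrow> x = 0"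
    unfolding inner_fock_def by transfer (auto simp: wave_inner_self_eq_0 w)
  show "norm x = sqrt (inner x x)" by (rule norm_fock_def)
  show "r *\<^sub>R x = complex_of_real r *\<^sub>C x" by (rule scaleR_fock_def)
  show "c *\<^sub>C (x + y) = c *\<^sub>C x + c *\<^sub>C y" by (rule Cr)
  show "(b + c) *\<^sub>C x = b *\<^sub>C x + c *\<^sub>C x" by (rule Cl)
  show "b *\<^sub>C c *\<^sub>C x = (b * c) *\<^sub>C x" by (rule CC)
  show "cinner x y = cnj (cinner y x)" by (rule comm)
  show "cinner x (y + z) = cinner x y + cinner x z" by (rule addr)
  show "cinner x (c *\<^sub>C y) = c * cinner x y" by (rule mulr)
  show "inner x y = Re (cinner x y)" by (rule inner_fock_def)
qed

end


section \<open>Partially defined operators\<close>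

datatype 'h operator = Operator (op_dom: "'h set") (op_app: "'h \<Rightarrow> 'h")

definition op_id :: "'h operator" where
  "op_id = Operator UNIV (\<lambda>\<psi>. \<psi>)"

definition op_add :: "'h::complex_inner operator \<Rightarrow> 'h operator \<Rightarrow> 'h operator" (infixl \<open>+\<^sub>o\<close> 65) where
  "A +\<^sub>o B = Operator (op_dom A \<inter> op_dom B) (\<lambda>\<psi>. op_app A \<psi> + op_app B \<psi>)"

definition op_scale :: "complex \<Rightarrow> 'h::complex_inner operator \<Rightarrow> 'h operator" (infixr \<open>*\<^sub>o\<close> 70) where
  "c *\<^sub>o A = Operator (op_dom A) (\<lambda>\<psi>. c *\<^sub>C op_app A \<psi>)"

text \<open>The tensor product of \<open>\<complex>\<^sup>2\<close> with a space \<open>'h\<close> is \<open>'h ^ 2\<close>.  In \<open>M \<otimes> A\<close> only the components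
  that \<open>M\<close> couples have to be in the domain of \<open>A\<close>.\<close>

definition op_tensor :: "complex^2^2 \<Rightarrow> 'h::complex_inner operator \<Rightarrow> ('h ^ 2) operator"
    (infixr \<open>\<otimes>\<^sub>o\<close> 75) where
  "M \<otimes>\<^sub>o A = Operator {\<psi>. \<forall>i j. M $ i $ j \<noteq> 0 \<longrightarrow> \<psi> $ j \<in> op_dom A}
     (\<lambda>\<psi>. \<chi> i. \<Sum>j\<in>UNIV. M $ i $ j *\<^sub>C op_app A (\<psi> $ j))"

text \<open>To be used only for everywhere defined bounded operators.\<close>

definition bounded_op :: "'h::complex_inner operator \<Rightarrow> 'h \<Rightarrow>\<^sub>L 'h" where
  "bounded_op A = Blinfun (op_app A)"

definition bounded_adjoint :: "('h::complex_inner \<Rightarrow>\<^sub>L 'h) \<Rightarrow> 'h \<Rightarrow>\<^sub>L 'h" where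
  "bounded_adjoint A = Blinfun (adjoint (blinfun_apply A))"

definition bounded_exp :: "('h::complex_inner \<Rightarrow>\<^sub>L 'h) \<Rightarrow> 'h \<Rightarrow>\<^sub>L 'h" where
  "bounded_exp A = (\<Sum>n. (((\<lambda>B. A o\<^sub>L B) ^^ n) id_blinfun) /\<^sub>R fact n)"

definition op_conj :: "('h::complex_inner \<Rightarrow>\<^sub>L 'h) \<Rightarrow> 'h operator \<Rightarrow> 'h operator" where
  "op_conj V A = Operator {\<psi>. blinfun_apply (bounded_adjoint V) \<psi> \<in> op_dom A}
     (\<lambda>\<psi>. blinfun_apply V (op_app A (blinfun_apply (bounded_adjoint V) \<psi>)))"

definition blinfun_commutator :: "('h::complex_inner \<Rightarrow>\<^sub>L 'h) \<Rightarrow> ('h \<Rightarrow>\<^sub>L 'h) \<Rightarrow> 'h \<Rightarrow>\<^sub>L 'h" where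
  "blinfun_commutator A B = (A o\<^sub>L B) - (B o\<^sub>L A)"


section \<open>Field operators\<close>

text \<open>An operation on wave functions induces an operator on Fock space whose domain is the maximal
  one: the vectors that it maps to a wave function of finite norm.\<close>

definition wave_op :: "('a::euclidean_space wave \<Rightarrow> 'a wave) \<Rightarrow> 'a fock operator" where
  "wave_op T = Operator {\<psi>. fock_wave (T (rep_fock \<psi>))} (\<lambda>\<psi>. abs_fock (T (rep_fock \<psi>)))"

definition skip :: "nat \<Rightarrow> (nat \<Rightarrow> 'a) \<Rightarrow> nat \<Rightarrow> 'a" where
  "skip j k = (\<lambda>i. if i < j then k i else k (Suc i))"

text \<open>\<open>case_nat q k\<close> is the configuration \<open>(q, k 0, k 1, \<dots>)\<close>.\<close>

definition annihilation :: "('a::euclidean_space \<Rightarrow> complex) \<Rightarrow> 'a fock operator" where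
  "annihilation f = wave_op (\<lambda>\<psi> n k.
     complex_of_real (sqrt (real (Suc n))) * (\<integral>q. cnj (f q) * \<psi> (Suc n) (case_nat q k) \<partial>lborel))"

definition creation :: "('a::euclidean_space \<Rightarrow> complex) \<Rightarrow> 'a fock operator" where
  "creation f = wave_op (\<lambda>\<psi> n k. case n of 0 \<Rightarrow> 0
     | Suc l \<Rightarrow> (\<Sum>j\<le>l. f (k j) * \<psi> l (skip j k)) / complex_of_real (sqrt (real n)))"

text \<open>The second quantization \<open>\<integral> |k| a\<^sup>\<dagger>(k) a(k) dk\<close>.\<close>

definition field_energy :: "'a::euclidean_space fock operator" where
  "field_energy = wave_op (\<lambda>\<psi> n k. complex_of_real (\<Sum>i<n. norm (k i)) * \<psi> n k)"

definition vacuum :: "'a::euclidean_space fock" where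
  "vacuum = abs_fock (\<lambda>n k. if n = 0 then 1 else 0)"

definition vacuum_proj :: "'a::euclidean_space fock operator" where
  "vacuum_proj = Operator UNIV (\<lambda>\<psi>. cinner vacuum \<psi> *\<^sub>C vacuum)"


section \<open>The Dicke model\<close>

definition p_mat :: "complex^2^2" where
  "p_mat = vector [vector [1, 0], vector [0, 0]]"

definition sigma_plus :: "complex^2^2" where
  "sigma_plus = vector [vector [0, 1], vector [0, 0]]"

definition sigma_minus :: "complex^2^2" where
  "sigma_minus = vector [vector [0, 0], vector [1, 0]]"

definition sigma_x :: "complex^2^2" where
  "sigma_x = vector [vector [0, 1], vector [1, 0]]"

definition dicke :: "real \<Rightarrow> ('a::euclidean_space \<Rightarrow> complex) \<Rightarrow> real \<Rightarrow> ('a fock ^ 2) operator" where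
  "dicke m f \<alpha> =
     complex_of_real m *\<^sub>o ((mat 1 - p_mat) \<otimes>\<^sub>o op_id)
     +\<^sub>o complex_of_real (inverse \<alpha>) *\<^sub>o (mat 1 \<otimes>\<^sub>o field_energy)
     +\<^sub>o complex_of_real (sqrt \<alpha>) *\<^sub>o (sigma_plus \<otimes>\<^sub>o creation f)
     +\<^sub>o complex_of_real (sqrt \<alpha>) *\<^sub>o (sigma_minus \<otimes>\<^sub>o annihilation f)"

definition rotation :: "real \<Rightarrow> ('a::euclidean_space fock ^ 2) \<Rightarrow>\<^sub>L ('a fock ^ 2)" where
  "rotation s = bounded_exp (bounded_op ((\<i> * complex_of_real s) *\<^sub>o (sigma_x \<otimes>\<^sub>o op_id)))"

definition dicke_at :: "real \<Rightarrow> real \<Rightarrow> ('a::euclidean_space \<Rightarrow> complex) \<Rightarrow> real \<Rightarrow> ('a fock ^ 2) operator" where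
  "dicke_at s m f \<alpha> = op_conj (rotation s) (dicke m f \<alpha>)"

definition ground_proj :: "real \<Rightarrow> ('a::euclidean_space fock ^ 2) \<Rightarrow>\<^sub>L ('a fock ^ 2)" where
  "ground_proj s =
     rotation s o\<^sub>L bounded_op (p_mat \<otimes>\<^sub>o vacuum_proj) o\<^sub>L bounded_adjoint (rotation s)"

text \<open>The generator is unbounded, so the Schroedinger equation is required strongly, for initial
  data in the domain of \<open>A 0\<close>.  For symmetric, densely defined \<open>A s\<close> this determines \<open>U\<close>.\<close>

definition schroedinger_evolution ::
    "(real \<Rightarrow> 'h::complex_inner operator) \<Rightarrow> real \<Rightarrow> (real \<Rightarrow> 'h \<Rightarrow>\<^sub>L 'h) \<Rightarrow> bool" where
  "schroedinger_evolution A \<tau> U \<longleftrightarrow>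
     U 0 = id_blinfun \<and>
     (\<forall>\<psi> \<in> op_dom (A 0). \<forall>s\<in>{0..1}.
        blinfun_apply (U s) \<psi> \<in> op_dom (A s) \<and>
        (\<exists>D. ((\<lambda>t. blinfun_apply (U t) \<psi>) has_vector_derivative D) (at s within {0..1}) \<and>
             \<i> *\<^sub>C D = \<tau> *\<^sub>R op_app (A s) (blinfun_apply (U s) \<psi>)))"

definition adiabatic_evolution ::
    "(real \<Rightarrow> 'h::complex_inner \<Rightarrow>\<^sub>L 'h) \<Rightarrow> (real \<Rightarrow> 'h \<Rightarrow>\<^sub>L 'h) \<Rightarrow> bool" where
  "adiabatic_evolution P U \<longleftrightarrow>
     U 0 = id_blinfun \<and>
     (\<forall>s\<in>{0..1}. (U has_vector_derivative
        (blinfun_commutator (vector_derivative P (at s)) (P s) o\<^sub>L U s)) (at s within {0..1}))"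

definition sqrt_singularity :: "('a::euclidean_space \<Rightarrow> complex) \<Rightarrow> bool" where
  "sqrt_singularity f \<longleftrightarrow>
     (\<exists>K. \<exists>r>0. \<forall>k. 0 < norm k \<and> norm k < r \<longrightarrow> f k = K * complex_of_real (sqrt (1 / norm k)))"

definition coupling_energy :: "('a::euclidean_space \<Rightarrow> complex) \<Rightarrow> real" where
  "coupling_energy f = (\<integral>k. (cmod (f k))\<^sup>2 / norm k \<partial>lborel)"

text \<open>A time, to be compared with energies through its inverse.\<close>

definition adiabatic_time_scale :: "real \<Rightarrow> ('a::euclidean_space \<Rightarrow> complex) \<Rightarrow> real \<Rightarrow> real" where
  "adiabatic_time_scale m f \<alpha> = 1 / (m - \<alpha>\<^sup>2 * coupling_energy f)"

definition adiabatic_rate :: "nat \<Rightarrow> real \<Rightarrow> real" where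
  "adiabatic_rate d \<tau> = (if d = 3 then sqrt (ln \<tau>) / \<tau> else 1 / \<tau>)"


section \<open>Resonance energy and Lamb shift\<close>

definition resolvent_element :: "'h::complex_inner operator \<Rightarrow> 'h \<Rightarrow> complex \<Rightarrow> complex" where
  "resolvent_element A v z = cinner v (THE \<psi>. \<psi> \<in> op_dom A \<and> op_app A \<psi> - z *\<^sub>C \<psi> = v)"

text \<open>\<open>E\<close> is a pole of the analytic continuation of \<open>\<langle>v|(A - z)\<^sup>-\<^sup>1|v\<rangle>\<close> from the upper half plane
  through a real neighbourhood of \<open>l\<close>.\<close>

definition resonance :: "'h::complex_inner operator \<Rightarrow> 'h \<Rightarrow> real \<Rightarrow> complex \<Rightarrow> bool" where
  "resonance A v l E \<longleftrightarrow>
     (\<exists>r>0. \<exists>g. E \<in> ball (complex_of_real l) r \<and>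
        g holomorphic_on (ball (complex_of_real l) r - {E}) \<and> is_pole g E \<and>
        (\<forall>z\<in>ball (complex_of_real l) r. 0 < Im z \<longrightarrow> g z = resolvent_element A v z))"

text \<open>The operator \<open>N + (1 - p)\<close> is conserved.  The sector where it equals 1 is spanned by the
  excited atom without photons and the states with one photon and the atom in its lower level.\<close>

definition excited_state :: "'a::euclidean_space fock ^ 2" where
  "excited_state = vector [0, vacuum]"

definition dicke_resonance :: "real \<Rightarrow> ('a::euclidean_space \<Rightarrow> complex) \<Rightarrow> (real \<Rightarrow> complex) \<Rightarrow> bool" where
  "dicke_resonance m f E \<longleftrightarrow>
     (\<forall>\<^sub>F \<alpha> in at_right 0. resonance (dicke m f \<alpha>) excited_state m (E \<alpha>)) \<and>
     (E \<longlongrightarrow> complex_of_real m) (at_right 0)"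

definition lamb_shift :: "real \<Rightarrow> complex \<Rightarrow> real" where
  "lamb_shift m E = Re (E - complex_of_real m)"

end

theory Submission
  imports Defs
begin

unbundle no fps_syntax

text \<open>
  Write \<open>g\<close> for the ground state (atom down, no photon), \<open>e\<close> for the excited atom without photons,
  \<open>V(s) = exp(i s \<sigma>\<^sub>x) = cos s + (i \<sigma>\<^sub>x) sin s\<close>, and \<open>\<E> = \<langle>f| 1/|k| |f\<rangle>\<close>.

  Since \<open>\<sigma>\<^sub>x\<close> flips the atom, \<open>P \<sigma>\<^sub>x P = 0\<close>, and the adiabatic evolution of \<open>g\<close>
  is exactly \<open>V(s) g\<close> (\<open>adiabatic_evolution_on_ground_state\<close>).  The Schroedinger equation sees the
  velocity \<open>V(s) i \<sigma>\<^sub>x g = i V(s) e\<close> as an error.  If \<open>H \<psi> = e\<close>, subtracting \<open>V(s) \<psi> / \<tau>\<close> cancels this error: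
  \<open>V(s) (g - \<psi>/\<tau>)\<close> solves the equation up to a defect of size \<open>\<parallel>\<psi>\<parallel>/\<tau>\<close>, and as the generator
  is symmetric a defect moves the solution by at most its size (\<open>energy_estimate\<close>,
  \<open>schroedinger_near_rotated_state\<close>).  The equation \<open>H \<psi> = e\<close> lives in the sector spanned by \<open>e\<close> and
  the one photon states over \<open>g\<close>.  There \<open>\<psi> = a e + \<phi>\<close> with \<open>a = 1 / (m - \<alpha>\<^sup>2 \<E>)\<close>, the time scale of
  the theorem, and \<open>\<phi> = - \<alpha>\<^bsup>3/2\<^esup> a f / |k|\<close>.  The function \<open>f / |k|\<close> is square integrable for \<open>d > 3\<close>.
  For \<open>d = 3\<close> it misses square integrability by a logarithm: cutting \<open>\<phi>\<close> off at \<open>|k| \<le> 1/\<tau>\<close>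
  gives a norm of order \<open>\<surd>(log \<tau>)\<close> and leaves a residue \<open>H \<psi> - e\<close> of order \<open>1/\<tau>\<close>
  (\<open>adiabatic_estimate_with_cutoff\<close>, \<open>adiabatic_bound\<close>).

  For the Lamb shift, solving \<open>(H - z) \<psi> = e\<close> in the same sector gives
  \<open>\<langle>e| (H - z)\<^sup>-\<^sup>1 |e\<rangle> = 1 / (m - z - \<alpha>\<^sup>2 S(\<alpha> z))\<close> with the self energy \<open>S(w) = \<langle>f| 1/(|k| - w) |f\<rangle>\<close>
  (\<open>resolvent_element_dicke\<close>).  On the small momenta, \<open>|f|\<^sup>2 = |K|\<^sup>2/|k|\<close> makes \<open>S\<close> a radial integral of
  \<open>\<rho>\<^bsup>d-2\<^esup> / (\<rho> - w)\<close>, which is a polynomial plus \<open>w\<^bsup>d-2\<^esup>\<close> times a logarithm; hence \<open>S\<close> continues from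
  the upper half plane across the real axis near \<open>0\<close> and tends to \<open>\<E>\<close> at \<open>0\<close>
  (\<open>continued_self_energy_holomorphic\<close>, \<open>continued_self_energy_tendsto\<close>).  The resonances are the zeros
  of \<open>m - z - \<alpha>\<^sup>2 S(\<alpha> z)\<close>: one exists by contraction (\<open>characteristic_zero_exists\<close>), and every resonance
  is one by the identity theorem (\<open>resonance_zero\<close>).  So \<open>E\<^sub>r = m - \<alpha>\<^sup>2 S(\<alpha> E\<^sub>r) = m - \<alpha>\<^sup>2 \<E> + o(\<alpha>\<^sup>2)\<close>.
\<close>

section \<open>Complex inner product spaces\<close>

lemma scaleC_one [simp]: "1 *\<^sub>C x = (x :: 'h::complex_inner)"
  using scaleR_scaleC[of 1 x] by simp

lemma scaleC_zero_left [simp]: "0 *\<^sub>C x = (0 :: 'h::complex_inner)"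
  using scaleR_scaleC[of 0 x] by simp

lemma scaleC_zero_right [simp]: "c *\<^sub>C 0 = (0 :: 'h::complex_inner)"
  using scaleC_add_right[of c 0 0] by simp

lemma scaleC_minus_right: "c *\<^sub>C (- x) = - (c *\<^sub>C (x :: 'h::complex_inner))"
  using scaleC_add_right[of c x "- x"] by (simp add: eq_neg_iff_add_eq_0 add.commute)

lemma scaleC_minus_left: "(- c) *\<^sub>C x = - (c *\<^sub>C (x :: 'h::complex_inner))"
  using scaleC_add_left[of c "- c" x] by (simp add: eq_neg_iff_add_eq_0 add.commute)

lemma scaleC_diff_right: "c *\<^sub>C (x - y) = c *\<^sub>C x - c *\<^sub>C (y :: 'h::complex_inner)"
  using scaleC_add_right[of c x "- y"] by (simp add: scaleC_minus_right)

lemma scaleC_scaleR: "c *\<^sub>C r *\<^sub>R x = r *\<^sub>R c *\<^sub>C (x :: 'h::complex_inner)"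
  by (simp add: scaleR_scaleC scaleC_scaleC mult.commute)

lemma cinner_scaleC_left: "cinner (c *\<^sub>C x) y = cnj c * cinner x (y :: 'h::complex_inner)"
  by (subst (1 2) cinner_commute) (simp add: cinner_scaleC_right)

lemma cinner_add_left: "cinner (x + y) z = cinner x z + cinner y (z :: 'h::complex_inner)"
  by (subst (1 2 3) cinner_commute) (simp add: cinner_add_right)

lemma cinner_diff_right: "cinner x (y - z) = cinner x y - cinner x (z :: 'h::complex_inner)"
  using cinner_add_right[of x "y - z" z] by simp

lemma cinner_diff_left: "cinner (x - y) z = cinner x z - cinner y (z :: 'h::complex_inner)"
  using cinner_add_left[of "x - y" y z] by simp

lemma cinner_scaleR_right: "cinner x (r *\<^sub>R y) = of_real r * cinner x (y :: 'h::complex_inner)"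
  by (simp add: scaleR_scaleC cinner_scaleC_right)

lemma cinner_scaleR_left: "cinner (r *\<^sub>R x) y = of_real r * cinner x (y :: 'h::complex_inner)"
  by (simp add: scaleR_scaleC cinner_scaleC_left)

lemma cinner_zero [simp]: "cinner 0 x = 0" "cinner x (0 :: 'h::complex_inner) = 0"
  using cinner_scaleC_left[of 0 0 x] cinner_scaleC_right[of x 0 0] by simp_all

lemma Im_cinner_self: "Im (cinner x (x :: 'h::complex_inner)) = 0"
  by (metis cinner_commute cnj.simps(2) neg_equal_zero)

lemma cinner_self: "cinner x (x :: 'h::complex_inner) = of_real ((norm x)\<^sup>2)"
  by (simp add: complex_eq_iff Im_cinner_self power2_norm_eq_inner inner_Re_cinner)

lemma norm_scaleC [simp]: "norm (c *\<^sub>C x) = cmod c * norm (x :: 'h::complex_inner)"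
proof -
  have "cinner (c *\<^sub>C x) (c *\<^sub>C x) = of_real ((cmod c * norm x)\<^sup>2)"
    unfolding cinner_scaleC_left cinner_scaleC_right cinner_self[of x]
    by (simp add: power_mult_distrib complex_norm_square mult_ac del: of_real_power)
  then have "(norm (c *\<^sub>C x))\<^sup>2 = (cmod c * norm x)\<^sup>2"
    unfolding cinner_self of_real_eq_iff .
  then show ?thesis by (simp add: power2_eq_iff_nonneg)
qed

lemma norm_cinner_le: "cmod (cinner x y) \<le> norm x * norm (y :: 'h::complex_inner)"
proof -
  define c where "c = cnj (sgn (cinner x y))"
  have "complex_of_real (cmod (cinner x y)) = c * cinner x y"
    by (simp add: c_def sgn_eq complex_norm_square[symmetric] power2_eq_square field_simps)
  also have "\<dots> = cinner x (c *\<^sub>C y)" by (simp add: cinner_scaleC_right)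
  finally have "cmod (cinner x y) = inner x (c *\<^sub>C y)"
    by (metis Re_complex_of_real inner_Re_cinner)
  also have "\<dots> \<le> norm x * norm (c *\<^sub>C y)" by (rule norm_cauchy_schwarz)
  also have "\<dots> \<le> norm x * norm y"
    by (auto simp: c_def norm_sgn mult_le_0_iff)
  finally show ?thesis .
qed

lemma norm_vec2_sq: "(norm (x :: 'h::real_inner ^ 2))\<^sup>2 = (norm (x $ 1))\<^sup>2 + (norm (x $ 2))\<^sup>2"
  by (simp add: power2_norm_eq_inner inner_vec_def UNIV_2)

lemma cinner_vec2: "cinner (x :: 'h::complex_inner ^ 2) y = cinner (x $ 1) (y $ 1) + cinner (x $ 2) (y $ 2)"
  by (simp add: cinner_vec_def UNIV_2)

lemma vec2_eq_iff: "(x :: 'h ^ 2) = y \<longleftrightarrow> x $ 1 = y $ 1 \<and> x $ 2 = y $ 2"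
  by (auto simp: vec_eq_iff forall_2)

lemma scaleC_vec_nth [simp]: "(c *\<^sub>C (x :: 'h::complex_inner ^ 2)) $ j = c *\<^sub>C (x $ j)"
  by (simp add: scaleC_vec_def)

lemma norm_vector_2_le: "norm (vector [x, y] :: 'h::real_inner ^ 2) \<le> norm x + norm y"
proof (rule power2_le_imp_le)
  show "(norm (vector [x, y] :: 'h ^ 2))\<^sup>2 \<le> (norm x + norm y)\<^sup>2"
    by (simp add: norm_vec2_sq power2_sum)
qed auto

section \<open>Symmetric operators and the energy estimate\<close>

definition symmetric_op :: "'h::complex_inner operator \<Rightarrow> bool" where
  "symmetric_op A \<longleftrightarrow>
     (\<forall>x\<in>op_dom A. \<forall>y\<in>op_dom A. cinner (op_app A x) y = cinner x (op_app A y))"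

text \<open>The quadratic form of a symmetric operator is real on differences as well.  Stated with
  \<open>A x - A y\<close>, this follows from symmetry alone and fits operators that act through chosen
  representatives of classes of wave functions.\<close>

lemma symmetric_op_diff_real:
  assumes "symmetric_op A" "x \<in> op_dom A" "y \<in> op_dom A"
  shows "Im (cinner (x - y) (op_app A x - op_app A y)) = 0"
proof -
  define a where "a = op_app A x"
  define b where "b = op_app A y"
  have s: "cinner a x = cinner x a" "cinner b y = cinner y b" "cinner a y = cinner x b"
    using assms by (auto simp: symmetric_op_def a_def b_def)
  have "cinner y a = cnj (cinner x b)" "Im (cinner x a) = 0" "Im (cinner y b) = 0"
    using s cinner_commute[of y a] cinner_commute[of x a] cinner_commute[of y b]
    by (auto simp: complex_eq_iff)
  then show ?thesis
    unfolding a_def[symmetric] b_def[symmetric] by (simp add: cinner_diff_left cinner_diff_right)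
qed

text \<open>If the derivative of \<open>z\<close> is skew up to \<open>\<delta>\<close>, then \<open>\<parallel>z\<parallel>\<close> grows at most at the rate \<open>\<delta>\<close>: formally
  \<open>\<parallel>z\<parallel>' = \<langle>z, z'\<rangle> / \<parallel>z\<parallel>\<close>.\<close>

lemma energy_estimate:
  fixes z :: "real \<Rightarrow> 'h::real_inner"
  assumes z: "\<And>t. t \<in> {0..1} \<Longrightarrow> (z has_vector_derivative D t) (at t within {0..1})"
    and D: "\<And>t. t \<in> {0..1} \<Longrightarrow> inner (z t) (D t) \<le> \<delta> * norm (z t)"
    and \<delta>: "0 \<le> \<delta>" and s: "s \<in> {0..1}"
  shows "norm (z s) \<le> norm (z 0) + \<delta>"
proof (rule field_le_epsilon)
  fix \<eta> :: real assume \<eta>: "0 < \<eta>"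
  \<comment> \<open>The norm is not differentiable at zeros of \<open>z\<close>; the function \<open>g\<close> smooths it.\<close>
  define g where "g t = sqrt (inner (z t) (z t) + \<eta>\<^sup>2)" for t
  have pos: "0 < inner (z t) (z t) + \<eta>\<^sup>2" for t
    using \<eta> by (simp add: add_nonneg_pos)
  have gz: "norm (z t) \<le> g t" for t
    unfolding g_def norm_eq_sqrt_inner by (intro real_sqrt_le_mono) simp
  have gpos: "0 < g t" for t
    using pos by (simp add: g_def)
  have der: "(g has_derivative (\<lambda>h. h * (inner (z t) (D t) / g t))) (at t within {0..s})"
    if "0 \<le> t" "t \<le> s" for t
  proof -
    have "(z has_vector_derivative D t) (at t within {0..s})"
      using that s by (intro has_vector_derivative_within_subset[OF z]) auto
    then have "(z has_derivative (\<lambda>h. h *\<^sub>R D t)) (at t within {0..s})"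
      by (simp add: has_vector_derivative_def)
    note d = has_derivative_add[OF has_derivative_inner[OF this this] has_derivative_const[of "\<eta>\<^sup>2"]]
    have "((\<lambda>t. sqrt (inner (z t) (z t) + \<eta>\<^sup>2)) has_derivative
        (\<lambda>h. (inner (z t) (h *\<^sub>R D t) + inner (h *\<^sub>R D t) (z t) + 0)
           * (inverse (sqrt (inner (z t) (z t) + \<eta>\<^sup>2)) / 2))) (at t within {0..s})"
      by (rule has_derivative_real_sqrt[OF pos d])
    then show ?thesis
      unfolding g_def[symmetric]
      by (rule has_derivative_eq_rhs)
        (auto simp: fun_eq_iff inner_commute field_simps g_def)
  qed
  have "\<exists>x\<in>{0..s}. g s - g 0 = (s - 0) * (inner (z x) (D x) / g x)"
    using s der by (intro mvt_very_simple) auto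
  then obtain x where x: "x \<in> {0..s}" "g s - g 0 = s * (inner (z x) (D x) / g x)" by auto
  have "inner (z x) (D x) \<le> \<delta> * g x"
    using D[of x] x s gz[of x] mult_left_mono[OF gz[of x] \<delta>] by auto
  then have "inner (z x) (D x) / g x \<le> \<delta>"
    using gpos[of x] by (simp add: divide_le_eq)
  then have "s * (inner (z x) (D x) / g x) \<le> s * \<delta>"
    using s by (intro mult_left_mono) auto
  also have "\<dots> \<le> 1 * \<delta>" using s \<delta> by (intro mult_right_mono) auto
  finally have "g s \<le> g 0 + \<delta>" using x by simp
  moreover have "g 0 \<le> norm (z 0) + \<eta>"
    unfolding g_def using \<eta> sqrt_add_le_add_sqrt[of "inner (z 0) (z 0)" "\<eta>\<^sup>2"]
    by (simp add: norm_eq_sqrt_inner)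
  ultimately show "norm (z s) \<le> norm (z 0) + \<delta> + \<eta>"
    using gz[of s] by linarith
qed

section \<open>The rotation of the atom\<close>

text \<open>The skew generator \<open>i \<sigma>\<^sub>x \<otimes> 1\<close> of the rotation.  Its square is \<open>-1\<close>, so that its exponential is
  given by Euler's formula.\<close>

definition i_sigma_x :: "('a::euclidean_space fock ^ 2) \<Rightarrow>\<^sub>L ('a fock ^ 2)" where
  "i_sigma_x = bounded_op (\<i> *\<^sub>o (sigma_x \<otimes>\<^sub>o op_id))"

lemma scaled_sigma_x_apply:
  "op_app (c *\<^sub>o (sigma_x \<otimes>\<^sub>o op_id)) \<psi> = vector [c *\<^sub>C \<psi> $ 2, c *\<^sub>C \<psi> $ (1 :: 2)]"
  by (simp add: vec2_eq_iff op_scale_def op_tensor_def sigma_x_def op_id_def UNIV_2)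

lemma bounded_linear_scaled_sigma_x:
  "bounded_linear (\<lambda>\<psi> :: 'h ^ 2. vector [c *\<^sub>C \<psi> $ 2, c *\<^sub>C \<psi> $ 1] :: 'h::complex_inner ^ 2)"
proof (rule bounded_linear_intro[where K = "cmod c"])
  show "norm (vector [c *\<^sub>C \<psi> $ 2, c *\<^sub>C \<psi> $ 1] :: 'h ^ 2) \<le> norm \<psi> * cmod c" for \<psi> :: "'h ^ 2"
  proof -
    have "(norm (vector [c *\<^sub>C \<psi> $ 2, c *\<^sub>C \<psi> $ 1] :: 'h ^ 2))\<^sup>2 = (norm \<psi> * cmod c)\<^sup>2"
      by (simp add: norm_vec2_sq power_mult_distrib algebra_simps)
    then show ?thesis by (simp add: power2_eq_iff_nonneg)
  qed
qed (auto simp: vec2_eq_iff scaleC_add_right scaleC_scaleR)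

lemma i_sigma_x_apply: "blinfun_apply i_sigma_x \<psi> = vector [\<i> *\<^sub>C \<psi> $ 2, \<i> *\<^sub>C \<psi> $ 1]"
  unfolding i_sigma_x_def bounded_op_def scaled_sigma_x_apply[abs_def]
  by (simp add: bounded_linear_Blinfun_apply bounded_linear_scaled_sigma_x)

lemma i_sigma_x_scaled: "bounded_op ((\<i> * complex_of_real s) *\<^sub>o (sigma_x \<otimes>\<^sub>o op_id)) = s *\<^sub>R i_sigma_x"
proof (rule blinfun_eqI)
  fix \<psi> :: "'a fock ^ 2"
  show "blinfun_apply (bounded_op ((\<i> * complex_of_real s) *\<^sub>o (sigma_x \<otimes>\<^sub>o op_id))) \<psi>
      = blinfun_apply (s *\<^sub>R i_sigma_x) \<psi>"
    unfolding bounded_op_def scaled_sigma_x_apply[abs_def]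
    by (simp add: bounded_linear_Blinfun_apply bounded_linear_scaled_sigma_x scaleR_blinfun.rep_eq
        i_sigma_x_apply vec2_eq_iff scaleR_scaleC scaleC_scaleC mult.commute)
qed

lemma i_sigma_x_square: "i_sigma_x o\<^sub>L i_sigma_x = - id_blinfun"
  by (rule blinfun_eqI)
    (simp add: vec2_eq_iff i_sigma_x_apply scaleC_scaleC uminus_blinfun.rep_eq scaleC_minus_left)

lemma i_sigma_x_scaleC: "i_sigma_x (c *\<^sub>C x) = c *\<^sub>C i_sigma_x x"
  by (simp add: vec2_eq_iff i_sigma_x_apply scaleC_scaleC mult.commute)

lemma i_sigma_x_skew: "cinner (i_sigma_x x) y = - cinner x (i_sigma_x y)"
  by (simp add: cinner_vec2 i_sigma_x_apply cinner_scaleC_left cinner_scaleC_right)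

lemma norm_i_sigma_x: "norm (blinfun_apply i_sigma_x x) = norm x"
proof -
  have "(norm (i_sigma_x x))\<^sup>2 = (norm x)\<^sup>2" by (simp add: norm_vec2_sq i_sigma_x_apply)
  then show ?thesis by (simp add: power2_eq_iff_nonneg)
qed

lemma i_sigma_x_power:
  "((\<lambda>B. (s *\<^sub>R (i_sigma_x :: ('a::euclidean_space fock ^ 2) \<Rightarrow>\<^sub>L ('a fock ^ 2))) o\<^sub>L B) ^^ n) id_blinfun =
     (if even n then ((-1) ^ (n div 2) * s ^ n) *\<^sub>R id_blinfun
      else ((-1) ^ ((n - 1) div 2) * s ^ n) *\<^sub>R i_sigma_x)"
proof (induction n)
  case (Suc n)
  show ?case
  proof (cases "even n")
    case False
    then obtain k where "n = 2 * k + 1" by (elim oddE)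
    with Suc show ?thesis
      by (simp add: i_sigma_x_square bounded_bilinear.scaleR_left[OF bounded_bilinear_blinfun_compose]
          bounded_bilinear.scaleR_right[OF bounded_bilinear_blinfun_compose])
  next
    case True
    then obtain k where n: "n = 2 * k" by (elim evenE)
    have "i_sigma_x o\<^sub>L id_blinfun = (i_sigma_x :: ('a fock ^ 2) \<Rightarrow>\<^sub>L ('a fock ^ 2))"
      by (rule blinfun_eqI) simp
    with Suc n show ?thesis
      by (simp add: bounded_bilinear.scaleR_left[OF bounded_bilinear_blinfun_compose]
          bounded_bilinear.scaleR_right[OF bounded_bilinear_blinfun_compose])
  qed
qed simp

lemma rotation_eq: "rotation s = cos s *\<^sub>R id_blinfun + sin s *\<^sub>R i_sigma_x"
proof -
  have "(((\<lambda>B. (s *\<^sub>R i_sigma_x) o\<^sub>L B) ^^ n) id_blinfun) /\<^sub>R fact n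
      = (cos_coeff n *\<^sub>R s ^ n) *\<^sub>R id_blinfun + (sin_coeff n *\<^sub>R s ^ n) *\<^sub>R i_sigma_x" for n
    unfolding i_sigma_x_power
    by (cases "even n") (simp_all add: cos_coeff_def sin_coeff_def divide_inverse mult.commute)
  then have "bounded_exp (s *\<^sub>R i_sigma_x) =
      (\<Sum>n. (cos_coeff n *\<^sub>R s ^ n) *\<^sub>R id_blinfun + (sin_coeff n *\<^sub>R s ^ n) *\<^sub>R i_sigma_x)"
    unfolding bounded_exp_def by (intro suminf_cong)
  also have "\<dots> = cos s *\<^sub>R id_blinfun + sin s *\<^sub>R i_sigma_x"
    by (intro sums_unique[symmetric] sums_add sums_scaleR_left cos_converges sin_converges)
  finally show ?thesis
    unfolding rotation_def i_sigma_x_scaled .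
qed

lemma rotation_apply: "rotation s x = cos s *\<^sub>R x + sin s *\<^sub>R i_sigma_x x"
  by (simp add: rotation_eq plus_blinfun.rep_eq scaleR_blinfun.rep_eq)

lemma i_sigma_x_twice [simp]: "i_sigma_x (i_sigma_x x) = - x"
  using arg_cong[OF i_sigma_x_square, of "\<lambda>A. blinfun_apply A x"] by (simp add: uminus_blinfun.rep_eq)

lemma rotation_commutes: "rotation s (i_sigma_x x) = i_sigma_x (rotation s x)"
  by (simp add: rotation_apply blinfun.add_right blinfun.scaleR_right)

lemma rotation_scaleC: "rotation s (c *\<^sub>C x) = c *\<^sub>C rotation s x"
  by (simp add: rotation_apply i_sigma_x_scaleC scaleC_add_right scaleC_scaleR)

lemma rotation_0 [simp]: "rotation 0 = id_blinfun"
  by (simp add: rotation_eq)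

lemma rotation_inverse [simp]: "rotation s (rotation (- s) x) = x" "rotation (- s) (rotation s x) = x"
proof -
  have "(cos s * cos s) *\<^sub>R x + (sin s * sin s) *\<^sub>R x = x"
    unfolding scaleR_add_left[symmetric] by (simp add: power2_eq_square[symmetric])
  then show "rotation s (rotation (- s) x) = x" "rotation (- s) (rotation s x) = x"
    by (simp_all add: rotation_apply blinfun.add_right blinfun.diff_right blinfun.minus_right
        blinfun.scaleR_right scaleR_add_right scaleR_diff_right mult.commute)
qed

lemma cinner_rotation_left: "cinner (rotation s x) y = cinner x (rotation (- s) y)"
  by (simp add: rotation_apply cinner_add_left cinner_add_right cinner_diff_right
      cinner_scaleR_left cinner_scaleR_right i_sigma_x_skew)

lemma inner_rotation_left: "inner (rotation s x) y = inner x (rotation (- s) y)"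
  by (simp add: inner_Re_cinner cinner_rotation_left)

lemma norm_rotation [simp]: "norm (rotation s x) = norm x"
  by (simp add: norm_eq_sqrt_inner inner_rotation_left)

lemma bounded_adjoint_rotation: "bounded_adjoint (rotation s) = rotation (- s)"
  unfolding bounded_adjoint_def
  by (subst adjoint_unique[where g = "blinfun_apply (rotation (- s))"])
    (simp_all add: inner_rotation_left blinfun_apply_inverse)

lemma rotation_derivative:
  "(rotation has_vector_derivative i_sigma_x o\<^sub>L rotation s) (at s within S)"
proof -
  have "((\<lambda>s. cos s *\<^sub>R id_blinfun + sin s *\<^sub>R i_sigma_x) has_vector_derivative
      (- sin s) *\<^sub>R id_blinfun + cos s *\<^sub>R i_sigma_x) (at s within S)"
    by (intro has_vector_derivative_add derivative_eq_intros) (auto simp: has_vector_derivative_def)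
  also have "(- sin s) *\<^sub>R id_blinfun + cos s *\<^sub>R i_sigma_x = i_sigma_x o\<^sub>L rotation s"
    by (rule blinfun_eqI)
      (simp add: rotation_apply blinfun.add_left blinfun.diff_left blinfun.minus_left
        blinfun.scaleR_left blinfun.add_right blinfun.scaleR_right)
  finally show ?thesis unfolding rotation_eq[abs_def] .
qed

lemma rotation_apply_derivative:
  "((\<lambda>t. rotation t y) has_vector_derivative i_sigma_x (rotation s y)) (at s within S)"
  using bounded_linear.has_vector_derivative[OF blinfun.bounded_linear_left rotation_derivative]
  by simp

section \<open>Evolutions of a state in the kernel\<close>

lemma symmetric_op_rotated:
  assumes "symmetric_op A"
  shows "symmetric_op (op_conj (rotation s) A)"
  using assms cinner_rotation_left[of "- s"]
  by (auto simp: symmetric_op_def op_conj_def bounded_adjoint_rotation cinner_rotation_left[of s])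

text \<open>If \<open>y\<close> is in the kernel of \<open>H\<close>, the rotated state \<open>V(s) y\<close> fails the Schroedinger equation by
  \<open>V(s) i \<sigma>\<^sub>x y\<close>.  The correction \<open>- V(s) \<psi> / \<tau>\<close> with \<open>H \<psi> = h\<close> produces \<open>i V(s) h\<close> when the generator
  \<open>\<tau> H\<close> acts on it, which cancels the error if \<open>i h\<close> is close to \<open>i \<sigma>\<^sub>x y\<close>.  The correction contributes
  \<open>\<parallel>\<psi>\<parallel> / \<tau>\<close> at time \<open>0\<close>, at time \<open>s\<close>, and through its own rotation.\<close>

lemma schroedinger_near_rotated_state:
  fixes H :: "('a::euclidean_space fock ^ 2) operator"
  assumes U: "schroedinger_evolution (\<lambda>s. op_conj (rotation s) H) \<tau> U"
    and H: "symmetric_op H"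
    and \<tau>: "0 < \<tau>"
    and y: "y \<in> op_dom H"
    and w: "y - (1 / \<tau>) *\<^sub>R \<psi> \<in> op_dom H"
    and Hw: "op_app H (y - (1 / \<tau>) *\<^sub>R \<psi>) = - (1 / \<tau>) *\<^sub>R h"
    and s: "s \<in> {0..1}"
  shows "norm (U s y - rotation s y) \<le> 3 * norm \<psi> / \<tau> + norm (i_sigma_x y - \<i> *\<^sub>C h)"
proof -
  define A where "A s = op_conj (rotation s) H" for s
  define w where "w = y - (1 / \<tau>) *\<^sub>R \<psi>"
  define q where "q = i_sigma_x y - \<i> *\<^sub>C h - (1 / \<tau>) *\<^sub>R i_sigma_x \<psi>"
  define \<delta> where "\<delta> = norm (i_sigma_x y - \<i> *\<^sub>C h) + norm \<psi> / \<tau>"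
  define z where "z t = U t y - rotation t w" for t
  have y0: "y \<in> op_dom (op_conj (rotation 0) H)"
    using y unfolding op_conj_def bounded_adjoint_rotation by simp
  have "\<forall>t\<in>{0..1}. \<exists>D. ((\<lambda>t. U t y) has_vector_derivative D) (at t within {0..1}) \<and>
      \<i> *\<^sub>C D = \<tau> *\<^sub>R op_app (A t) (U t y)"
    and Udom: "\<And>t. t \<in> {0..1} \<Longrightarrow> U t y \<in> op_dom (A t)"
    and U0: "U 0 y = y"
    using U y0 unfolding schroedinger_evolution_def A_def by auto
  then obtain D where D: "\<And>t. t \<in> {0..1} \<Longrightarrow> ((\<lambda>t. U t y) has_vector_derivative D t) (at t within {0..1})"
      "\<And>t. t \<in> {0..1} \<Longrightarrow> \<i> *\<^sub>C D t = \<tau> *\<^sub>R op_app (A t) (U t y)"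
    by metis
  have wdom: "rotation t w \<in> op_dom (A t)" and Aw: "op_app (A t) (rotation t w) = rotation t (op_app H w)" for t
    using w unfolding A_def op_conj_def w_def bounded_adjoint_rotation by simp_all
  have q: "norm q \<le> \<delta>"
  proof -
    have "norm q \<le> norm (i_sigma_x y - \<i> *\<^sub>C h) + norm ((1 / \<tau>) *\<^sub>R i_sigma_x \<psi>)"
      unfolding q_def by (rule norm_triangle_ineq4)
    then show ?thesis using \<tau> by (simp add: norm_i_sigma_x \<delta>_def)
  qed
  have est: "norm (z s) \<le> norm (z 0) + \<delta>"
  proof (rule energy_estimate[where D = "\<lambda>t. D t - i_sigma_x (rotation t w)"])
    fix t :: real assume t: "t \<in> {0..1}"
    show "(z has_vector_derivative D t - i_sigma_x (rotation t w)) (at t within {0..1})"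
      unfolding z_def[abs_def] by (intro has_vector_derivative_diff D t rotation_apply_derivative)
    have Dt: "D t = (- \<i> * \<tau>) *\<^sub>C op_app (A t) (U t y)"
    proof -
      have "D t = - \<i> *\<^sub>C \<i> *\<^sub>C D t" by (simp add: scaleC_scaleC scaleC_minus_left)
      then show ?thesis by (simp add: D(2)[OF t] scaleR_scaleC scaleC_scaleC)
    qed
    have "i_sigma_x (rotation t w) = rotation t (i_sigma_x w)" by (simp add: rotation_commutes)
    also have "i_sigma_x w = (- \<i> * \<tau>) *\<^sub>C op_app H w + q"
      using \<tau> unfolding w_def q_def Hw
      by (simp add: blinfun.diff_right blinfun.scaleR_right scaleR_scaleC scaleC_scaleC
          i_sigma_x_scaleC scaleC_minus_left scaleC_minus_right)
    finally have w': "i_sigma_x (rotation t w) = (- \<i> * \<tau>) *\<^sub>C op_app (A t) (rotation t w) + rotation t q"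
      by (simp add: blinfun.add_right rotation_scaleC Aw)
    have "symmetric_op (A t)"
      unfolding A_def by (rule symmetric_op_rotated[OF H])
    then have "Im (cinner (z t) (op_app (A t) (U t y) - op_app (A t) (rotation t w))) = 0"
      unfolding z_def by (rule symmetric_op_diff_real[OF _ Udom[OF t] wdom])
    then have "inner (z t) ((- \<i> * \<tau>) *\<^sub>C (op_app (A t) (U t y) - op_app (A t) (rotation t w))) = 0"
      by (simp add: inner_Re_cinner cinner_scaleC_right)
    moreover have "D t - i_sigma_x (rotation t w)
        = (- \<i> * \<tau>) *\<^sub>C (op_app (A t) (U t y) - op_app (A t) (rotation t w)) - rotation t q"
      unfolding Dt w' scaleC_diff_right by simp
    ultimately have "inner (z t) (D t - i_sigma_x (rotation t w)) = - inner (z t) (rotation t q)"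
      by (simp add: inner_diff_right)
    also have "\<dots> \<le> norm (z t) * norm (rotation t q)"
      using Cauchy_Schwarz_ineq2[of "z t" "rotation t q"] by linarith
    also have "\<dots> \<le> \<delta> * norm (z t)"
      using mult_right_mono[OF q norm_ge_zero[of "z t"]] by (simp add: mult.commute)
    finally show "inner (z t) (D t - i_sigma_x (rotation t w)) \<le> \<delta> * norm (z t)" .
  next
    show "0 \<le> \<delta>" using \<tau> by (simp add: \<delta>_def)
  qed (rule s)
  have "z 0 = (1 / \<tau>) *\<^sub>R \<psi>" by (simp add: z_def w_def U0)
  then have z0: "norm (z 0) = norm \<psi> / \<tau>" using \<tau> by simp
  have "U s y - rotation s y = z s - (1 / \<tau>) *\<^sub>R rotation s \<psi>"
    by (simp add: z_def w_def blinfun.diff_right blinfun.scaleR_right)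
  then have "norm (U s y - rotation s y) \<le> norm (z s) + norm ((1 / \<tau>) *\<^sub>R rotation s \<psi>)"
    by (simp only: norm_triangle_ineq4)
  also have "\<dots> = norm (z s) + norm \<psi> / \<tau>" using \<tau> by simp
  also have "\<dots> \<le> 3 * norm \<psi> / \<tau> + norm (i_sigma_x y - \<i> *\<^sub>C h)"
    using est z0 by (simp add: \<delta>_def)
  finally show ?thesis .
qed

abbreviation ground_proj_0 :: "('a::euclidean_space fock ^ 2) \<Rightarrow>\<^sub>L ('a fock ^ 2)" where
  "ground_proj_0 \<equiv> bounded_op (p_mat \<otimes>\<^sub>o vacuum_proj)"

lemma ground_proj_0_apply:
  "ground_proj_0 x = vector [cinner vacuum (x $ 1) *\<^sub>C vacuum, 0 :: 'a::euclidean_space fock]"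
proof -
  have *: "op_app (p_mat \<otimes>\<^sub>o vacuum_proj) x = vector [cinner vacuum (x $ 1) *\<^sub>C vacuum, 0]" for x :: "'a fock ^ 2"
    by (simp add: vec2_eq_iff op_tensor_def p_mat_def vacuum_proj_def UNIV_2)
  have "bounded_linear (\<lambda>x :: 'a fock ^ 2. vector [cinner vacuum (x $ 1) *\<^sub>C vacuum, 0] :: 'a fock ^ 2)"
  proof (rule bounded_linear_intro[where K = "norm (vacuum :: 'a fock) * norm (vacuum :: 'a fock)"])
    fix x y :: "'a fock ^ 2" and r :: real
    show "(vector [cinner vacuum ((x + y) $ 1) *\<^sub>C vacuum, 0] :: 'a fock ^ 2)
        = vector [cinner vacuum (x $ 1) *\<^sub>C vacuum, 0] + vector [cinner vacuum (y $ 1) *\<^sub>C vacuum, 0]"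
      by (simp add: vec2_eq_iff cinner_add_right scaleC_add_left)
    show "(vector [cinner vacuum ((r *\<^sub>R x) $ 1) *\<^sub>C vacuum, 0] :: 'a fock ^ 2)
        = r *\<^sub>R vector [cinner vacuum (x $ 1) *\<^sub>C vacuum, 0]"
      by (simp add: vec2_eq_iff cinner_scaleR_right cinner_scaleC_right scaleR_scaleC scaleC_scaleC)
    have "norm (vector [cinner vacuum (x $ 1) *\<^sub>C vacuum, 0] :: 'a fock ^ 2)
        \<le> cmod (cinner vacuum (x $ 1)) * norm (vacuum :: 'a fock)"
      using norm_vector_2_le[of "cinner vacuum (x $ 1) *\<^sub>C vacuum" 0] by simp
    also have "\<dots> \<le> (norm (vacuum :: 'a fock) * norm (x $ 1)) * norm (vacuum :: 'a fock)"
      by (intro mult_right_mono norm_cinner_le) auto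
    also have "\<dots> \<le> (norm (vacuum :: 'a fock) * norm x) * norm (vacuum :: 'a fock)"
      by (intro mult_right_mono mult_left_mono Finite_Cartesian_Product.norm_nth_le) auto
    finally show "norm (vector [cinner vacuum (x $ 1) *\<^sub>C vacuum, 0] :: 'a fock ^ 2)
        \<le> norm x * (norm (vacuum :: 'a fock) * norm (vacuum :: 'a fock))"
      by (simp add: mult_ac)
  qed
  then show ?thesis
    unfolding bounded_op_def *[abs_def] by (simp add: bounded_linear_Blinfun_apply)
qed

lemma ground_proj_0_symmetric: "inner (ground_proj_0 x) y = inner x (ground_proj_0 y)"
proof -
  have "cinner (ground_proj_0 x) y = cnj (cinner vacuum (x $ 1)) * cinner vacuum (y $ 1)"
    "cinner x (ground_proj_0 y) = cinner (x $ 1) vacuum * cinner vacuum (y $ 1)"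
    by (simp_all add: cinner_vec2 ground_proj_0_apply cinner_scaleC_left cinner_scaleC_right)
  then show ?thesis
    unfolding inner_Re_cinner using cinner_commute[of "x $ 1" vacuum] by simp
qed

lemma ground_proj_apply: "ground_proj s x = rotation s (ground_proj_0 (rotation (- s) x))"
  by (simp add: ground_proj_def bounded_adjoint_rotation)

lemma ground_proj_symmetric: "inner (ground_proj s x) y = inner x (ground_proj s y)"
  unfolding ground_proj_apply inner_rotation_left[of s] ground_proj_0_symmetric
  by (simp add: inner_rotation_left[of "- s"])

text \<open>From \<open>P(s) = V(s) P V(s)\<^sup>-\<^sup>1\<close> and \<open>V' = i \<sigma>\<^sub>x V\<close>: the derivative is a commutator with \<open>i \<sigma>\<^sub>x\<close>.\<close>

lemma ground_proj_derivative:
  "(ground_proj has_vector_derivative (i_sigma_x o\<^sub>L ground_proj s) - (ground_proj s o\<^sub>L i_sigma_x)) (at s)"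
proof -
  have eq: "ground_proj t = (rotation t o\<^sub>L ground_proj_0) o\<^sub>L rotation (- t)" for t
    by (rule blinfun_eqI) (simp add: ground_proj_apply)
  have r: "((\<lambda>t. rotation (- t)) has_vector_derivative - (i_sigma_x o\<^sub>L rotation (- s))) (at s)"
  proof -
    have "(uminus has_vector_derivative (-1 :: real)) (at s)"
      by (auto intro!: derivative_eq_intros simp: has_vector_derivative_def)
    from vector_diff_chain_at[OF this rotation_derivative[of "- s" UNIV]]
    show ?thesis by (simp add: o_def)
  qed
  have "((\<lambda>t. (rotation t o\<^sub>L ground_proj_0) o\<^sub>L rotation (- t)) has_vector_derivative
     ((rotation s o\<^sub>L ground_proj_0) o\<^sub>L - (i_sigma_x o\<^sub>L rotation (- s)))
     + (((rotation s o\<^sub>L 0) + ((i_sigma_x o\<^sub>L rotation s) o\<^sub>L ground_proj_0)) o\<^sub>L rotation (- s))) (at s)"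
    by (rule bounded_bilinear.has_vector_derivative[OF bounded_bilinear_blinfun_compose
          bounded_bilinear.has_vector_derivative[OF bounded_bilinear_blinfun_compose
            rotation_derivative has_vector_derivative_const] r])
  also have "((rotation s o\<^sub>L ground_proj_0) o\<^sub>L - (i_sigma_x o\<^sub>L rotation (- s)))
     + (((rotation s o\<^sub>L 0) + ((i_sigma_x o\<^sub>L rotation s) o\<^sub>L ground_proj_0)) o\<^sub>L rotation (- s))
     = (i_sigma_x o\<^sub>L ground_proj s) - (ground_proj s o\<^sub>L i_sigma_x)"
    by (rule blinfun_eqI)
      (simp add: ground_proj_apply blinfun.add_left blinfun.diff_left blinfun.minus_left
        blinfun.minus_right blinfun.add_right rotation_commutes)
  finally show ?thesis unfolding eq[abs_def] .
qed

text \<open>The generator \<open>[P', P]\<close> is skew, so its evolution is determined by the initial value; and on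
  \<open>V(s) y\<close> with \<open>P y = y\<close>, \<open>P \<sigma>\<^sub>x y = 0\<close> it acts as \<open>i \<sigma>\<^sub>x\<close>, the generator of \<open>V\<close>.\<close>

lemma adiabatic_evolution_on_ground_state:
  assumes U: "adiabatic_evolution ground_proj U"
    and y: "ground_proj_0 y = y" "ground_proj_0 (i_sigma_x y) = 0"
    and s: "s \<in> {0..1}"
  shows "U s y = rotation s (y :: 'a::euclidean_space fock ^ 2)"
proof -
  define K where "K t = blinfun_commutator ((i_sigma_x o\<^sub>L ground_proj t) - (ground_proj t o\<^sub>L i_sigma_x))
    (ground_proj t :: ('a fock ^ 2) \<Rightarrow>\<^sub>L ('a fock ^ 2))" for t
  define z where "z t = U t y - rotation t y" for t
  have K: "K t x = i_sigma_x (ground_proj t (ground_proj t x)) - ground_proj t (i_sigma_x (ground_proj t x))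
      - (ground_proj t (i_sigma_x (ground_proj t x)) - ground_proj t (ground_proj t (i_sigma_x x)))" for t x
    by (simp add: K_def blinfun_commutator_def blinfun.diff_left blinfun.diff_right)
  have skew: "inner x (K t x) = 0" for t x
  proof -
    define P where "P = blinfun_apply (ground_proj t :: ('a fock ^ 2) \<Rightarrow>\<^sub>L ('a fock ^ 2))"
    have J: "inner (i_sigma_x u) v = - inner u (i_sigma_x v)" for u v :: "'a fock ^ 2"
      by (simp add: inner_Re_cinner i_sigma_x_skew)
    have P: "inner (P u) v = inner u (P v)" for u v
      by (simp add: P_def ground_proj_symmetric)
    have "inner x (P (i_sigma_x (P x))) = 0"
      using J[of "P x" "P x"] P[of x "i_sigma_x (P x)"] inner_commute[of "P x" "i_sigma_x (P x)"] by linarith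
    moreover have "inner x (i_sigma_x (P (P x))) = - inner x (P (P (i_sigma_x x)))"
      using J[of x "P (P x)"] P[of "P x" "i_sigma_x x"] P[of x "P (i_sigma_x x)"]
        inner_commute[of "P (P x)" "i_sigma_x x"] by linarith
    ultimately show ?thesis by (simp add: K P_def inner_diff_right)
  qed
  have "norm (z s) \<le> norm (z 0) + 0"
  proof (rule energy_estimate[where D = "\<lambda>t. K t (U t y) - i_sigma_x (rotation t y)"])
    fix t :: real assume t: "t \<in> {0..1}"
    have "(U has_vector_derivative
        (blinfun_commutator (vector_derivative ground_proj (at t)) (ground_proj t) o\<^sub>L U t)) (at t within {0..1})"
      using U t unfolding adiabatic_evolution_def by blast
    then have "(U has_vector_derivative (K t o\<^sub>L U t)) (at t within {0..1})"
      unfolding K_def vector_derivative_at[OF ground_proj_derivative] .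
    then have "((\<lambda>t. U t y) has_vector_derivative K t (U t y)) (at t within {0..1})"
      using bounded_linear.has_vector_derivative[OF blinfun.bounded_linear_left] by fastforce
    then show "(z has_vector_derivative K t (U t y) - i_sigma_x (rotation t y)) (at t within {0..1})"
      unfolding z_def[abs_def] by (intro has_vector_derivative_diff rotation_apply_derivative)
    have "K t (rotation t y) = i_sigma_x (rotation t y)"
      by (simp add: K ground_proj_apply y flip: rotation_commutes)
    then have "K t (U t y) - i_sigma_x (rotation t y) = K t (z t)"
      by (simp add: z_def blinfun.diff_right)
    then show "inner (z t) (K t (U t y) - i_sigma_x (rotation t y)) \<le> 0 * norm (z t)"
      by (simp add: skew)
  qed (use s in auto)
  moreover have "z 0 = 0" using U by (simp add: z_def adiabatic_evolution_def)
  ultimately show ?thesis by (simp add: z_def)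
qed

section \<open>Configurations of photons\<close>

interpretation lborel_prod: product_sigma_finite "\<lambda>_ :: nat. lborel :: 'a::euclidean_space measure"
  by standard

lemma sigma_finite_config: "sigma_finite_measure (config n :: (nat \<Rightarrow> 'a::euclidean_space) measure)"
  unfolding config_def by (rule lborel_prod.sigma_finite) simp

interpretation config_pair: pair_sigma_finite "config n :: (nat \<Rightarrow> 'a::euclidean_space) measure" "lborel :: 'a measure" for n
  by (intro pair_sigma_finite.intro sigma_finite_config lborel.sigma_finite_measure_axioms)

lemma space_config: "space (config n) = {k. \<forall>i. n \<le> i \<longrightarrow> k i = undefined}"
  unfolding config_def space_PiM by (simp add: PiE_eq_iff PiE_def extensional_def not_less)

lemma measurable_config_component [measurable]:
  "i < n \<Longrightarrow> (\<lambda>k. k i) \<in> config n \<rightarrow>\<^sub>M (borel :: 'a::euclidean_space measure)"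
  unfolding config_def measurable_lborel1[symmetric] measurable_lborel2[symmetric]
  using measurable_component_singleton[of i "{..<n}" "\<lambda>_. lborel"] by simp

lemma measurable_into_config:
  assumes "\<And>i. i < n \<Longrightarrow> (\<lambda>x. g x i) \<in> borel_measurable M"
    and "\<And>x i. x \<in> space M \<Longrightarrow> n \<le> i \<Longrightarrow> g x i = undefined"
  shows "g \<in> M \<rightarrow>\<^sub>M (config n :: (nat \<Rightarrow> 'a::euclidean_space) measure)"
  unfolding config_def
  by (rule measurable_PiM_single') (use assms in \<open>auto simp: PiE_iff extensional_def not_less\<close>)

lemma measurable_case_nat_config [measurable]:
  "(\<lambda>(k, q). case_nat q k) \<in> config n \<Otimes>\<^sub>M lborel \<rightarrow>\<^sub>M (config (Suc n) :: (nat \<Rightarrow> 'a::euclidean_space) measure)"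
proof (rule measurable_into_config)
  fix i assume "i < Suc n"
  then show "(\<lambda>x. (case x of (k, q) \<Rightarrow> case_nat q k) i) \<in> borel_measurable (config n \<Otimes>\<^sub>M (lborel :: 'a measure))"
    by (cases i) (simp_all add: split_beta')
qed (auto simp: space_pair_measure space_config split: nat.split)

lemma measurable_permute_config:
  assumes "\<pi> permutes {..<n}"
  shows "(\<lambda>k. k \<circ> \<pi>) \<in> config n \<rightarrow>\<^sub>M (config n :: (nat \<Rightarrow> 'a::euclidean_space) measure)"
proof (rule measurable_into_config)
  fix i assume "i < n"
  then have "\<pi> i < n" using permutes_in_image[OF assms, of i] by simp
  then show "(\<lambda>k. (k \<circ> \<pi>) i) \<in> borel_measurable (config n :: (nat \<Rightarrow> 'a) measure)" by simp
next
  fix k :: "nat \<Rightarrow> 'a" and i assume "k \<in> space (config n)" "n \<le> i"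
  then show "(k \<circ> \<pi>) i = undefined"
    using permutes_not_in[OF assms, of i] by (simp add: space_config)
qed

lemma measurable_skip_config [measurable]:
  "j \<le> n \<Longrightarrow> skip j \<in> config (Suc n) \<rightarrow>\<^sub>M (config n :: (nat \<Rightarrow> 'a::euclidean_space) measure)"
  by (rule measurable_into_config) (auto simp: skip_def space_config)

lemma emeasure_config_PiE:
  "(\<And>i. i < n \<Longrightarrow> A i \<in> sets borel) \<Longrightarrow>
    emeasure (config n) (Pi\<^sub>E {..<n} A) = (\<Prod>i<n. emeasure lborel (A i :: 'a::euclidean_space set))"
  unfolding config_def by (subst lborel_prod.emeasure_PiM) auto

lemma sets_config_PiE:
  "(\<And>i. i < n \<Longrightarrow> A i \<in> sets borel) \<Longrightarrow> Pi\<^sub>E {..<n} A \<in> sets (config n :: (nat \<Rightarrow> 'a::euclidean_space) measure)"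
  unfolding config_def by (rule sets_PiM_I_finite) auto

lemma distr_permute_config:
  assumes \<pi>: "\<pi> permutes {..<n}"
  shows "distr (config n) (config n) (\<lambda>k. k \<circ> \<pi>) = (config n :: (nat \<Rightarrow> 'a::euclidean_space) measure)"
proof -
  have "distr (config n) (config n) (\<lambda>k. k \<circ> \<pi>) = (\<Pi>\<^sub>M i\<in>{..<n}. (lborel :: 'a measure))"
  proof (rule lborel_prod.PiM_eqI)
    fix A :: "nat \<Rightarrow> 'a set" assume "\<And>i. i \<in> {..<n} \<Longrightarrow> A i \<in> sets lborel"
    then have A: "\<And>i. i < n \<Longrightarrow> A i \<in> sets borel" by auto
    define \<rho> where "\<rho> = inv \<pi>"
    have \<rho>: "\<rho> permutes {..<n}" unfolding \<rho>_def by (rule permutes_inv[OF \<pi>])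
    have lt: "\<pi> i < n \<longleftrightarrow> i < n" "\<rho> i < n \<longleftrightarrow> i < n" for i
      using permutes_in_image[OF \<pi>, of i] permutes_in_image[OF \<rho>, of i] by auto
    have inv: "\<pi> (\<rho> i) = i" "\<rho> (\<pi> i) = i" for i
      using permutes_inverses[OF \<pi>] by (auto simp: \<rho>_def)
    have "(\<lambda>k. k \<circ> \<pi>) -` Pi\<^sub>E {..<n} A \<inter> space (config n) = Pi\<^sub>E {..<n} (\<lambda>i. A (\<rho> i))"
    proof (intro set_eqI iffI)
      fix k assume k: "k \<in> (\<lambda>k. k \<circ> \<pi>) -` Pi\<^sub>E {..<n} A \<inter> space (config n)"
      then have "k (\<pi> (\<rho> i)) \<in> A (\<rho> i)" if "i < n" for i
        using that lt(2)[of i] by (auto simp: PiE_iff)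
      then show "k \<in> Pi\<^sub>E {..<n} (\<lambda>i. A (\<rho> i))"
        using k by (auto simp: PiE_iff inv space_config extensional_def not_less)
    next
      fix k assume k: "k \<in> Pi\<^sub>E {..<n} (\<lambda>i. A (\<rho> i))"
      then have "k (\<pi> i) \<in> A (\<rho> (\<pi> i))" if "i < n" for i
        using that lt(1)[of i] by (auto simp: PiE_iff)
      then show "k \<in> (\<lambda>k. k \<circ> \<pi>) -` Pi\<^sub>E {..<n} A \<inter> space (config n)"
        using k lt(1) permutes_not_in[OF \<pi>]
        by (auto simp: PiE_iff inv space_config extensional_def not_less)
    qed
    then have "emeasure (distr (config n) (config n) (\<lambda>k. k \<circ> \<pi>)) (Pi\<^sub>E {..<n} A)
        = emeasure (config n) (Pi\<^sub>E {..<n} (\<lambda>i. A (\<rho> i)))"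
      using A by (subst emeasure_distr) (auto intro!: measurable_permute_config[OF \<pi>] sets_config_PiE)
    also have "\<dots> = (\<Prod>i<n. emeasure lborel (A (\<rho> i)))"
      using A lt by (intro emeasure_config_PiE) auto
    also have "\<dots> = (\<Prod>i<n. emeasure lborel (A i))"
      using prod.permute[OF \<rho>, of "\<lambda>i. emeasure lborel (A i)"] by (simp add: o_def)
    finally show "emeasure (distr (config n) (config n) (\<lambda>k. k \<circ> \<pi>)) (Pi\<^sub>E {..<n} A)
        = (\<Prod>i\<in>{..<n}. emeasure lborel (A i))" .
  qed (auto simp: config_def)
  then show ?thesis by (simp add: config_def)
qed

text \<open>One photon can be integrated first: the measure on \<open>n + 1\<close> photons is the product of the measure
  on the last \<open>n\<close> and Lebesgue measure for the front one.  This is the form in which the annihilation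
  operator needs Fubini's theorem.\<close>

lemma distr_case_nat_config:
  "distr (config n \<Otimes>\<^sub>M lborel) (config (Suc n)) (\<lambda>(k, q). case_nat q k)
     = (config (Suc n) :: (nat \<Rightarrow> 'a::euclidean_space) measure)"
proof -
  have "distr (config n \<Otimes>\<^sub>M lborel) (config (Suc n)) (\<lambda>(k, q). case_nat q k)
      = (\<Pi>\<^sub>M i\<in>{..<Suc n}. (lborel :: 'a measure))"
  proof (rule lborel_prod.PiM_eqI)
    fix A :: "nat \<Rightarrow> 'a set" assume "\<And>i. i \<in> {..<Suc n} \<Longrightarrow> A i \<in> sets lborel"
    then have A: "\<And>i. i < Suc n \<Longrightarrow> A i \<in> sets borel" by auto
    have "(\<lambda>(k, q). case_nat q k) -` Pi\<^sub>E {..<Suc n} A \<inter> space (config n \<Otimes>\<^sub>M lborel)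
        = Pi\<^sub>E {..<n} (\<lambda>i. A (Suc i)) \<times> A 0"
    proof (rule set_eqI)
      fix x :: "(nat \<Rightarrow> 'a) \<times> 'a"
      obtain k q where x: "x = (k, q)" by (cases x)
      have "case_nat q k \<in> Pi\<^sub>E {..<Suc n} A \<longleftrightarrow>
          (\<forall>i<Suc n. case_nat q k i \<in> A i) \<and> (\<forall>i\<ge>Suc n. case_nat q k i = undefined)"
        by (auto simp: PiE_iff extensional_def not_less)
      also have "\<dots> \<longleftrightarrow> q \<in> A 0 \<and> (\<forall>i<n. k i \<in> A (Suc i)) \<and> (\<forall>i\<ge>n. k i = undefined)"
        by (auto simp: All_less_Suc2 Suc_le_eq split: nat.split)
      finally show "x \<in> (\<lambda>(k, q). case_nat q k) -` Pi\<^sub>E {..<Suc n} A \<inter> space (config n \<Otimes>\<^sub>M lborel) \<longleftrightarrow>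
          x \<in> Pi\<^sub>E {..<n} (\<lambda>i. A (Suc i)) \<times> A 0"
        unfolding x by (auto simp: PiE_iff extensional_def not_less space_pair_measure space_config)
    qed
    then have "emeasure (distr (config n \<Otimes>\<^sub>M lborel) (config (Suc n)) (\<lambda>(k, q). case_nat q k)) (Pi\<^sub>E {..<Suc n} A)
        = emeasure (config n \<Otimes>\<^sub>M lborel) (Pi\<^sub>E {..<n} (\<lambda>i. A (Suc i)) \<times> A 0)"
      using A by (subst emeasure_distr) (auto intro!: sets_config_PiE)
    also have "\<dots> = emeasure (config n) (Pi\<^sub>E {..<n} (\<lambda>i. A (Suc i))) * emeasure lborel (A 0)"
      using A by (intro lborel.emeasure_pair_measure_Times sets_config_PiE) auto
    also have "\<dots> = (\<Prod>i<n. emeasure lborel (A (Suc i))) * emeasure lborel (A 0)"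
      using A by (subst emeasure_config_PiE) auto
    also have "\<dots> = (\<Prod>i\<in>{..<Suc n}. emeasure lborel (A i))"
      by (simp only: prod.lessThan_Suc_shift mult.commute)
    finally show "emeasure (distr (config n \<Otimes>\<^sub>M lborel) (config (Suc n)) (\<lambda>(k, q). case_nat q k)) (Pi\<^sub>E {..<Suc n} A)
        = (\<Prod>i\<in>{..<Suc n}. emeasure lborel (A i))" .
  qed (auto simp: config_def)
  then show ?thesis by (simp add: config_def)
qed

lemma integral_permute_config:
  fixes g :: "(nat \<Rightarrow> 'a::euclidean_space) \<Rightarrow> complex"
  assumes "\<pi> permutes {..<n}" "g \<in> borel_measurable (config n)"
  shows "(\<integral>k. g (k \<circ> \<pi>) \<partial>config n) = (\<integral>k. g k \<partial>config n)"
    and "integrable (config n) (\<lambda>k. g (k \<circ> \<pi>)) \<longleftrightarrow> integrable (config n) g"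
  using integral_distr[OF measurable_permute_config[OF assms(1)] assms(2)]
    integrable_distr_eq[OF measurable_permute_config[OF assms(1)] assms(2)]
  by (simp_all add: distr_permute_config[OF assms(1)])

lemma AE_permute_config:
  assumes \<pi>: "\<pi> permutes {..<n}" and "AE k in config n. P k"
  shows "AE k in (config n :: (nat \<Rightarrow> 'a::euclidean_space) measure). P (k \<circ> \<pi>)"
proof (rule AE_distrD[OF measurable_permute_config[OF \<pi>]])
  show "AE k in distr (config n) (config n) (\<lambda>k. k \<circ> \<pi>). P k"
    unfolding distr_permute_config[OF \<pi>] by fact
qed

lemma integral_config_Suc:
  fixes g :: "(nat \<Rightarrow> 'a::euclidean_space) \<Rightarrow> complex"
  assumes "g \<in> borel_measurable (config (Suc n))"
  shows "(\<integral>x. g (case x of (k, q) \<Rightarrow> case_nat q k) \<partial>(config n \<Otimes>\<^sub>M lborel)) = (\<integral>k. g k \<partial>config (Suc n))"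
    and "integrable (config n \<Otimes>\<^sub>M lborel) (\<lambda>x. g (case x of (k, q) \<Rightarrow> case_nat q k)) \<longleftrightarrow> integrable (config (Suc n)) g"
  using integral_distr[OF measurable_case_nat_config assms]
    integrable_distr_eq[OF measurable_case_nat_config assms]
  by (simp_all add: distr_case_nat_config)

text \<open>This makes the annihilation operator independent of representatives: a change on a null set of
  \<open>n + 1\<close> photons leaves the integral over the front photon unchanged almost everywhere.\<close>

lemma AE_config_Suc:
  assumes "AE k in config (Suc n). P k"
  shows "AE k in (config n :: (nat \<Rightarrow> 'a::euclidean_space) measure). AE q in lborel. P (case_nat q k)"
proof -
  have "AE x in config n \<Otimes>\<^sub>M lborel. P (case x of (k, q) \<Rightarrow> case_nat q k)"
  proof (rule AE_distrD[OF measurable_case_nat_config])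
    show "AE k in distr (config n \<Otimes>\<^sub>M lborel) (config (Suc n)) (\<lambda>(k, q). case_nat q k). P k"
      unfolding distr_case_nat_config by fact
  qed
  from config_pair.AE_pair[OF this] show ?thesis by simp
qed

text \<open>For \<open>k \<circ> to_front j\<close>, photon \<open>j\<close> comes first and the others keep their order.\<close>

definition to_front :: "nat \<Rightarrow> nat \<Rightarrow> nat" where
  "to_front j i = (if i = 0 then j else if i \<le> j then i - 1 else i)"

lemma to_front_permutes: "j \<le> n \<Longrightarrow> to_front j permutes {..<Suc n}"
proof (rule bij_imp_permutes)
  assume j: "j \<le> n"
  show "bij_betw (to_front j) {..<Suc n} {..<Suc n}"
  proof (rule bij_betw_byWitness[where f' = "\<lambda>i. if i = j then 0 else if i < j then Suc i else i"])
  qed (use j in \<open>auto simp: to_front_def split: if_splits\<close>)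
qed (auto simp: to_front_def)

lemma skip_0_to_front: "skip 0 (k \<circ> to_front j) = skip j k"
  by (auto simp: skip_def to_front_def fun_eq_iff)

lemma skip_0_case_nat [simp]: "skip 0 (case_nat q k) = k"
  by (simp add: skip_def)

text \<open>This makes the creation operator independent of representatives.  Up to a permutation, \<open>skip j\<close> is a
  projection of a product, which pulls null sets back to null sets.\<close>

lemma AE_skip_config:
  assumes "AE k in config n. P k" and j: "j \<le> n"
  shows "AE k in (config (Suc n) :: (nat \<Rightarrow> 'a::euclidean_space) measure). P (skip j k)"
proof -
  from assms(1) obtain N where N: "{k \<in> space (config n). \<not> P k} \<subseteq> N" "N \<in> null_sets (config n)"
    unfolding eventually_ae_filter by blast
  have skip0: "skip 0 \<in> config (Suc n) \<rightarrow>\<^sub>M (config n :: (nat \<Rightarrow> 'a) measure)"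
    by (rule measurable_skip_config) simp
  have "AE k in (config (Suc n) :: (nat \<Rightarrow> 'a) measure). skip 0 k \<notin> N"
  proof -
    have "N \<times> space lborel \<in> null_sets (config n \<Otimes>\<^sub>M (lborel :: 'a measure))"
      using N by (auto simp: null_sets_def lborel.emeasure_pair_measure_Times)
    then have "AE x in config n \<Otimes>\<^sub>M (lborel :: 'a measure). x \<notin> N \<times> space lborel"
      by (rule AE_not_in)
    then have "AE x in config n \<Otimes>\<^sub>M (lborel :: 'a measure). skip 0 (case x of (k, q) \<Rightarrow> case_nat q k) \<notin> N"
      by eventually_elim (auto split: prod.split)
    moreover have "{k \<in> space (config (Suc n)). skip 0 k \<notin> N}
        = skip 0 -` (space (config n) - N) \<inter> space (config (Suc n) :: (nat \<Rightarrow> 'a) measure)"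
      using measurable_space[OF skip0] by auto
    then have "{k \<in> space (config (Suc n)). skip 0 k \<notin> N} \<in> sets (config (Suc n) :: (nat \<Rightarrow> 'a) measure)"
      using N(2) by (auto intro!: measurable_sets[OF skip0] simp: null_sets_def)
    ultimately show ?thesis
      using AE_distr_iff[OF measurable_case_nat_config, of n "\<lambda>k. skip 0 k \<notin> N"]
      by (simp only: distr_case_nat_config)
  qed
  from AE_permute_config[OF to_front_permutes[OF j] this]
  have "AE k in (config (Suc n) :: (nat \<Rightarrow> 'a) measure). skip j k \<notin> N"
    by (simp add: skip_0_to_front)
  moreover have "AE k in (config (Suc n) :: (nat \<Rightarrow> 'a) measure). skip j k \<in> space (config n)"
    using measurable_space[OF measurable_skip_config[OF j]] by (rule AE_I2)
  ultimately show ?thesis by eventually_elim (use N(1) in auto)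
qed

section \<open>Field operators\<close>

definition annihilation_wave :: "('a::euclidean_space \<Rightarrow> complex) \<Rightarrow> 'a wave \<Rightarrow> 'a wave" where
  "annihilation_wave f \<psi> n k =
     complex_of_real (sqrt (real (Suc n))) * (\<integral>q. cnj (f q) * \<psi> (Suc n) (case_nat q k) \<partial>lborel)"

definition creation_wave :: "('a::euclidean_space \<Rightarrow> complex) \<Rightarrow> 'a wave \<Rightarrow> 'a wave" where
  "creation_wave f \<psi> n k = (case n of 0 \<Rightarrow> 0
     | Suc l \<Rightarrow> (\<Sum>j\<le>l. f (k j) * \<psi> l (skip j k)) / complex_of_real (sqrt (real n)))"

definition energy_wave :: "('a::euclidean_space) wave \<Rightarrow> 'a wave" where
  "energy_wave \<psi> n k = complex_of_real (\<Sum>i<n. norm (k i)) * \<psi> n k"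

lemma field_operators_eq:
  "annihilation f = wave_op (annihilation_wave f)"
  "creation f = wave_op (creation_wave f)"
  "field_energy = wave_op energy_wave"
  by (simp_all add: annihilation_def creation_def field_energy_def annihilation_wave_def[abs_def]
      creation_wave_def[abs_def] energy_wave_def[abs_def])

lemma fock_eq_refl [simp]: "fock_eq w w \<longleftrightarrow> fock_wave w"
  by (simp add: fock_eq_def)

lemma fock_wave_rep: "fock_wave (rep_fock \<psi>)"
  using Quotient_rep_reflp[OF Quotient_fock] by simp

lemma abs_rep_fock: "abs_fock (rep_fock \<psi>) = \<psi>"
  by (rule Quotient_abs_rep[OF Quotient_fock])

lemma abs_fock_eq: "fock_eq v w \<Longrightarrow> abs_fock v = abs_fock w"
  using Quotient_rel_abs[OF Quotient_fock] by blast

lemma rep_abs_fock: "fock_wave w \<Longrightarrow> fock_eq (rep_fock (abs_fock w)) w"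
  using Quotient_rep_abs[OF Quotient_fock] by simp

lemma cinner_abs: "fock_wave v \<Longrightarrow> fock_wave w \<Longrightarrow> cinner (abs_fock v) (abs_fock w) = wave_inner v w"
  by (simp add: cinner_fock.abs_eq)

lemma fock_wave_measurable: "fock_wave \<psi> \<Longrightarrow> \<psi> n \<in> borel_measurable (config n)"
  by (simp add: fock_wave_def square_integrable_def)

lemma fock_wave_AE_cong:
  assumes w: "fock_wave w" and v: "\<And>n. v n \<in> borel_measurable (config n)"
    and eq: "\<And>n. AE k in config n. v n k = w n k"
  shows "fock_wave v"
proof -
  have sq: "integrable (config n) (\<lambda>k. (cmod (v n k))\<^sup>2)"
    "(\<integral>k. (cmod (v n k))\<^sup>2 \<partial>config n) = (\<integral>k. (cmod (w n k))\<^sup>2 \<partial>config n)" for n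
  proof -
    have [measurable]: "v n \<in> borel_measurable (config n)" "w n \<in> borel_measurable (config n)"
      using v w by (auto intro: fock_wave_measurable)
    have ae: "AE k in config n. (cmod (v n k))\<^sup>2 = (cmod (w n k))\<^sup>2"
      using eq[of n] by eventually_elim simp
    show "integrable (config n) (\<lambda>k. (cmod (v n k))\<^sup>2)"
      using w by (subst integrable_cong_AE[OF _ _ ae]) (auto simp: fock_wave_def square_integrable_def)
    show "(\<integral>k. (cmod (v n k))\<^sup>2 \<partial>config n) = (\<integral>k. (cmod (w n k))\<^sup>2 \<partial>config n)"
      by (rule integral_cong_AE[OF _ _ ae]) auto
  qed
  have "AE k in config n. v n (k \<circ> \<pi>) = v n k" if \<pi>: "\<pi> permutes {..<n}" for n \<pi>
  proof -
    have "AE k in config n. w n (k \<circ> \<pi>) = w n k" using w \<pi> by (auto simp: fock_wave_def)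
    with eq[of n] AE_permute_config[OF \<pi> eq[of n]] show ?thesis by eventually_elim simp
  qed
  then show ?thesis using w v sq by (simp add: fock_wave_def square_integrable_def)
qed

text \<open>Operators on Fock space act on an arbitrary representative; for a given wave \<open>w\<close> the result is
  known once \<open>T\<close> maps all representatives of \<open>w\<close> to the same class.\<close>

lemma wave_op_apply_abs:
  assumes w: "fock_wave w" and v: "fock_wave v"
    and T: "\<And>\<psi> n. fock_eq \<psi> w \<Longrightarrow> T \<psi> n \<in> borel_measurable (config n)"
      "\<And>\<psi> n. fock_eq \<psi> w \<Longrightarrow> AE k in config n. T \<psi> n k = v n k"
  shows "abs_fock w \<in> op_dom (wave_op T)" "op_app (wave_op T) (abs_fock w) = abs_fock v"
proof -
  define \<psi> where "\<psi> = rep_fock (abs_fock w)"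
  have \<psi>: "fock_eq \<psi> w" unfolding \<psi>_def by (rule rep_abs_fock[OF w])
  have "fock_wave (T \<psi>)" by (rule fock_wave_AE_cong[OF v T(1)[OF \<psi>] T(2)[OF \<psi>]])
  moreover from this have "fock_eq (T \<psi>) v" using v T(2)[OF \<psi>] by (simp add: fock_eq_def)
  ultimately show "abs_fock w \<in> op_dom (wave_op T)" "op_app (wave_op T) (abs_fock w) = abs_fock v"
    by (simp_all add: wave_op_def \<psi>_def abs_fock_eq)
qed

lemma cinner_wave_op_left:
  assumes "x \<in> op_dom (wave_op T)"
  shows "cinner (op_app (wave_op T) x) y = wave_inner (T (rep_fock x)) (rep_fock y)"
  using assms cinner_abs[of "T (rep_fock x)" "rep_fock y"]
  by (simp add: wave_op_def fock_wave_rep abs_rep_fock)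

lemma cinner_wave_op_right:
  assumes "x \<in> op_dom (wave_op T)"
  shows "cinner y (op_app (wave_op T) x) = wave_inner (rep_fock y) (T (rep_fock x))"
  using assms cinner_abs[of "rep_fock y" "T (rep_fock x)"]
  by (simp add: wave_op_def fock_wave_rep abs_rep_fock)

lemma field_energy_symmetric: "symmetric_op field_energy"
  unfolding symmetric_op_def field_operators_eq
  by (auto simp: cinner_wave_op_left cinner_wave_op_right wave_inner_def energy_wave_def
      intro!: suminf_cong Bochner_Integration.integral_cong)

lemma square_integrable_tensor:
  assumes "square_integrable (config n) \<phi>" "square_integrable lborel f"
  shows "square_integrable (config (Suc n)) (\<lambda>k. f (k 0) * \<phi> (skip 0 k))"
proof -
  have [measurable]: "\<phi> \<in> borel_measurable (config n)" "f \<in> borel_measurable borel"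
    and i: "integrable (config n) (\<lambda>k. (cmod (\<phi> k))\<^sup>2)" "integrable lborel (\<lambda>q. (cmod (f q))\<^sup>2)"
    using assms by (auto simp: square_integrable_def)
  have m: "(\<lambda>k. f (k 0) * \<phi> (skip 0 k)) \<in> borel_measurable (config (Suc n))"
    by measurable
  have "integrable (config n \<Otimes>\<^sub>M lborel) (\<lambda>x. (cmod (\<phi> (fst x)))\<^sup>2 * (cmod (f (snd x)))\<^sup>2)"
    by (rule config_pair.Fubini_integrable) (use i in \<open>auto intro!: integrable_mult_left integrable_mult_right\<close>)
  then have "integrable (config n \<Otimes>\<^sub>M lborel)
      (\<lambda>x. (cmod (f ((case x of (k, q) \<Rightarrow> case_nat q k) 0) * \<phi> (skip 0 (case x of (k, q) \<Rightarrow> case_nat q k))))\<^sup>2)"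
    by (simp add: norm_mult power_mult_distrib mult.commute split_beta')
  then have "integrable (config (Suc n)) (\<lambda>k. (cmod (f (k 0) * \<phi> (skip 0 k)))\<^sup>2)"
    using m integrable_distr_eq[OF measurable_case_nat_config, of "\<lambda>k. (cmod (f (k 0) * \<phi> (skip 0 k)))\<^sup>2" n]
    by (simp add: distr_case_nat_config)
  then show ?thesis using m by (simp add: square_integrable_def)
qed

text \<open>The \<open>n + 1\<close> terms of the creation operator contribute equally, because \<open>\<psi>\<close> is symmetric and the
  measure is invariant under permutations; in the term \<open>j = 0\<close> the front photon is integrated against
  \<open>f\<close>, which is the annihilation operator.  The factors agree as \<open>(n + 1) / \<surd>(n + 1) = \<surd>(n + 1)\<close>.\<close>

lemma creation_annihilation_adjoint_wave:
  assumes f: "square_integrable lborel f" and \<psi>: "fock_wave \<psi>" and \<phi>: "fock_wave \<phi>"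
  shows "(\<integral>k. cnj (\<psi> (Suc n) k) * creation_wave f \<phi> (Suc n) k \<partial>config (Suc n))
       = (\<integral>k. cnj (annihilation_wave f \<psi> n k) * \<phi> n k \<partial>config n)"
proof -
  have f_meas [measurable]: "f \<in> borel_measurable borel" using f by (simp add: square_integrable_def)
  have [measurable]: "\<psi> (Suc n) \<in> borel_measurable (config (Suc n))" "\<phi> n \<in> borel_measurable (config n)"
    using \<psi> \<phi> by (auto intro: fock_wave_measurable)
  have [measurable]: "cnj \<in> borel_measurable borel"
    by (rule borel_measurable_continuous_onI) (auto intro: continuous_intros)
  define g where "g j k = cnj (\<psi> (Suc n) k) * (f (k j) * \<phi> n (skip j k))" for j k
  have gm [measurable]: "g j \<in> borel_measurable (config (Suc n))" if j: "j \<le> n" for j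
  proof -
    have [measurable]: "(\<lambda>k. k j) \<in> config (Suc n) \<rightarrow>\<^sub>M (borel :: 'a measure)"
      "skip j \<in> config (Suc n) \<rightarrow>\<^sub>M (config n :: (nat \<Rightarrow> 'a) measure)"
      using j by (simp_all add: measurable_config_component measurable_skip_config)
    show ?thesis unfolding g_def[abs_def] by measurable
  qed
  have g0: "integrable (config (Suc n)) (g 0)"
    unfolding g_def using \<psi> \<phi> f
    by (intro square_integrable_cnj_mult(1) square_integrable_tensor) (auto simp: fock_wave_def)
  have g: "integrable (config (Suc n)) (g j)" "(\<integral>k. g j k \<partial>config (Suc n)) = (\<integral>k. g 0 k \<partial>config (Suc n))"
    if j: "j \<le> n" for j
  proof -
    note \<pi> = to_front_permutes[OF j]
    have "AE k in config (Suc n). \<psi> (Suc n) (k \<circ> to_front j) = \<psi> (Suc n) k"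
      using \<psi> \<pi> by (simp add: fock_wave_def)
    then have ae: "AE k in config (Suc n). g 0 (k \<circ> to_front j) = g j k"
      by eventually_elim (simp add: g_def skip_0_to_front to_front_def)
    have m: "(\<lambda>k. g 0 (k \<circ> to_front j)) \<in> borel_measurable (config (Suc n))"
      by (rule measurable_compose[OF measurable_permute_config[OF \<pi>] gm]) simp
    show "integrable (config (Suc n)) (g j)"
      using integrable_cong_AE[OF m gm[OF j] ae] g0 integral_permute_config(2)[OF \<pi> gm[of 0]] by simp
    show "(\<integral>k. g j k \<partial>config (Suc n)) = (\<integral>k. g 0 k \<partial>config (Suc n))"
      using integral_cong_AE[OF m gm[OF j] ae] integral_permute_config(1)[OF \<pi> gm[of 0]] by simp
  qed
  have "(\<integral>k. cnj (\<psi> (Suc n) k) * creation_wave f \<phi> (Suc n) k \<partial>config (Suc n))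
      = (\<integral>k. (\<Sum>j\<le>n. g j k) / sqrt (real (Suc n)) \<partial>config (Suc n))"
    by (simp add: creation_wave_def g_def sum_distrib_left)
  also have "\<dots> = (\<Sum>j\<le>n. (\<integral>k. g j k \<partial>config (Suc n))) / sqrt (real (Suc n))"
    using g(1) by (simp add: Bochner_Integration.integral_sum)
  also have "\<dots> = complex_of_real (real (Suc n) / sqrt (real (Suc n))) * (\<integral>k. g 0 k \<partial>config (Suc n))"
    by (subst sum.cong[OF refl g(2)]) simp_all
  also have "real (Suc n) / sqrt (real (Suc n)) = sqrt (real (Suc n))"
    by (rule real_div_sqrt) simp
  also have "(\<integral>k. g 0 k \<partial>config (Suc n)) = (\<integral>x. g 0 (case x of (k, q) \<Rightarrow> case_nat q k) \<partial>(config n \<Otimes>\<^sub>M lborel))"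
    by (rule integral_config_Suc(1)[symmetric]) simp
  also have "\<dots> = (\<integral>k. \<integral>q. g 0 (case_nat q k) \<partial>lborel \<partial>config n)"
    using g0 integral_config_Suc(2)[OF gm[of 0]]
    by (subst config_pair.integral_fst'[symmetric]) auto
  also have "\<dots> = (\<integral>k. cnj (\<integral>q. cnj (f q) * \<psi> (Suc n) (case_nat q k) \<partial>lborel) * \<phi> n k \<partial>config n)"
  proof (rule Bochner_Integration.integral_cong[OF refl])
    fix k
    have "(\<integral>q. g 0 (case_nat q k) \<partial>lborel) = (\<integral>q. cnj (cnj (f q) * \<psi> (Suc n) (case_nat q k)) * \<phi> n k \<partial>lborel)"
      by (simp add: g_def mult_ac)
    then show "(\<integral>q. g 0 (case_nat q k) \<partial>lborel) = cnj (\<integral>q. cnj (f q) * \<psi> (Suc n) (case_nat q k) \<partial>lborel) * \<phi> n k"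
      by (simp only: integral_mult_left_zero Bochner_Integration.integral_cnj)
  qed
  also have "complex_of_real (sqrt (real (Suc n))) * \<dots>
      = (\<integral>k. cnj (annihilation_wave f \<psi> n k) * \<phi> n k \<partial>config n)"
    by (simp add: annihilation_wave_def mult.assoc)
  finally show ?thesis .
qed

lemma creation_annihilation_adjoint:
  assumes f: "square_integrable lborel f"
    and x: "x \<in> op_dom (annihilation f)" and y: "y \<in> op_dom (creation f)"
  shows "cinner (op_app (annihilation f) x) y = cinner x (op_app (creation f) y)"
proof -
  define \<psi> where "\<psi> = rep_fock x"
  define \<phi> where "\<phi> = rep_fock y"
  define c where "c n = (\<integral>k. cnj (\<psi> n k) * creation_wave f \<phi> n k \<partial>config n)" for n
  have w: "fock_wave \<psi>" "fock_wave \<phi>" "fock_wave (creation_wave f \<phi>)"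
    using y by (auto simp: \<psi>_def \<phi>_def fock_wave_rep field_operators_eq wave_op_def)
  have "summable c"
    unfolding c_def[abs_def] by (rule wave_inner_summable[OF w(1,3)])
  note head = suminf_split_head[OF this]
  have "cinner x (op_app (creation f) y) = (\<Sum>n. c n)"
    using y unfolding field_operators_eq by (simp add: cinner_wave_op_right wave_inner_def c_def \<psi>_def \<phi>_def)
  also have "(\<Sum>n. c n) = (\<Sum>n. c (Suc n))"
    using head by (simp add: c_def[of 0] creation_wave_def)
  also have "\<dots> = cinner (op_app (annihilation f) x) y"
    using x unfolding field_operators_eq
    by (simp add: cinner_wave_op_left wave_inner_def c_def creation_annihilation_adjoint_wave[OF f w(1,2)] flip: \<psi>_def \<phi>_def)
  finally show ?thesis ..
qed

section \<open>Vectors with at most one photon\<close>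

text \<open>The vectors with vacuum amplitude \<open>a\<close>, one photon wave function \<open>\<phi>\<close> and nothing else.  They suffice
  to solve the equations for the ground state and the excited state.\<close>

definition photon01_wave :: "complex \<Rightarrow> ('a::euclidean_space \<Rightarrow> complex) \<Rightarrow> 'a wave" where
  "photon01_wave a \<phi> n k = (if n = 0 then a else if n = Suc 0 then \<phi> (k 0) else 0)"

definition photon01 :: "complex \<Rightarrow> ('a::euclidean_space \<Rightarrow> complex) \<Rightarrow> 'a fock" where
  "photon01 a \<phi> = abs_fock (photon01_wave a \<phi>)"

lemma distr_config_1: "distr (config (Suc 0)) lborel (\<lambda>k. k 0) = (lborel :: 'a::euclidean_space measure)"
  using lborel_prod.distr_singleton[of 0, where 'a = 'a]
  by (simp add: config_def lessThan_Suc)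

lemma measurable_config_1: "(\<lambda>k. k 0) \<in> config (Suc 0) \<rightarrow>\<^sub>M (lborel :: 'a::euclidean_space measure)"
  by simp

lemma integral_config_1:
  fixes g :: "'a::euclidean_space \<Rightarrow> 'b::{banach, second_countable_topology}"
  assumes "g \<in> borel_measurable borel"
  shows "(\<integral>k. g (k 0) \<partial>config (Suc 0)) = (\<integral>q. g q \<partial>lborel)"
    and "integrable (config (Suc 0)) (\<lambda>k. g (k 0)) \<longleftrightarrow> integrable lborel g"
  using integral_distr[OF measurable_config_1, of g] integrable_distr_eq[OF measurable_config_1, of g] assms
  by (simp_all add: distr_config_1)

lemma config_0: "config 0 = count_space {\<lambda>_. undefined :: 'a::euclidean_space}"
  unfolding config_def by (simp add: PiM_empty)

lemma square_integrable_photon01_wave: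
  assumes "square_integrable lborel \<phi>"
  shows "square_integrable (config n) (photon01_wave a \<phi> n)"
proof -
  consider "n = 0" | "n = Suc 0" | "n \<noteq> 0" "n \<noteq> Suc 0" by blast
  then show ?thesis
  proof cases
    case 1
    then show ?thesis by (simp add: square_integrable_def config_0 integrable_count_space)
  next
    case 2
    have [measurable]: "\<phi> \<in> borel_measurable borel" using assms by (simp add: square_integrable_def)
    show ?thesis
      using assms integral_config_1(2)[of "\<lambda>q. (cmod (\<phi> q))\<^sup>2"]
      by (simp add: 2 photon01_wave_def[abs_def] square_integrable_def)
  next
    case 3
    then show ?thesis by (simp add: photon01_wave_def[abs_def] square_integrable_0)
  qed
qed

lemma fock_wave_photon01_wave [simp]:
  assumes "square_integrable lborel \<phi>"
  shows "fock_wave (photon01_wave a \<phi>)"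
  unfolding fock_wave_def
proof (intro conjI allI impI)
  fix n \<pi> assume "\<pi> permutes {..<n :: nat}"
  then have "n = Suc 0 \<Longrightarrow> \<pi> = id"
    by (simp add: lessThan_Suc)
  then show "AE k in config n. photon01_wave a \<phi> n (k \<circ> \<pi>) = photon01_wave a \<phi> n k"
    by (cases "n = Suc 0") (simp_all add: photon01_wave_def)
next
  show "summable (\<lambda>n. \<integral>k. (cmod (photon01_wave a \<phi> n k))\<^sup>2 \<partial>config n)"
    by (rule summable_finite[of "{0, Suc 0}"]) (auto simp: photon01_wave_def)
qed (rule square_integrable_photon01_wave[OF assms])

lemma cinner_photon01:
  assumes "square_integrable lborel \<phi>" "square_integrable lborel \<eta>"
  shows "cinner (photon01 a \<phi>) (photon01 b \<eta>) = cnj a * b + (\<integral>q. cnj (\<phi> q) * \<eta> q \<partial>lborel)"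
proof -
  have [measurable]: "\<phi> \<in> borel_measurable borel" "\<eta> \<in> borel_measurable borel"
    using assms by (auto simp: square_integrable_def)
  have m: "(\<lambda>q. cnj (\<phi> q) * \<eta> q) \<in> borel_measurable borel"
    using square_integrable_cnj_mult(1)[OF assms] by (simp add: integrable_iff_bounded)
  have "cinner (photon01 a \<phi>) (photon01 b \<eta>) = (\<Sum>n. \<integral>k. cnj (photon01_wave a \<phi> n k) * photon01_wave b \<eta> n k \<partial>config n)"
    using assms by (simp add: photon01_def cinner_abs wave_inner_def)
  also have "\<dots> = (\<Sum>n\<in>{0, Suc 0}. \<integral>k. cnj (photon01_wave a \<phi> n k) * photon01_wave b \<eta> n k \<partial>config n)"
    by (rule suminf_finite) (auto simp: photon01_wave_def)
  also have "\<dots> = cnj a * b + (\<integral>q. cnj (\<phi> q) * \<eta> q \<partial>lborel)"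
    using integral_config_1(1)[OF m] by (simp add: photon01_wave_def config_0 lebesgue_integral_count_space_finite)
  finally show ?thesis .
qed

lemma norm_photon01:
  assumes "square_integrable lborel \<phi>"
  shows "(norm (photon01 a \<phi>))\<^sup>2 = (cmod a)\<^sup>2 + (\<integral>q. (cmod (\<phi> q))\<^sup>2 \<partial>lborel)"
proof -
  have "(\<integral>q. cnj (\<phi> q) * \<phi> q \<partial>lborel) = (\<integral>q. complex_of_real ((cmod (\<phi> q))\<^sup>2) \<partial>lborel)"
    by (simp only: complex_norm_square mult.commute)
  then have "complex_of_real ((norm (photon01 a \<phi>))\<^sup>2)
      = complex_of_real ((cmod a)\<^sup>2 + (\<integral>q. (cmod (\<phi> q))\<^sup>2 \<partial>lborel))"
    unfolding cinner_self[symmetric] cinner_photon01[OF assms assms] of_real_add complex_norm_square[of a]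
    by (simp only: integral_complex_of_real mult.commute)
  then show ?thesis unfolding of_real_eq_iff .
qed

lemma photon01_add:
  assumes "square_integrable lborel \<phi>" "square_integrable lborel \<eta>"
  shows "photon01 a \<phi> + photon01 b \<eta> = photon01 (a + b) (\<lambda>q. \<phi> q + \<eta> q)"
proof -
  have "(\<lambda>n k. photon01_wave a \<phi> n k + photon01_wave b \<eta> n k) = photon01_wave (a + b) (\<lambda>q. \<phi> q + \<eta> q)"
    by (simp add: photon01_wave_def fun_eq_iff)
  then show ?thesis using assms by (simp add: photon01_def plus_fock.abs_eq)
qed

lemma photon01_scaleC:
  assumes "square_integrable lborel \<phi>"
  shows "c *\<^sub>C photon01 a \<phi> = photon01 (c * a) (\<lambda>q. c * \<phi> q)"
proof -
  have "(\<lambda>n k. c * photon01_wave a \<phi> n k) = photon01_wave (c * a) (\<lambda>q. c * \<phi> q)"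
    by (simp add: photon01_wave_def fun_eq_iff)
  then show ?thesis using assms by (simp add: photon01_def scaleC_fock.abs_eq)
qed

lemma photon01_zero: "photon01 0 (\<lambda>_. 0) = 0"
  using photon01_scaleC[OF square_integrable_0, of 0 0] by simp

lemma vacuum_eq_photon01: "vacuum = photon01 1 (\<lambda>_. 0)"
  unfolding vacuum_def photon01_def
  by (rule arg_cong[where f = abs_fock]) (auto simp: photon01_wave_def fun_eq_iff)

lemma fock_eq_photon01_wave:
  assumes "fock_eq \<psi> (photon01_wave a \<phi>)"
  shows "\<And>n. \<psi> n \<in> borel_measurable (config n)"
    and "\<psi> 0 (\<lambda>_. undefined) = a"
    and "AE k in config (Suc 0). \<psi> (Suc 0) k = \<phi> (k 0)"
    and "\<And>n. AE k in config (Suc (Suc n)). \<psi> (Suc (Suc n)) k = 0"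
proof -
  have *: "AE k in config n. \<psi> n k = photon01_wave a \<phi> n k" for n
    using assms by (simp add: fock_eq_def)
  show "\<psi> n \<in> borel_measurable (config n)" for n
    using assms by (auto simp: fock_eq_def intro: fock_wave_measurable)
  show "\<psi> 0 (\<lambda>_. undefined) = a"
    using *[of 0] unfolding config_0 by (simp add: AE_count_space photon01_wave_def)
  show "AE k in config (Suc 0). \<psi> (Suc 0) k = \<phi> (k 0)"
    using *[of "Suc 0"] by (simp add: photon01_wave_def)
  show "AE k in config (Suc (Suc n)). \<psi> (Suc (Suc n)) k = 0" for n
    using *[of "Suc (Suc n)"] by (simp add: photon01_wave_def)
qed

lemma field_energy_photon01:
  assumes \<phi>: "square_integrable lborel \<phi>"
    and e: "square_integrable lborel (\<lambda>q. complex_of_real (norm q) * \<phi> q)"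
  shows "photon01 a \<phi> \<in> op_dom field_energy"
    and "op_app field_energy (photon01 a \<phi>) = photon01 0 (\<lambda>q. complex_of_real (norm q) * \<phi> q)"
proof -
  have m: "energy_wave \<psi> n \<in> borel_measurable (config n)"
    if "fock_eq \<psi> (photon01_wave a \<phi>)" for \<psi> n
    unfolding energy_wave_def[abs_def] using fock_eq_photon01_wave(1)[OF that, of n]
    by measurable
  have ae: "AE k in config n. energy_wave \<psi> n k = photon01_wave 0 (\<lambda>q. complex_of_real (norm q) * \<phi> q) n k"
    if "fock_eq \<psi> (photon01_wave a \<phi>)" for \<psi> n
  proof -
    have "AE k in config n. \<psi> n k = photon01_wave a \<phi> n k"
      using that by (simp add: fock_eq_def)
    then show ?thesis by eventually_elim (auto simp: energy_wave_def photon01_wave_def)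
  qed
  show "photon01 a \<phi> \<in> op_dom field_energy"
    "op_app field_energy (photon01 a \<phi>) = photon01 0 (\<lambda>q. complex_of_real (norm q) * \<phi> q)"
    unfolding photon01_def field_operators_eq
    using wave_op_apply_abs[OF fock_wave_photon01_wave[OF \<phi>] fock_wave_photon01_wave[OF e] m ae]
    by simp_all
qed

lemma creation_photon01:
  assumes f: "square_integrable lborel f"
  shows "photon01 b (\<lambda>_. 0) \<in> op_dom (creation f)"
    and "op_app (creation f) (photon01 b (\<lambda>_. 0)) = photon01 0 (\<lambda>q. b * f q)"
proof -
  have [measurable]: "f \<in> borel_measurable borel" using f by (simp add: square_integrable_def)
  have m: "creation_wave f \<psi> n \<in> borel_measurable (config n)"
    if \<psi>: "fock_eq \<psi> (photon01_wave b (\<lambda>_. 0))" for \<psi> n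
  proof (cases n)
    case (Suc l)
    have "(\<lambda>k. f (k j) * \<psi> l (skip j k)) \<in> borel_measurable (config (Suc l))" if "j \<le> l" for j
    proof -
      have [measurable]: "(\<lambda>k. k j) \<in> config (Suc l) \<rightarrow>\<^sub>M (borel :: 'a measure)"
        "skip j \<in> config (Suc l) \<rightarrow>\<^sub>M (config l :: (nat \<Rightarrow> 'a) measure)"
        "\<psi> l \<in> borel_measurable (config l)"
        using that fock_eq_photon01_wave(1)[OF \<psi>]
        by (simp_all add: measurable_config_component measurable_skip_config)
      show ?thesis by measurable
    qed
    then show ?thesis unfolding Suc creation_wave_def by (auto intro!: borel_measurable_divide borel_measurable_sum)
  qed (simp add: creation_wave_def[abs_def])
  have ae: "AE k in config n. creation_wave f \<psi> n k = photon01_wave 0 (\<lambda>q. b * f q) n k"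
    if \<psi>: "fock_eq \<psi> (photon01_wave b (\<lambda>_. 0))" for \<psi> n
  proof -
    consider "n = 0" | "n = Suc 0" | l where "n = Suc (Suc l)" by (metis not0_implies_Suc)
    then show ?thesis
    proof cases
      case 1
      then show ?thesis by (simp add: creation_wave_def photon01_wave_def)
    next
      case 2
      have "creation_wave f \<psi> (Suc 0) k = photon01_wave 0 (\<lambda>q. b * f q) (Suc 0) k" if "k \<in> space (config (Suc 0))" for k
      proof -
        have "skip 0 k = (\<lambda>_. undefined)"
          using that by (auto simp: skip_def space_config)
        then show ?thesis using fock_eq_photon01_wave(2)[OF \<psi>] by (simp add: creation_wave_def photon01_wave_def)
      qed
      then show ?thesis unfolding 2 by (rule AE_I2)
    next
      case (3 l)
      have z: "AE k in config (Suc l). \<psi> (Suc l) k = 0"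
      proof (cases l)
        case 0
        show ?thesis unfolding 0 using fock_eq_photon01_wave(3)[OF \<psi>] by simp
      next
        case (Suc i)
        show ?thesis unfolding Suc using fock_eq_photon01_wave(4)[OF \<psi>] by simp
      qed
      have "AE k in config (Suc (Suc l)). \<forall>j\<in>{..Suc l}. \<psi> (Suc l) (skip j k) = 0"
        by (subst AE_finite_all) (auto intro!: AE_skip_config[OF z])
      then show ?thesis unfolding 3
        by eventually_elim (simp add: creation_wave_def photon01_wave_def)
    qed
  qed
  show "photon01 b (\<lambda>_. 0) \<in> op_dom (creation f)"
    "op_app (creation f) (photon01 b (\<lambda>_. 0)) = photon01 0 (\<lambda>q. b * f q)"
    unfolding photon01_def field_operators_eq
    using wave_op_apply_abs[OF fock_wave_photon01_wave[OF square_integrable_0]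
        fock_wave_photon01_wave[OF square_integrable_mult[OF f]] m ae]
    by simp_all
qed

lemma annihilation_photon01:
  assumes f: "square_integrable lborel f" and \<phi>: "square_integrable lborel \<phi>"
  shows "photon01 a \<phi> \<in> op_dom (annihilation f)"
    and "op_app (annihilation f) (photon01 a \<phi>) = photon01 (\<integral>q. cnj (f q) * \<phi> q \<partial>lborel) (\<lambda>_. 0)"
proof -
  have [measurable]: "f \<in> borel_measurable borel" "\<phi> \<in> borel_measurable borel"
    using f \<phi> by (auto simp: square_integrable_def)
  have [measurable]: "cnj \<in> borel_measurable borel"
    by (rule borel_measurable_continuous_onI) (auto intro: continuous_intros)
  have m: "annihilation_wave f \<psi> n \<in> borel_measurable (config n)"
    if \<psi>: "fock_eq \<psi> (photon01_wave a \<phi>)" for \<psi> n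
  proof -
    have [measurable]: "\<psi> (Suc n) \<in> borel_measurable (config (Suc n))"
      by (rule fock_eq_photon01_wave(1)[OF \<psi>])
    have "(\<lambda>x. cnj (f (snd x)) * \<psi> (Suc n) (case x of (k, q) \<Rightarrow> case_nat q k))
        \<in> borel_measurable (config n \<Otimes>\<^sub>M lborel)"
      by measurable
    then show ?thesis
      unfolding annihilation_wave_def[abs_def]
      by (intro borel_measurable_times borel_measurable_const lborel.borel_measurable_lebesgue_integral)
        (simp add: split_beta')
  qed
  have ae: "AE k in config n. annihilation_wave f \<psi> n k = photon01_wave (\<integral>q. cnj (f q) * \<phi> q \<partial>lborel) (\<lambda>_. 0) n k"
    if \<psi>: "fock_eq \<psi> (photon01_wave a \<phi>)" for \<psi> n
  proof -
    have \<psi>m [measurable]: "\<psi> (Suc n) \<in> borel_measurable (config (Suc n))"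
      by (rule fock_eq_photon01_wave(1)[OF \<psi>])
    have m2: "(\<lambda>q. \<psi> (Suc n) (case_nat q k)) \<in> borel_measurable lborel" if "k \<in> space (config n)" for k
      using measurable_compose[OF measurable_Pair1'[OF that] measurable_compose[OF measurable_case_nat_config \<psi>m]]
      by simp
    have *: "AE k in config n. AE q in lborel. \<psi> (Suc n) (case_nat q k) = (if n = 0 then \<phi> q else 0)"
    proof (cases n)
      case 0
      show ?thesis unfolding 0 using AE_config_Suc[OF fock_eq_photon01_wave(3)[OF \<psi>]] by simp
    next
      case (Suc l)
      show ?thesis unfolding Suc using AE_config_Suc[OF fock_eq_photon01_wave(4)[OF \<psi>, of l]] by simp
    qed
    have "AE k in config n. k \<in> space (config n)" by (rule AE_space)
    with * show ?thesis
    proof eventually_elim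
      case (elim k)
      have "(\<integral>q. cnj (f q) * \<psi> (Suc n) (case_nat q k) \<partial>lborel)
          = (\<integral>q. cnj (f q) * (if n = 0 then \<phi> q else 0) \<partial>lborel)"
        using elim(1) m2[OF elim(2)] by (intro integral_cong_AE) (auto elim!: eventually_mono)
      then show ?case by (simp add: annihilation_wave_def photon01_wave_def)
    qed
  qed
  show "photon01 a \<phi> \<in> op_dom (annihilation f)"
    "op_app (annihilation f) (photon01 a \<phi>) = photon01 (\<integral>q. cnj (f q) * \<phi> q \<partial>lborel) (\<lambda>_. 0)"
    unfolding photon01_def field_operators_eq
    using wave_op_apply_abs[OF fock_wave_photon01_wave[OF \<phi>] fock_wave_photon01_wave[OF square_integrable_0] m ae]
    by simp_all
qed

declare measurable_config_component [measurable del]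

section \<open>Radial integrals\<close>

definition sphere_area :: "'a::euclidean_space itself \<Rightarrow> real" where
  "sphere_area _ = real DIM('a) * unit_ball_vol DIM('a)"

text \<open>The radial part of Lebesgue measure is determined by the volumes of balls.\<close>

lemma distr_norm_lborel:
  "distr lborel borel (norm :: 'a::euclidean_space \<Rightarrow> real)
     = density lborel (\<lambda>\<rho>. ennreal (indicator {0..} \<rho> * (sphere_area TYPE('a) * \<rho> ^ (DIM('a) - 1))))"
    (is "?M = ?N")
proof (rule measure_eqI_generator_eq[where E = "range atMost" and \<Omega> = UNIV and A = "\<lambda>n. {..real n}"])
  show "Int_stable (range (atMost :: real \<Rightarrow> real set))"
    by (auto simp: Int_stable_def)
  show "sets ?M = sigma_sets UNIV (range atMost)" "sets ?N = sigma_sets UNIV (range atMost)"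
    by (simp_all add: borel_eq_atMost)
  show "(\<Union>i. {..real i}) = UNIV"
    by (auto intro: real_arch_simple)
  have M: "emeasure ?M {..x} = ennreal (unit_ball_vol DIM('a) * x ^ DIM('a))" if "0 \<le> x" for x
  proof -
    have "norm -` {..x} \<inter> space lborel = cball (0 :: 'a) x" by auto
    then show ?thesis using that by (simp add: emeasure_distr emeasure_cball)
  qed
  have N: "emeasure ?N {..x} = ennreal (unit_ball_vol DIM('a) * x ^ DIM('a))" if "0 \<le> x" for x
  proof -
    have "emeasure ?N {..x} = (\<integral>\<^sup>+\<rho>. ennreal (sphere_area TYPE('a) * \<rho> ^ (DIM('a) - 1)) * indicator {0..x} \<rho> \<partial>lborel)"
      by (subst emeasure_density) (auto intro!: nn_integral_cong simp: indicator_def)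
    also have "\<dots> = ennreal (unit_ball_vol DIM('a) * x ^ DIM('a) - unit_ball_vol DIM('a) * 0 ^ DIM('a))"
    proof (rule nn_integral_FTC_Icc)
      fix \<rho> :: real assume "\<rho> \<in> {0..x}"
      show "((\<lambda>\<rho>. unit_ball_vol DIM('a) * \<rho> ^ DIM('a)) has_real_derivative
          sphere_area TYPE('a) * \<rho> ^ (DIM('a) - 1)) (at \<rho>)"
        unfolding sphere_area_def by (auto intro!: derivative_eq_intros)
      show "0 \<le> sphere_area TYPE('a) * \<rho> ^ (DIM('a) - 1)"
        using \<open>\<rho> \<in> {0..x}\<close> by (simp add: sphere_area_def)
    qed (use that in auto)
    finally show ?thesis by (simp add: power_0_left)
  qed
  show "emeasure ?M X = emeasure ?N X" if "X \<in> range atMost" for X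
  proof -
    from that obtain x where X: "X = {..x}" by auto
    show ?thesis
    proof (cases "0 \<le> x")
      case True
      show ?thesis unfolding X M[OF True] N[OF True] ..
    next
      case False
      have "norm -` {..x} \<inter> space lborel = ({} :: 'a set)"
        using False by (auto simp: not_le) (meson norm_ge_zero order_trans not_le)
      then have "emeasure ?M {..x} = 0" by (simp add: emeasure_distr)
      moreover have "emeasure ?N {..x} = (\<integral>\<^sup>+\<rho>. ennreal (indicator {0..} \<rho> * (sphere_area TYPE('a) * \<rho> ^ (DIM('a) - 1))) * indicator {..x} \<rho> \<partial>lborel)"
        by (rule emeasure_density) auto
      moreover have "\<dots> = (\<integral>\<^sup>+\<rho>. 0 \<partial>(lborel :: real measure))"
        by (rule nn_integral_cong) (use False in \<open>simp add: indicator_def\<close>)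
      ultimately show ?thesis by (simp add: X)
    qed
  qed
  show "emeasure ?M {..real i} \<noteq> \<infinity>" for i :: nat
    by (simp add: M)
qed auto

lemma radial_integral:
  fixes g :: "real \<Rightarrow> 'b::{banach, second_countable_topology}"
  assumes g: "g \<in> borel_measurable borel"
  shows "(\<integral>q. g (norm (q :: 'a::euclidean_space)) \<partial>lborel)
       = (\<integral>\<rho>. (indicator {0..} \<rho> * (sphere_area TYPE('a) * \<rho> ^ (DIM('a) - 1))) *\<^sub>R g \<rho> \<partial>lborel)"
    and "integrable lborel (\<lambda>q :: 'a. g (norm q)) \<longleftrightarrow>
         integrable lborel (\<lambda>\<rho>. (indicator {0..} \<rho> * (sphere_area TYPE('a) * \<rho> ^ (DIM('a) - 1))) *\<^sub>R g \<rho>)"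
proof -
  have m: "(\<lambda>\<rho> :: real. indicator {0..} \<rho> * (sphere_area TYPE('a) * \<rho> ^ (DIM('a) - 1))) \<in> borel_measurable lborel"
    by simp
  have nn: "AE \<rho> in lborel. 0 \<le> indicator {0..} \<rho> * (sphere_area TYPE('a) * \<rho> ^ (DIM('a) - 1))"
    by (rule AE_I2) (auto simp: indicator_def sphere_area_def)
  have n: "(norm :: 'a \<Rightarrow> real) \<in> lborel \<rightarrow>\<^sub>M borel" by simp
  show "(\<integral>q. g (norm (q :: 'a)) \<partial>lborel)
       = (\<integral>\<rho>. (indicator {0..} \<rho> * (sphere_area TYPE('a) * \<rho> ^ (DIM('a) - 1))) *\<^sub>R g \<rho> \<partial>lborel)"
    using integral_distr[OF n g] integral_density[OF _ m nn, of g] g by (simp add: distr_norm_lborel)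
  show "integrable lborel (\<lambda>q :: 'a. g (norm q)) \<longleftrightarrow>
         integrable lborel (\<lambda>\<rho>. (indicator {0..} \<rho> * (sphere_area TYPE('a) * \<rho> ^ (DIM('a) - 1))) *\<^sub>R g \<rho>)"
    using integrable_distr_eq[OF n g] integrable_density[OF _ m nn, of g] g by (simp add: distr_norm_lborel)
qed

text \<open>Here \<open>K\<close> and \<open>r\<close> are the constant and the radius of the square root singularity.\<close>

locale singular_coupling =
  fixes f :: "'a::euclidean_space \<Rightarrow> complex" and K :: complex and r :: real
  assumes dim: "3 \<le> DIM('a)"
    and f: "square_integrable lborel f"
    and r: "0 < r"
    and sing: "\<And>k. 0 < norm k \<Longrightarrow> norm k < r \<Longrightarrow> f k = K * complex_of_real (sqrt (1 / norm k))"
begin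

text \<open>Near \<open>0\<close>, \<open>|f|\<^sup>2 dk\<close> has the radial density \<open>\<kappa> \<rho>\<^bsup>d-2\<^esup>\<close>: the singularity lowers the power \<open>\<rho>\<^bsup>d-1\<^esup>\<close> of
  the sphere by one.\<close>

definition \<kappa> :: real where "\<kappa> = (cmod K)\<^sup>2 * sphere_area TYPE('a)"

lemma kappa_nonneg: "0 \<le> \<kappa>"
  by (simp add: \<kappa>_def sphere_area_def)

lemma f_measurable [measurable]: "f \<in> borel_measurable borel"
  using f by (simp add: square_integrable_def)

lemma f_sq: "0 < norm k \<Longrightarrow> norm k < r \<Longrightarrow> (cmod (f k))\<^sup>2 = (cmod K)\<^sup>2 / norm k"
  by (simp add: sing norm_mult power_mult_distrib)

lemma near_integral:
  fixes g :: "real \<Rightarrow> 'b::{banach, second_countable_topology}"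
  assumes g: "g \<in> borel_measurable borel"
  shows "(\<integral>q. (indicator {0<..<r} (norm q) * (cmod (f q))\<^sup>2) *\<^sub>R g (norm q) \<partial>lborel)
       = (\<integral>\<rho>. indicator {0..r} \<rho> *\<^sub>R ((\<kappa> * \<rho> ^ (DIM('a) - 2)) *\<^sub>R g \<rho>) \<partial>lborel)"
    and "integrable lborel (\<lambda>q. (indicator {0<..<r} (norm q) * (cmod (f q))\<^sup>2) *\<^sub>R g (norm q)) \<longleftrightarrow>
         integrable lborel (\<lambda>\<rho>. indicator {0..r} \<rho> *\<^sub>R ((\<kappa> * \<rho> ^ (DIM('a) - 2)) *\<^sub>R g \<rho>))"
proof -
  have [measurable]: "g \<in> borel_measurable borel" by (rule g)
  define h where "h \<rho> = (indicator {0<..<r} \<rho> * ((cmod K)\<^sup>2 / \<rho>)) *\<^sub>R g \<rho>" for \<rho>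
  have h: "h \<in> borel_measurable borel" unfolding h_def[abs_def] by measurable
  have eq1: "(indicator {0<..<r} (norm q) * (cmod (f q))\<^sup>2) *\<^sub>R g (norm q) = h (norm q)" for q
    by (auto simp: h_def indicator_def f_sq)
  have p: "\<rho> ^ (DIM('a) - 1) / \<rho> = \<rho> ^ (DIM('a) - 2)" if "0 < \<rho>" for \<rho> :: real
  proof -
    have "DIM('a) - 1 = Suc (DIM('a) - 2)" using dim by simp
    then show ?thesis using that by simp
  qed
  have eq2: "(indicator {0..} \<rho> * (sphere_area TYPE('a) * \<rho> ^ (DIM('a) - 1))) *\<^sub>R h \<rho>
      = indicator {0<..<r} \<rho> *\<^sub>R ((\<kappa> * \<rho> ^ (DIM('a) - 2)) *\<^sub>R g \<rho>)" for \<rho>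
    using p[of \<rho>] by (auto simp: h_def indicator_def \<kappa>_def field_simps)
  have ae: "AE \<rho> in lborel. indicator {0<..<r} \<rho> *\<^sub>R ((\<kappa> * \<rho> ^ (DIM('a) - 2)) *\<^sub>R g \<rho>)
      = indicator {0..r} \<rho> *\<^sub>R ((\<kappa> * \<rho> ^ (DIM('a) - 2)) *\<^sub>R g \<rho>)"
    using AE_lborel_singleton[of "0 :: real"] AE_lborel_singleton[of r]
    by eventually_elim (auto simp: indicator_def)
  show "(\<integral>q. (indicator {0<..<r} (norm q) * (cmod (f q))\<^sup>2) *\<^sub>R g (norm q) \<partial>lborel)
       = (\<integral>\<rho>. indicator {0..r} \<rho> *\<^sub>R ((\<kappa> * \<rho> ^ (DIM('a) - 2)) *\<^sub>R g \<rho>) \<partial>lborel)"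
    unfolding eq1 radial_integral(1)[OF h] eq2 by (rule integral_cong_AE[OF _ _ ae]) auto
  show "integrable lborel (\<lambda>q. (indicator {0<..<r} (norm q) * (cmod (f q))\<^sup>2) *\<^sub>R g (norm q)) \<longleftrightarrow>
         integrable lborel (\<lambda>\<rho>. indicator {0..r} \<rho> *\<^sub>R ((\<kappa> * \<rho> ^ (DIM('a) - 2)) *\<^sub>R g \<rho>))"
    unfolding eq1 radial_integral(2)[OF h] eq2 by (rule integrable_cong_AE[OF _ _ ae]) auto
qed

lemma far_integrable:
  fixes g :: "'a \<Rightarrow> 'b::{banach, second_countable_topology}"
  assumes [measurable]: "g \<in> borel_measurable borel"
    and g: "\<And>q. r \<le> norm q \<Longrightarrow> norm (g q) \<le> B"
  shows "integrable lborel (\<lambda>q. (indicator {r..} (norm q) * (cmod (f q))\<^sup>2) *\<^sub>R g q)"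
proof (rule Bochner_Integration.integrable_bound)
  show "integrable lborel (\<lambda>q. B * (cmod (f q))\<^sup>2)"
    using f by (simp add: square_integrable_def)
  have "norm (g q) * (cmod (f q))\<^sup>2 \<le> \<bar>B\<bar> * (cmod (f q))\<^sup>2" if "r \<le> norm q" for q
    using g[OF that] by (intro mult_right_mono) auto
  then show "AE q in lborel. norm ((indicator {r..} (norm q) * (cmod (f q))\<^sup>2) *\<^sub>R g q) \<le> norm (B * (cmod (f q))\<^sup>2)"
    by (intro AE_I2) (auto simp: indicator_def abs_mult mult.commute)
qed measurable

lemma norm_recip_far:
  assumes "r \<le> norm (q :: 'a)"
  shows "norm (1 / norm q) \<le> 1 / r" "norm (1 / (norm q)\<^sup>2) \<le> 1 / r\<^sup>2"
  using r assms by (auto simp: power_divide[symmetric] intro!: divide_left_mono power_mono mult_pos_pos zero_less_power)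

lemma near_far_integral:
  fixes g :: "'a \<Rightarrow> 'b::{banach, second_countable_topology}"
  assumes [measurable]: "g \<in> borel_measurable borel"
    and near: "integrable lborel (\<lambda>q. (indicator {0<..<r} (norm q) * (cmod (f q))\<^sup>2) *\<^sub>R g q)"
    and far: "integrable lborel (\<lambda>q. (indicator {r..} (norm q) * (cmod (f q))\<^sup>2) *\<^sub>R g q)"
  shows "integrable lborel (\<lambda>q. (cmod (f q))\<^sup>2 *\<^sub>R g q)"
    and "(\<integral>q. (cmod (f q))\<^sup>2 *\<^sub>R g q \<partial>lborel)
       = (\<integral>q. (indicator {0<..<r} (norm q) * (cmod (f q))\<^sup>2) *\<^sub>R g q \<partial>lborel)
       + (\<integral>q. (indicator {r..} (norm q) * (cmod (f q))\<^sup>2) *\<^sub>R g q \<partial>lborel)"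
proof -
  have ae: "AE q in lborel. (indicator {0<..<r} (norm q) * (cmod (f q))\<^sup>2) *\<^sub>R g q
      + (indicator {r..} (norm q) * (cmod (f q))\<^sup>2) *\<^sub>R g q = (cmod (f q))\<^sup>2 *\<^sub>R g q"
    using AE_lborel_singleton[of "0 :: 'a"] by eventually_elim (use r in \<open>auto simp: indicator_def\<close>)
  note s = Bochner_Integration.integrable_add[OF near far]
  show "integrable lborel (\<lambda>q. (cmod (f q))\<^sup>2 *\<^sub>R g q)"
    using s by (subst integrable_cong_AE[OF _ _ ae, symmetric]) auto
  show "(\<integral>q. (cmod (f q))\<^sup>2 *\<^sub>R g q \<partial>lborel)
       = (\<integral>q. (indicator {0<..<r} (norm q) * (cmod (f q))\<^sup>2) *\<^sub>R g q \<partial>lborel)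
       + (\<integral>q. (indicator {r..} (norm q) * (cmod (f q))\<^sup>2) *\<^sub>R g q \<partial>lborel)"
    unfolding Bochner_Integration.integral_add[OF near far, symmetric]
    by (rule integral_cong_AE[symmetric, OF _ _ ae]) auto
qed

lemma power_integral:
  fixes a b :: real
  assumes "a \<le> b"
  shows "has_bochner_integral lborel (\<lambda>\<rho>. indicator {a..b} \<rho> *\<^sub>R (c * \<rho> ^ n))
    (c * b ^ Suc n / Suc n - c * a ^ Suc n / Suc n)"
proof (rule has_bochner_integral_FTC_Icc[OF assms, of "\<lambda>\<rho>. c * \<rho> ^ Suc n / Suc n"])
  fix x assume "a \<le> x" "x \<le> b"
  have "((\<lambda>\<rho>. c * \<rho> ^ Suc n / Suc n) has_real_derivative c * (real (Suc n) * x ^ n) / Suc n) (at x within {a..b})"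
    by (rule derivative_eq_intros refl | simp)+
  then show "((\<lambda>\<rho>. c * \<rho> ^ Suc n / Suc n) has_vector_derivative c * x ^ n) (at x within {a..b})"
    by (simp add: has_real_derivative_iff_has_vector_derivative)
qed (auto intro!: continuous_intros)

lemma coupling_energy_integral:
  "integrable lborel (\<lambda>q. (cmod (f q))\<^sup>2 / norm q)"
  "coupling_energy f = \<kappa> * r ^ (DIM('a) - 2) / real (DIM('a) - 2)
     + (\<integral>q. (indicator {r..} (norm q) * (cmod (f q))\<^sup>2) *\<^sub>R (1 / norm q) \<partial>lborel)"
proof -
  define N where "N = DIM('a) - 3"
  have N: "DIM('a) - 2 = Suc N" using dim by (simp add: N_def)
  have eq: "indicator {0..r} \<rho> *\<^sub>R ((\<kappa> * \<rho> ^ (DIM('a) - 2)) *\<^sub>R (1 / \<rho>)) = indicator {0..r} \<rho> *\<^sub>R (\<kappa> * \<rho> ^ N)" if "\<rho> \<noteq> 0" for \<rho>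
    using that by (simp add: N)
  have ae: "AE \<rho> in lborel. indicator {0..r} \<rho> *\<^sub>R ((\<kappa> * \<rho> ^ (DIM('a) - 2)) *\<^sub>R (1 / \<rho>))
      = indicator {0..r} \<rho> *\<^sub>R (\<kappa> * \<rho> ^ N)"
    using AE_lborel_singleton[of "0 :: real"] by eventually_elim (rule eq)
  have "has_bochner_integral lborel (\<lambda>\<rho>. indicator {0..r} \<rho> *\<^sub>R ((\<kappa> * \<rho> ^ (DIM('a) - 2)) *\<^sub>R (1 / \<rho>)))
      (\<kappa> * r ^ Suc N / Suc N - \<kappa> * 0 ^ Suc N / Suc N)"
    by (subst has_bochner_integral_cong_AE[OF _ _ ae]) (use power_integral[of 0 r \<kappa> N] r in \<open>auto simp del: of_nat_Suc power_Suc\<close>)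
  then have near: "integrable lborel (\<lambda>q. (indicator {0<..<r} (norm q) * (cmod (f q))\<^sup>2) *\<^sub>R (1 / norm q))"
    "(\<integral>q. (indicator {0<..<r} (norm q) * (cmod (f q))\<^sup>2) *\<^sub>R (1 / norm q) \<partial>lborel) = \<kappa> * r ^ Suc N / Suc N"
    using near_integral[of "\<lambda>\<rho>. 1 / \<rho>"] by (auto simp: has_bochner_integral_iff)
  have far: "integrable lborel (\<lambda>q. (indicator {r..} (norm q) * (cmod (f q))\<^sup>2) *\<^sub>R (1 / norm q))"
    by (rule far_integrable[where B = "1 / r"]) (use norm_recip_far in auto)
  show "integrable lborel (\<lambda>q. (cmod (f q))\<^sup>2 / norm q)"
    using near_far_integral(1)[OF _ near(1) far] by simp
  show "coupling_energy f = \<kappa> * r ^ (DIM('a) - 2) / real (DIM('a) - 2)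
     + (\<integral>q. (indicator {r..} (norm q) * (cmod (f q))\<^sup>2) *\<^sub>R (1 / norm q) \<partial>lborel)"
    using near_far_integral(2)[OF _ near(1) far] near(2) by (simp add: coupling_energy_def N)
qed

text \<open>The weight of the momenta that a cutoff at \<open>e\<close> removes: of order \<open>e\<^sup>2\<close> for \<open>d = 3\<close>.\<close>

lemma small_momentum_weight:
  assumes "0 \<le> e" "e < r"
  shows "(\<integral>q. indicator {..e} (norm q) * (cmod (f q))\<^sup>2 \<partial>lborel) = \<kappa> * e ^ (DIM('a) - 1) / real (DIM('a) - 1)"
proof -
  define N where "N = DIM('a) - 2"
  have N: "DIM('a) - 1 = Suc N" using dim by (simp add: N_def)
  have ae: "AE q in lborel. indicator {..e} (norm q) * (cmod (f q))\<^sup>2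
      = (indicator {0<..<r} (norm q) * (cmod (f q))\<^sup>2) *\<^sub>R (indicator {..e} (norm q) :: real)"
    using AE_lborel_singleton[of "0 :: 'a"] by eventually_elim (use assms in \<open>auto simp: indicator_def\<close>)
  have "(\<integral>q. indicator {..e} (norm q) * (cmod (f q))\<^sup>2 \<partial>lborel)
      = (\<integral>q. (indicator {0<..<r} (norm q) * (cmod (f q))\<^sup>2) *\<^sub>R (indicator {..e} (norm q) :: real) \<partial>lborel)"
    by (rule integral_cong_AE[OF _ _ ae]) auto
  also have "\<dots> = (\<integral>\<rho>. indicator {0..r} \<rho> *\<^sub>R ((\<kappa> * \<rho> ^ N) *\<^sub>R indicator {..e} \<rho>) \<partial>lborel)"
    unfolding N_def by (rule near_integral(1)) simp
  also have "\<dots> = (\<integral>\<rho>. indicator {0..e} \<rho> *\<^sub>R (\<kappa> * \<rho> ^ N) \<partial>lborel)"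
    using assms by (intro Bochner_Integration.integral_cong) (auto simp: indicator_def)
  also have "\<dots> = \<kappa> * e ^ Suc N / Suc N"
    using power_integral[OF assms(1), of \<kappa> N] by (simp add: has_bochner_integral_iff del: of_nat_Suc power_Suc)
  finally show ?thesis by (simp only: N)
qed

text \<open>The radial density of \<open>|f|\<^sup>2 / |k|\<^sup>2\<close> is \<open>\<kappa> \<rho>\<^bsup>d-4\<^esup>\<close>, integrable at \<open>0\<close> exactly for \<open>d > 3\<close>.  For \<open>d = 3\<close>
  the cutoff integral is logarithmic.\<close>

lemma f_over_norm_sq_dim_gt_3:
  assumes "3 < DIM('a)"
  shows "integrable lborel (\<lambda>q. (cmod (f q))\<^sup>2 *\<^sub>R (1 / (norm q)\<^sup>2))"
proof -
  define N where "N = DIM('a) - 4"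
  have N: "DIM('a) - 2 = Suc (Suc N)" using assms by (simp add: N_def)
  have eq: "indicator {0..r} \<rho> *\<^sub>R ((\<kappa> * \<rho> ^ (DIM('a) - 2)) *\<^sub>R (1 / \<rho>\<^sup>2)) = indicator {0..r} \<rho> *\<^sub>R (\<kappa> * \<rho> ^ N)" if "\<rho> \<noteq> 0" for \<rho>
    using that by (simp add: N power2_eq_square)
  have ae: "AE \<rho> in lborel. indicator {0..r} \<rho> *\<^sub>R ((\<kappa> * \<rho> ^ (DIM('a) - 2)) *\<^sub>R (1 / \<rho>\<^sup>2))
      = indicator {0..r} \<rho> *\<^sub>R (\<kappa> * \<rho> ^ N)"
    using AE_lborel_singleton[of "0 :: real"] by eventually_elim (rule eq)
  have "integrable lborel (\<lambda>\<rho>. indicator {0..r} \<rho> *\<^sub>R ((\<kappa> * \<rho> ^ (DIM('a) - 2)) *\<^sub>R (1 / \<rho>\<^sup>2)))"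
    by (subst integrable_cong_AE[OF _ _ ae])
      (use power_integral[of 0 r \<kappa> N] r in \<open>auto simp: has_bochner_integral_iff\<close>)
  then have near: "integrable lborel (\<lambda>q. (indicator {0<..<r} (norm q) * (cmod (f q))\<^sup>2) *\<^sub>R (1 / (norm q)\<^sup>2))"
    using near_integral(2)[of "\<lambda>\<rho>. 1 / \<rho>\<^sup>2"] by auto
  have far: "integrable lborel (\<lambda>q. (indicator {r..} (norm q) * (cmod (f q))\<^sup>2) *\<^sub>R (1 / (norm q)\<^sup>2))"
    by (rule far_integrable[where B = "1 / r\<^sup>2"]) (use norm_recip_far in auto)
  show ?thesis by (rule near_far_integral(1)[OF _ near far]) simp
qed

lemma f_over_norm_sq_dim_3:
  assumes d: "DIM('a) = 3" and e: "0 < e" "e < r"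
  shows "integrable lborel (\<lambda>q. (cmod (f q))\<^sup>2 *\<^sub>R (indicator {e<..} (norm q) / (norm q)\<^sup>2))"
    and "(\<integral>q. (cmod (f q))\<^sup>2 *\<^sub>R (indicator {e<..} (norm q) / (norm q)\<^sup>2) \<partial>lborel)
      = \<kappa> * (ln r - ln e) + (\<integral>q. (indicator {r..} (norm q) * (cmod (f q))\<^sup>2) *\<^sub>R (1 / (norm q)\<^sup>2) \<partial>lborel)"
proof -
  have eq: "indicator {0..r} \<rho> *\<^sub>R ((\<kappa> * \<rho> ^ (DIM('a) - 2)) *\<^sub>R (indicator {e<..} \<rho> / \<rho>\<^sup>2))
      = indicator {e..r} \<rho> *\<^sub>R (\<kappa> / \<rho>)" if "\<rho> \<noteq> e" for \<rho> :: real
    using that e by (auto simp: d indicator_def power2_eq_square)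
  have ae: "AE \<rho> in lborel. indicator {0..r} \<rho> *\<^sub>R ((\<kappa> * \<rho> ^ (DIM('a) - 2)) *\<^sub>R (indicator {e<..} \<rho> / \<rho>\<^sup>2))
      = indicator {e..r} \<rho> *\<^sub>R (\<kappa> / \<rho>)"
    using AE_lborel_singleton[of e] by eventually_elim (rule eq)
  have "has_bochner_integral lborel (\<lambda>\<rho>. indicator {e..r} \<rho> *\<^sub>R (\<kappa> / \<rho>)) (\<kappa> * ln r - \<kappa> * ln e)"
  proof (rule has_bochner_integral_FTC_Icc)
    fix x assume "e \<le> x" "x \<le> r"
    then have "((\<lambda>\<rho>. \<kappa> * ln \<rho>) has_real_derivative \<kappa> / x) (at x within {e..r})"
      using e by (auto intro!: derivative_eq_intros)
    then show "((\<lambda>\<rho>. \<kappa> * ln \<rho>) has_vector_derivative \<kappa> / x) (at x within {e..r})"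
      by (simp add: has_real_derivative_iff_has_vector_derivative)
  qed (use e in \<open>auto intro!: continuous_intros\<close>)
  then have "has_bochner_integral lborel (\<lambda>\<rho>. indicator {0..r} \<rho> *\<^sub>R ((\<kappa> * \<rho> ^ (DIM('a) - 2)) *\<^sub>R (indicator {e<..} \<rho> / \<rho>\<^sup>2)))
      (\<kappa> * (ln r - ln e))"
    by (subst has_bochner_integral_cong_AE[OF _ _ ae]) (auto simp: right_diff_distrib)
  then have near: "integrable lborel (\<lambda>q. (indicator {0<..<r} (norm q) * (cmod (f q))\<^sup>2) *\<^sub>R (indicator {e<..} (norm q) / (norm q)\<^sup>2))"
    "(\<integral>q. (indicator {0<..<r} (norm q) * (cmod (f q))\<^sup>2) *\<^sub>R (indicator {e<..} (norm q) / (norm q)\<^sup>2) \<partial>lborel) = \<kappa> * (ln r - ln e)"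
    using near_integral[of "\<lambda>\<rho>. indicator {e<..} \<rho> / \<rho>\<^sup>2"] by (auto simp: has_bochner_integral_iff)
  have eq2: "(indicator {r..} (norm q) * (cmod (f q))\<^sup>2) *\<^sub>R (indicator {e<..} (norm q) / (norm q)\<^sup>2)
      = (indicator {r..} (norm q) * (cmod (f q))\<^sup>2) *\<^sub>R (1 / (norm q)\<^sup>2)" for q
    using e by (auto simp: indicator_def)
  have far: "integrable lborel (\<lambda>q. (indicator {r..} (norm q) * (cmod (f q))\<^sup>2) *\<^sub>R (indicator {e<..} (norm q) / (norm q)\<^sup>2))"
    unfolding eq2
    by (rule far_integrable[where B = "1 / r\<^sup>2"]) (use norm_recip_far in auto)
  have m: "(\<lambda>q :: 'a. indicator {e<..} (norm q) / (norm q)\<^sup>2 :: real) \<in> borel_measurable borel" by measurable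
  show "integrable lborel (\<lambda>q. (cmod (f q))\<^sup>2 *\<^sub>R (indicator {e<..} (norm q) / (norm q)\<^sup>2))"
    by (rule near_far_integral(1)[OF m near(1) far])
  show "(\<integral>q. (cmod (f q))\<^sup>2 *\<^sub>R (indicator {e<..} (norm q) / (norm q)\<^sup>2) \<partial>lborel)
      = \<kappa> * (ln r - ln e) + (\<integral>q. (indicator {r..} (norm q) * (cmod (f q))\<^sup>2) *\<^sub>R (1 / (norm q)\<^sup>2) \<partial>lborel)"
    unfolding near_far_integral(2)[OF m near(1) far] near(2) eq2 ..
qed

section \<open>Continuation of the self energy\<close>

definition self_energy :: "complex \<Rightarrow> complex" where
  "self_energy w = (\<integral>q. (cmod (f q))\<^sup>2 *\<^sub>R (1 / (of_real (norm q) - w)) \<partial>lborel)"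

text \<open>The radial integral over \<open>\<rho> < r\<close>, with \<open>\<rho>\<^sup>N = w\<^sup>N + (\<rho> - w) (\<dots>)\<close> for \<open>N = d - 2\<close>.  The antiderivative
  \<open>Ln (\<rho> - w)\<close> gives \<open>Ln (r - w) - Ln (- w)\<close> for \<open>w\<close> in the upper half plane; writing \<open>Ln (- w)\<close> as
  \<open>Ln w - i \<pi>\<close> moves its cut away from the positive axis, which is the continuation.\<close>

definition near_part :: "complex \<Rightarrow> complex" where
  "near_part w = of_real \<kappa> * ((\<Sum>j<DIM('a) - 2. w ^ (DIM('a) - 2 - Suc j) * of_real (r ^ Suc j / real (Suc j)))
     + w ^ (DIM('a) - 2) * (Ln (of_real r - w) - Ln w + \<i> * pi))"

definition far_part :: "complex \<Rightarrow> complex" where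
  "far_part w = (\<integral>q. (indicator {r..} (norm q) * (cmod (f q))\<^sup>2) *\<^sub>R (1 / (of_real (norm q) - w)) \<partial>lborel)"

lemma near_part_eq:
  assumes w: "0 < Im w"
  shows "integrable lborel (\<lambda>q. (indicator {0<..<r} (norm q) * (cmod (f q))\<^sup>2) *\<^sub>R (1 / (of_real (norm q) - w)))"
    and "(\<integral>q. (indicator {0<..<r} (norm q) * (cmod (f q))\<^sup>2) *\<^sub>R (1 / (of_real (norm q) - w)) \<partial>lborel) = near_part w"
proof -
  define N where "N = DIM('a) - 2"
  define G where "G \<rho> = of_real \<kappa> * ((\<Sum>j<N. w ^ (N - Suc j) * (\<rho> ^ Suc j / of_nat (Suc j))) + w ^ N * Ln (\<rho> - w))" for \<rho>
  have ne: "complex_of_real \<rho> - w \<noteq> 0" for \<rho>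
    using w by (auto simp: complex_eq_iff)
  have nR: "complex_of_real \<rho> - w \<notin> \<real>\<^sub>\<le>\<^sub>0" for \<rho>
    using w by (auto simp: complex_nonpos_Reals_iff)
  have G: "(G has_field_derivative of_real (\<kappa> * \<rho> ^ N) / (of_real \<rho> - w)) (at (of_real \<rho>))" for \<rho>
  proof -
    have "(G has_field_derivative of_real \<kappa> * ((\<Sum>j<N. w ^ (N - Suc j) * of_real \<rho> ^ j) + w ^ N * (1 / (of_real \<rho> - w)))) (at (of_real \<rho>))"
      unfolding G_def
      by (rule derivative_eq_intros refl sum.cong nR | simp add: nR del: of_nat_Suc power_Suc)+
        (simp add: divide_inverse mult.commute)
    moreover have "of_real \<rho> ^ N - w ^ N = (of_real \<rho> - w) * (\<Sum>j<N. w ^ (N - Suc j) * of_real \<rho> ^ j)"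
      by (rule power_diff_sumr2)
    then have "(\<Sum>j<N. w ^ (N - Suc j) * of_real \<rho> ^ j) = (of_real \<rho> ^ N - w ^ N) / (of_real \<rho> - w)"
      using ne[of \<rho>] by (simp add: field_simps)
    then have "of_real \<kappa> * ((\<Sum>j<N. w ^ (N - Suc j) * of_real \<rho> ^ j) + w ^ N * (1 / (of_real \<rho> - w)))
        = of_real (\<kappa> * \<rho> ^ N) / (of_real \<rho> - w)"
      using ne[of \<rho>] by (simp add: field_simps)
    ultimately show ?thesis by simp
  qed
  have "has_bochner_integral lborel (\<lambda>\<rho>. indicator {0..r} \<rho> *\<^sub>R (of_real (\<kappa> * \<rho> ^ N) / (of_real \<rho> - w)))
      (G (of_real r) - G (of_real 0))"
  proof (rule has_bochner_integral_FTC_Icc)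
    show "((\<lambda>\<rho>. G (of_real \<rho>)) has_vector_derivative of_real (\<kappa> * x ^ N) / (of_real x - w)) (at x within {0..r})" for x
      by (rule has_vector_derivative_real_field[OF G])
    show "continuous_on {0..r} (\<lambda>\<rho>. of_real (\<kappa> * \<rho> ^ N) / (of_real \<rho> - w))"
      using ne by (intro continuous_intros) auto
  qed (use r in simp)
  moreover have "of_real (\<kappa> * \<rho> ^ N) / (of_real \<rho> - w) = (\<kappa> * \<rho> ^ N) *\<^sub>R (1 / (of_real \<rho> - w))" for \<rho>
    by (simp add: scaleR_conv_of_real)
  moreover have "G (of_real r) - G (of_real 0) = near_part w"
  proof -
    have "Ln w = Ln (- w) + \<i> * pi"
      using w by (subst Ln_minus) auto
    then show ?thesis
      by (simp add: G_def near_part_def N_def algebra_simps)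
  qed
  ultimately have "has_bochner_integral lborel (\<lambda>\<rho>. indicator {0..r} \<rho> *\<^sub>R ((\<kappa> * \<rho> ^ N) *\<^sub>R (1 / (of_real \<rho> - w)))) (near_part w)"
    by simp
  moreover have m: "(\<lambda>\<rho>. 1 / (complex_of_real \<rho> - w)) \<in> borel_measurable borel"
    by measurable
  ultimately show "integrable lborel (\<lambda>q. (indicator {0<..<r} (norm q) * (cmod (f q))\<^sup>2) *\<^sub>R (1 / (of_real (norm q) - w)))"
    "(\<integral>q. (indicator {0<..<r} (norm q) * (cmod (f q))\<^sup>2) *\<^sub>R (1 / (of_real (norm q) - w)) \<partial>lborel) = near_part w"
    using near_integral[OF m] unfolding N_def by (simp_all add: has_bochner_integral_iff)
qed

lemma far_part_bound:
  assumes "cmod w \<le> s" "r \<le> norm q"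
  shows "r - s \<le> cmod (of_real (norm q) - w)"
  using norm_triangle_ineq2[of "complex_of_real (norm q)" w] assms by simp

lemma far_part_integrable:
  assumes "cmod w < r"
  shows "integrable lborel (\<lambda>q. (indicator {r..} (norm q) * (cmod (f q))\<^sup>2) *\<^sub>R (1 / (of_real (norm q) - w)))"
proof (rule far_integrable[where B = "1 / (r - cmod w)"])
  fix q :: 'a assume "r \<le> norm q"
  then show "cmod (1 / (of_real (norm q) - w)) \<le> 1 / (r - cmod w)"
    using far_part_bound[OF order_refl, of q w] assms by (auto simp: norm_divide intro!: divide_left_mono mult_pos_pos)
qed measurable

lemma self_energy_eq:
  assumes "0 < Im w" "cmod w < r"
  shows "self_energy w = near_part w + far_part w"
  unfolding self_energy_def far_part_def near_part_eq(2)[OF assms(1), symmetric]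
  by (rule near_far_integral(2)[OF _ near_part_eq(1)[OF assms(1)] far_part_integrable[OF assms(2)]]) measurable

text \<open>Momenta beyond \<open>r\<close> stay away from \<open>w\<close>, so the difference quotient under the integral has a
  remainder of first order in \<open>v - w\<close>, uniformly in the momentum.\<close>

lemma far_part_differentiable:
  assumes w: "cmod w < r"
  shows "far_part field_differentiable (at w)"
proof -
  define s where "s = (cmod w + r) / 2"
  have s: "cmod w < s" "s < r" using w by (auto simp: s_def)
  define D where "D = (\<integral>q. (indicator {r..} (norm q) * (cmod (f q))\<^sup>2) *\<^sub>R (1 / (of_real (norm q) - w)\<^sup>2) \<partial>lborel)"
  define M where "M = (\<integral>q. (cmod (f q))\<^sup>2 \<partial>lborel) / (r - s) ^ 3"
  have Di: "integrable lborel (\<lambda>q. (indicator {r..} (norm q) * (cmod (f q))\<^sup>2) *\<^sub>R (1 / (of_real (norm q) - w)\<^sup>2))"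
  proof (rule far_integrable[where B = "1 / (r - s)\<^sup>2"])
    fix q :: 'a assume "r \<le> norm q"
    then have "(r - s)\<^sup>2 \<le> (cmod (of_real (norm q) - w))\<^sup>2"
      using far_part_bound[of w s q] s by (intro power_mono) auto
    then show "cmod (1 / (of_real (norm q) - w)\<^sup>2) \<le> 1 / (r - s)\<^sup>2"
      using s by (auto simp: norm_divide norm_power intro!: divide_left_mono mult_pos_pos)
  qed measurable
  have est: "cmod ((far_part v - far_part w) / (v - w) - D) \<le> cmod (v - w) * M" if v: "cmod v < s" "v \<noteq> w" for v
  proof -
    define h where "h q = 1 / (of_real (norm q) - v) - 1 / (of_real (norm q) - w) - (v - w) * (1 / (of_real (norm q) - w)\<^sup>2)" for q :: 'a
    have iv: "integrable lborel (\<lambda>q. (indicator {r..} (norm q) * (cmod (f q))\<^sup>2) *\<^sub>R (1 / (of_real (norm q) - v)))"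
      and iw: "integrable lborel (\<lambda>q. (indicator {r..} (norm q) * (cmod (f q))\<^sup>2) *\<^sub>R (1 / (of_real (norm q) - w)))"
      using v s by (auto intro!: far_part_integrable)
    have eq: "(indicator {r..} (norm q) * (cmod (f q))\<^sup>2) *\<^sub>R (1 / (of_real (norm q) - v))
        - (indicator {r..} (norm q) * (cmod (f q))\<^sup>2) *\<^sub>R (1 / (of_real (norm q) - w))
        - (v - w) * ((indicator {r..} (norm q) * (cmod (f q))\<^sup>2) *\<^sub>R (1 / (of_real (norm q) - w)\<^sup>2))
        = (indicator {r..} (norm q) * (cmod (f q))\<^sup>2) *\<^sub>R h q" for q
      by (simp add: h_def scaleR_conv_of_real algebra_simps)
    note iD = integrable_mult_right[OF Di, of "v - w"]
    have hi: "integrable lborel (\<lambda>q. (indicator {r..} (norm q) * (cmod (f q))\<^sup>2) *\<^sub>R h q)"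
      unfolding eq[symmetric] by (intro Bochner_Integration.integrable_diff iv iw iD)
    have "far_part v - far_part w - (v - w) * D = (\<integral>q. (indicator {r..} (norm q) * (cmod (f q))\<^sup>2) *\<^sub>R h q \<partial>lborel)"
      unfolding far_part_def D_def eq[symmetric] integral_mult_right_zero[symmetric]
      using iv iw iD by (simp only: Bochner_Integration.integral_diff Bochner_Integration.integrable_diff)
    also have "cmod \<dots> \<le> (\<integral>q. (cmod (f q))\<^sup>2 * ((cmod (v - w))\<^sup>2 / (r - s) ^ 3) \<partial>lborel)"
    proof (rule order_trans[OF integral_norm_bound], rule integral_mono)
      show "integrable lborel (\<lambda>q. norm ((indicator {r..} (norm q) * (cmod (f q))\<^sup>2) *\<^sub>R h q))"
        using hi by (rule integrable_norm)
      show "integrable lborel (\<lambda>q. (cmod (f q))\<^sup>2 * ((cmod (v - w))\<^sup>2 / (r - s) ^ 3))"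
        using f by (simp add: square_integrable_def)
      fix q :: 'a
      show "norm ((indicator {r..} (norm q) * (cmod (f q))\<^sup>2) *\<^sub>R h q) \<le> (cmod (f q))\<^sup>2 * ((cmod (v - w))\<^sup>2 / (r - s) ^ 3)"
      proof (cases "r \<le> norm q")
        case True
        define a where "a = complex_of_real (norm q) - v"
        define b where "b = complex_of_real (norm q) - w"
        have ab: "r - s \<le> cmod a" "r - s \<le> cmod b"
          using far_part_bound[of v s q] far_part_bound[of w s q] s v True by (auto simp: a_def b_def)
        then have nz: "a \<noteq> 0" "b \<noteq> 0" using s by auto
        have "h q = 1 / a - 1 / b - (b - a) * (1 / b\<^sup>2)"
          by (simp add: h_def a_def b_def)
        also have "\<dots> = (b - a)\<^sup>2 / (a * b\<^sup>2)"
          using nz by (simp add: field_simps power2_eq_square)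
        also have "cmod \<dots> = (cmod (v - w))\<^sup>2 / (cmod a * (cmod b)\<^sup>2)"
          by (simp add: norm_divide norm_mult norm_power a_def b_def)
        also have "\<dots> \<le> (cmod (v - w))\<^sup>2 / ((r - s) * (r - s)\<^sup>2)"
          using ab s by (intro divide_left_mono mult_mono power_mono mult_pos_pos zero_less_power) auto
        also have "(r - s) * (r - s)\<^sup>2 = (r - s) ^ 3" by (simp add: power3_eq_cube power2_eq_square)
        finally have "cmod (h q) \<le> (cmod (v - w))\<^sup>2 / (r - s) ^ 3" .
        from mult_left_mono[OF this, of "(cmod (f q))\<^sup>2"] show ?thesis using True by (simp add: abs_mult)
      next
        case False
        then show ?thesis using s by simp
      qed
    qed
    also have "\<dots> = (cmod (v - w))\<^sup>2 * M" by (simp add: M_def)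
    finally have "cmod (far_part v - far_part w - (v - w) * D) \<le> (cmod (v - w))\<^sup>2 * M" .
    moreover have "(far_part v - far_part w) / (v - w) - D = (far_part v - far_part w - (v - w) * D) / (v - w)"
      using v by (simp add: field_simps)
    ultimately show ?thesis
      using v by (simp add: norm_divide divide_le_eq power2_eq_square mult_ac)
  qed
  have "((\<lambda>v. (far_part v - far_part w) / (v - w) - D) \<longlongrightarrow> 0) (at w)"
  proof (rule Lim_null_comparison)
    show "eventually (\<lambda>v. norm ((far_part v - far_part w) / (v - w) - D) \<le> cmod (v - w) * M) (at w)"
    proof (rule eventually_mono)
      show "eventually (\<lambda>v. v \<in> ball 0 s \<and> v \<noteq> w) (at w)"
        using s by (intro eventually_conj eventually_at_in_open' eventually_neq_at_within) auto
    qed (use est in auto)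
    show "((\<lambda>v. cmod (v - w) * M) \<longlongrightarrow> 0) (at w)"
      by (auto intro!: tendsto_eq_intros)
  qed
  then have "((\<lambda>v. (far_part v - far_part w) / (v - w)) \<longlongrightarrow> D) (at w)"
    by (rule LIM_zero_cancel)
  then show ?thesis
    unfolding field_differentiable_def has_field_derivative_iff by auto
qed

definition continued_self_energy :: "complex \<Rightarrow> complex" where
  "continued_self_energy w = near_part w + far_part w"

lemma continued_self_energy_holomorphic:
  "continued_self_energy holomorphic_on {w. 0 < Re w \<and> cmod w < r}"
proof -
  have "open {w. 0 < Re w \<and> cmod w < r}"
    by (intro open_Collect_conj open_Collect_less continuous_intros)
  moreover have "far_part holomorphic_on {w. 0 < Re w \<and> cmod w < r}"
    by (auto simp: holomorphic_on_def intro: field_differentiable_at_within far_part_differentiable)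
  moreover have "near_part holomorphic_on {w. 0 < Re w \<and> cmod w < r}"
  proof -
    have "of_real r - w \<notin> \<real>\<^sub>\<le>\<^sub>0" if "cmod w < r" for w
      using that abs_Re_le_cmod[of w] by (auto simp: complex_nonpos_Reals_iff)
    then show ?thesis
      unfolding near_part_def by (intro holomorphic_intros) (auto simp: complex_nonpos_Reals_iff)
  qed
  ultimately show ?thesis
    unfolding continued_self_energy_def[abs_def] by (intro holomorphic_on_add)
qed

lemma continued_self_energy_eq:
  "0 < Im w \<Longrightarrow> cmod w < r \<Longrightarrow> continued_self_energy w = self_energy w"
  by (simp add: continued_self_energy_def self_energy_eq)

text \<open>By \<open>ln (1 / \<surd>x) \<le> 1 / \<surd>x\<close>, a logarithm is dominated by an inverse square root.\<close>

lemma tendsto_mult_Ln_0: "((\<lambda>w. w * Ln w) \<longlongrightarrow> 0) (at 0)"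
proof (rule Lim_null_comparison)
  have "cmod (w * Ln w) \<le> 2 * sqrt (cmod w) + pi * cmod w" if w: "w \<noteq> 0" "cmod w < 1" for w
  proof -
    define x where "x = cmod w"
    have x: "0 < x" "x < 1" using w by (auto simp: x_def)
    have "cmod (Ln w) \<le> \<bar>Re (Ln w)\<bar> + \<bar>Im (Ln w)\<bar>" by (rule cmod_le)
    also have "\<dots> \<le> \<bar>ln x\<bar> + pi"
      using Im_Ln_le_pi[OF w(1)] mpi_less_Im_Ln[OF w(1)] w by (simp add: x_def Re_Ln)
    also have "\<bar>ln x\<bar> = 2 * ln (1 / sqrt x)"
      using x by (simp add: ln_div ln_sqrt)
    also have "\<dots> \<le> 2 * (1 / sqrt x)"
      using ln_bound[of "1 / sqrt x"] x by simp
    finally have "x * cmod (Ln w) \<le> x * (2 * (1 / sqrt x) + pi)"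
      using x by (intro mult_left_mono) auto
    also have "\<dots> = 2 * (x / sqrt x) + pi * x" by (simp add: algebra_simps)
    also have "x / sqrt x = sqrt x" using x by (simp add: real_div_sqrt)
    finally show ?thesis by (simp add: x_def norm_mult)
  qed
  then show "eventually (\<lambda>w. norm (w * Ln w) \<le> 2 * sqrt (cmod w) + pi * cmod w) (at 0)"
    unfolding eventually_at by (intro exI[of _ 1]) auto
  show "((\<lambda>w. 2 * sqrt (cmod w) + pi * cmod w) \<longlongrightarrow> 0) (at (0 :: complex))"
    by (auto intro!: tendsto_eq_intros)
qed

lemma continued_self_energy_tendsto:
  "(continued_self_energy \<longlongrightarrow> of_real (coupling_energy f)) (at 0)"
proof -
  define N where "N = DIM('a) - 3"
  have N: "DIM('a) - 2 = Suc N" using dim by (simp add: N_def)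
  have far: "(far_part \<longlongrightarrow> far_part 0) (at 0)"
    using field_differentiable_imp_continuous_at[OF far_part_differentiable[of 0]] r
    by (simp add: continuous_at)
  have far0: "far_part 0 = of_real (\<integral>q. (indicator {r..} (norm q) * (cmod (f q))\<^sup>2) *\<^sub>R (1 / norm q) \<partial>lborel)"
    unfolding far_part_def integral_complex_of_real[symmetric] by (simp add: scaleR_conv_of_real)
  have "((\<lambda>w. w ^ N * (w * Ln w)) \<longlongrightarrow> 0 ^ N * 0) (at 0)"
    by (intro tendsto_intros tendsto_mult_Ln_0)
  then have l1: "((\<lambda>w. w ^ Suc N * Ln w) \<longlongrightarrow> 0) (at 0)" by (simp add: mult_ac)
  have l2: "((\<lambda>w. w ^ Suc N * (Ln (of_real r - w) + \<i> * pi)) \<longlongrightarrow> 0 ^ Suc N * (Ln (of_real r - 0) + \<i> * pi)) (at 0)"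
    using r by (intro tendsto_intros) (auto simp: complex_nonpos_Reals_iff)
  have l3: "((\<lambda>w. \<Sum>j<Suc N. w ^ (Suc N - Suc j) * of_real (r ^ Suc j / real (Suc j)))
      \<longlongrightarrow> (\<Sum>j<Suc N. 0 ^ (Suc N - Suc j) * complex_of_real (r ^ Suc j / real (Suc j)))) (at 0)"
    by (intro tendsto_intros)
  have "(\<Sum>j<Suc N. 0 ^ (Suc N - Suc j) * complex_of_real (r ^ Suc j / real (Suc j)))
      = of_real (r ^ Suc N / real (Suc N))"
    by (simp add: sum.lessThan_Suc power_0_left del: of_nat_Suc power_Suc)
  note l3 = l3[unfolded this]
  have "((\<lambda>w. of_real \<kappa> * ((\<Sum>j<Suc N. w ^ (Suc N - Suc j) * of_real (r ^ Suc j / real (Suc j)))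
      + (w ^ Suc N * (Ln (of_real r - w) + \<i> * pi) - w ^ Suc N * Ln w)) + far_part w) \<longlongrightarrow>
      of_real \<kappa> * (of_real (r ^ Suc N / real (Suc N)) + (0 ^ Suc N * (Ln (of_real r - 0) + \<i> * pi) - 0)) + far_part 0) (at 0)"
    by (intro tendsto_add tendsto_mult tendsto_diff tendsto_const l1 l2 l3 far)
  moreover have "of_real \<kappa> * (of_real (r ^ Suc N / real (Suc N)) + (0 ^ Suc N * (Ln (of_real r - 0) + \<i> * pi) - 0)) + far_part 0
      = complex_of_real (coupling_energy f)"
    unfolding coupling_energy_integral(2) far0 N by simp
  moreover have "(\<lambda>w. of_real \<kappa> * ((\<Sum>j<Suc N. w ^ (Suc N - Suc j) * of_real (r ^ Suc j / real (Suc j)))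
      + (w ^ Suc N * (Ln (of_real r - w) + \<i> * pi) - w ^ Suc N * Ln w)) + far_part w) = continued_self_energy"
    unfolding continued_self_energy_def near_part_def N fun_eq_iff by (simp add: algebra_simps)
  ultimately show ?thesis by simp
qed

end

section \<open>The Dicke operator on vectors with at most one photon\<close>

lemma op_app_dicke:
  "op_app (dicke m f \<alpha>) x = vector
     [complex_of_real (inverse \<alpha>) *\<^sub>C op_app field_energy (x $ 1)
        + complex_of_real (sqrt \<alpha>) *\<^sub>C op_app (creation f) (x $ 2),
      complex_of_real m *\<^sub>C x $ 2 + complex_of_real (inverse \<alpha>) *\<^sub>C op_app field_energy (x $ 2)
        + complex_of_real (sqrt \<alpha>) *\<^sub>C op_app (annihilation f) (x $ (1 :: 2))]"
  by (simp add: dicke_def op_add_def op_scale_def op_tensor_def op_id_def p_mat_def sigma_plus_def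
      sigma_minus_def mat_def vec2_eq_iff UNIV_2)

lemma op_dom_dicke:
  "x \<in> op_dom (dicke m f \<alpha>) \<longleftrightarrow>
     x $ 1 \<in> op_dom field_energy \<and> x $ 2 \<in> op_dom field_energy \<and>
     x $ 2 \<in> op_dom (creation f) \<and> x $ (1 :: 2) \<in> op_dom (annihilation f)"
  by (auto simp: dicke_def op_add_def op_scale_def op_tensor_def op_id_def p_mat_def sigma_plus_def
      sigma_minus_def mat_def forall_2)

lemma dicke_symmetric:
  assumes f: "square_integrable lborel f"
  shows "symmetric_op (dicke m f \<alpha>)"
  unfolding symmetric_op_def
proof (intro ballI)
  fix x y assume xy: "x \<in> op_dom (dicke m f \<alpha>)" "y \<in> op_dom (dicke m f \<alpha>)"
  have "cinner (op_app field_energy (x $ i)) (y $ i) = cinner (x $ i) (op_app field_energy (y $ i))" for i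
    using xy field_energy_symmetric exhaust_2[of i] by (auto simp: op_dom_dicke symmetric_op_def)
  moreover have "cinner (op_app (annihilation f) (x $ 1)) (y $ 2) = cinner (x $ 1) (op_app (creation f) (y $ 2))"
    using xy by (auto simp: op_dom_dicke intro!: creation_annihilation_adjoint[OF f])
  moreover have "cinner (op_app (creation f) (x $ 2)) (y $ 1) = cinner (x $ 2) (op_app (annihilation f) (y $ 1))"
    using xy creation_annihilation_adjoint[OF f, of "y $ 1" "x $ 2"]
      cinner_commute[of "op_app (creation f) (x $ 2)" "y $ 1"]
      cinner_commute[of "x $ 2" "op_app (annihilation f) (y $ 1)"]
    by (auto simp: op_dom_dicke)
  ultimately show "cinner (op_app (dicke m f \<alpha>) x) y = cinner x (op_app (dicke m f \<alpha>) y)"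
    by (simp add: cinner_vec2 op_app_dicke cinner_add_left cinner_add_right cinner_scaleC_left cinner_scaleC_right)
qed

lemma field_energy_photon01_zero:
  "photon01 b (\<lambda>_ :: 'a::euclidean_space. 0) \<in> op_dom field_energy"
  "op_app field_energy (photon01 b (\<lambda>_ :: 'a. 0)) = 0"
  using field_energy_photon01[of "\<lambda>_ :: 'a. 0" b] by (simp_all add: square_integrable_0 photon01_zero)

lemma dicke_photon01:
  assumes f: "square_integrable lborel f" and \<phi>: "square_integrable lborel \<phi>"
    and e: "square_integrable lborel (\<lambda>q. complex_of_real (norm q) * \<phi> q)"
  shows "vector [photon01 a \<phi>, photon01 b (\<lambda>_. 0)] \<in> op_dom (dicke m f \<alpha>)"
    and "op_app (dicke m f \<alpha>) (vector [photon01 a \<phi>, photon01 b (\<lambda>_. 0)])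
      = vector [photon01 0 (\<lambda>q. of_real (inverse \<alpha>) * (of_real (norm q) * \<phi> q) + of_real (sqrt \<alpha>) * (b * f q)),
                photon01 (of_real m * b + of_real (sqrt \<alpha>) * (\<integral>q. cnj (f q) * \<phi> q \<partial>lborel)) (\<lambda>_. 0)]"
  using field_energy_photon01[OF \<phi> e, of a] creation_photon01[OF f, of b]
    annihilation_photon01[OF f \<phi>, of a] assms
  by (simp_all add: op_dom_dicke op_app_dicke field_energy_photon01_zero photon01_scaleC photon01_add square_integrable_0 square_integrable_mult)

section \<open>The resolvent in the excited state\<close>

context singular_coupling
begin

text \<open>In the upper half plane the one photon component of \<open>(H - z)\<^sup>-\<^sup>1 e\<close> has finite energy.\<close>

lemma resolvent_vector_integrable:
  assumes "0 < Im w"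
  shows "square_integrable lborel (\<lambda>q. f q / (of_real (norm q) - w))"
    and "square_integrable lborel (\<lambda>q. of_real (norm q) * (f q / (of_real (norm q) - w)))"
proof -
  have b: "Im w \<le> cmod (of_real (norm q) - w)" for q :: 'a
    using abs_Im_le_cmod[of "of_real (norm q) - w"] assms by simp
  have *: "square_integrable lborel (\<lambda>q. f q * h q)" if hm: "h \<in> borel_measurable borel"
    and h: "\<And>q. cmod (h q) \<le> B" for h :: "'a \<Rightarrow> complex" and B
  proof -
    have m: "(\<lambda>q. f q * h q) \<in> borel_measurable borel"
      by (intro borel_measurable_times hm f_measurable)
    have "integrable lborel (\<lambda>q. (cmod (f q * h q))\<^sup>2)"
    proof (rule Bochner_Integration.integrable_bound)
      show "integrable lborel (\<lambda>q. B\<^sup>2 * (cmod (f q))\<^sup>2)" using f by (simp add: square_integrable_def)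
      show "AE q in lborel. norm ((cmod (f q * h q))\<^sup>2) \<le> norm (B\<^sup>2 * (cmod (f q))\<^sup>2)"
        using h by (intro AE_I2)
          (simp add: norm_mult power_mult_distrib mult.commute[of "(cmod (f _))\<^sup>2"] mult_right_mono power_mono)
    qed (use m in simp)
    then show ?thesis using m by (simp add: square_integrable_def)
  qed
  have "cmod (1 / (of_real (norm q) - w)) \<le> 1 / Im w" for q :: 'a
    using b[of q] assms by (auto simp: norm_divide intro!: divide_left_mono mult_pos_pos)
  then show "square_integrable lborel (\<lambda>q. f q / (of_real (norm q) - w))"
    using *[of "\<lambda>q. 1 / (of_real (norm q) - w)" "1 / Im w"] by simp
  have "cmod (of_real (norm q) / (of_real (norm q) - w)) \<le> 1 + cmod w / Im w" for q :: 'a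
  proof -
    have nz: "complex_of_real (norm q) - w \<noteq> 0" using b[of q] assms by auto
    then have "of_real (norm q) / (of_real (norm q) - w) = 1 + w / (of_real (norm q) - w)"
      by (simp add: field_simps)
    also have "cmod \<dots> \<le> 1 + cmod (w / (of_real (norm q) - w))"
      using norm_triangle_ineq[of 1 "w / (of_real (norm q) - w)"] by simp
    also have "\<dots> \<le> 1 + cmod w / Im w"
      using b[of q] assms by (auto simp: norm_divide intro!: divide_left_mono mult_pos_pos)
    finally show ?thesis .
  qed
  then show "square_integrable lborel (\<lambda>q. of_real (norm q) * (f q / (of_real (norm q) - w)))"
    using *[of "\<lambda>q. of_real (norm q) / (of_real (norm q) - w)" "1 + cmod w / Im w"] by (simp add: mult.commute)
qed

lemma Im_self_energy_nonneg:
  assumes "0 < Im w" "cmod w < r"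
  shows "0 \<le> Im (self_energy w)"
proof -
  have i: "integrable lborel (\<lambda>q. (cmod (f q))\<^sup>2 *\<^sub>R (1 / (of_real (norm q) - w)))"
    by (rule near_far_integral(1)[OF _ near_part_eq(1)[OF assms(1)] far_part_integrable[OF assms(2)]]) measurable
  have "0 \<le> Im (1 / (of_real x - w))" for x
    using assms by (simp add: Im_divide)
  then have "0 \<le> (\<integral>q. Im ((cmod (f q))\<^sup>2 *\<^sub>R (1 / (of_real (norm q) - w))) \<partial>lborel)"
    by (intro integral_nonneg_AE AE_I2) simp
  also have "\<dots> = Im (self_energy w)"
    unfolding self_energy_def by (rule integral_Im[OF i])
  finally show ?thesis .
qed

text \<open>The denominator of the resolvent element, for \<open>S\<close> the self energy or its continuation.\<close>

definition characteristic :: "real \<Rightarrow> real \<Rightarrow> (complex \<Rightarrow> complex) \<Rightarrow> complex \<Rightarrow> complex" where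
  "characteristic m \<alpha> S z = of_real m - z - of_real (\<alpha>\<^sup>2) * S (of_real \<alpha> * z)"

text \<open>Both \<open>- z\<close> and \<open>- \<alpha>\<^sup>2 S(\<alpha> z)\<close> have nonpositive imaginary part in the upper half plane, the first a
  negative one.\<close>

lemma characteristic_nonzero:
  assumes "0 < Im z" "0 < \<alpha>" "cmod (of_real \<alpha> * z) < r"
  shows "characteristic m \<alpha> self_energy z \<noteq> 0"
proof -
  have "0 \<le> Im (self_energy (of_real \<alpha> * z))"
    using assms by (intro Im_self_energy_nonneg) auto
  then have "0 \<le> \<alpha>\<^sup>2 * Im (self_energy (of_real \<alpha> * z))" by simp
  moreover have "Im (characteristic m \<alpha> self_energy z) = - Im z - \<alpha>\<^sup>2 * Im (self_energy (of_real \<alpha> * z))"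
    by (simp add: characteristic_def flip: of_real_power)
  ultimately have "Im (characteristic m \<alpha> self_energy z) < 0"
    using assms(1) by linarith
  then show ?thesis by auto
qed

text \<open>Eliminating the one photon component \<open>\<phi>\<close> from \<open>(H - z) \<psi> = e\<close> leaves a scalar equation for the
  amplitude \<open>b\<close> of \<open>e\<close>.  The solution is unique because \<open>H\<close> is symmetric and \<open>z\<close> is not real.\<close>

lemma resolvent_element_dicke:
  assumes z: "0 < Im z" and \<alpha>: "0 < \<alpha>" and small: "cmod (of_real \<alpha> * z) < r"
  shows "resolvent_element (dicke m f \<alpha>) excited_state z = 1 / characteristic m \<alpha> self_energy z"
proof -
  define w where "w = complex_of_real \<alpha> * z"
  have w: "0 < Im w" using z \<alpha> by (simp add: w_def)
  define b where "b = 1 / characteristic m \<alpha> self_energy z"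
  define c where "c = complex_of_real (- \<alpha> * sqrt \<alpha>) * b"
  define \<phi> where "\<phi> q = c * (f q / (of_real (norm q) - w))" for q
  define \<psi> :: "'a fock ^ 2" where "\<psi> = vector [photon01 0 \<phi>, photon01 b (\<lambda>_. 0)]"
  have nz: "complex_of_real (norm q) - w \<noteq> 0" for q :: 'a
    using w by (auto simp: complex_eq_iff)
  have \<phi>: "square_integrable lborel \<phi>" "square_integrable lborel (\<lambda>q. complex_of_real (norm q) * \<phi> q)"
    using resolvent_vector_integrable[OF w, THEN square_integrable_mult, of c]
    by (simp_all add: \<phi>_def[abs_def] mult.left_commute)
  note H = dicke_photon01[OF f \<phi>, where a = 0 and b = b and m = m and \<alpha> = \<alpha>]
  have "(\<integral>q. cnj (f q) * \<phi> q \<partial>lborel) = (\<integral>q. c * ((cmod (f q))\<^sup>2 *\<^sub>R (1 / (of_real (norm q) - w))) \<partial>lborel)"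
    by (simp add: \<phi>_def scaleR_conv_of_real complex_norm_square mult_ac del: of_real_power)
  then have fphi: "(\<integral>q. cnj (f q) * \<phi> q \<partial>lborel) = c * self_energy w"
    unfolding self_energy_def by (simp only: integral_mult_right_zero)
  have one: "of_real (inverse \<alpha>) * (of_real (norm q) * \<phi> q) + of_real (sqrt \<alpha>) * (b * f q) - z * \<phi> q = 0" for q
  proof -
    have "of_real (inverse \<alpha>) * (of_real (norm q) * \<phi> q) - z * \<phi> q
        = (of_real (norm q) - w) * \<phi> q / of_real \<alpha>"
      using \<alpha> by (simp add: w_def field_simps)
    also have "\<dots> = c * f q / of_real \<alpha>" using nz[of q] by (simp add: \<phi>_def)
    also have "\<dots> = - (of_real (sqrt \<alpha>) * (b * f q))" using \<alpha> by (simp add: c_def field_simps)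
    finally show ?thesis by (simp add: algebra_simps)
  qed
  have two: "of_real m * b + of_real (sqrt \<alpha>) * (c * self_energy w) - z * b = 1"
  proof -
    have "sqrt \<alpha> * (- \<alpha> * sqrt \<alpha>) = - (\<alpha>\<^sup>2)"
      using \<alpha> by (simp add: power2_eq_square)
    then have "complex_of_real (sqrt \<alpha>) * of_real (- \<alpha> * sqrt \<alpha>) = - of_real (\<alpha>\<^sup>2)"
      by (simp only: of_real_mult[symmetric] of_real_minus[symmetric])
    moreover have "of_real (sqrt \<alpha>) * (c * self_energy w)
        = (complex_of_real (sqrt \<alpha>) * of_real (- \<alpha> * sqrt \<alpha>)) * (b * self_energy w)"
      unfolding c_def by (simp only: mult_ac)
    ultimately have "of_real m * b + of_real (sqrt \<alpha>) * (c * self_energy w) - z * b = characteristic m \<alpha> self_energy z * b"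
      by (simp add: characteristic_def w_def algebra_simps)
    also have "\<dots> = 1" using characteristic_nonzero[OF z \<alpha> small] by (simp add: b_def)
    finally show ?thesis .
  qed
  have sol: "\<psi> \<in> op_dom (dicke m f \<alpha>)" "op_app (dicke m f \<alpha>) \<psi> - z *\<^sub>C \<psi> = excited_state"
  proof -
    show "\<psi> \<in> op_dom (dicke m f \<alpha>)" unfolding \<psi>_def by (rule H(1))
    define \<eta> where "\<eta> q = of_real (inverse \<alpha>) * (of_real (norm q) * \<phi> q) + of_real (sqrt \<alpha>) * (b * f q)" for q
    have \<eta>: "square_integrable lborel \<eta>" unfolding \<eta>_def[abs_def]
      by (intro square_integrable_add square_integrable_mult \<phi> f)
    have "photon01 0 \<eta> + (- z) *\<^sub>C photon01 0 \<phi> = 0"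
      unfolding photon01_scaleC[OF \<phi>(1)] photon01_add[OF \<eta> square_integrable_mult[OF \<phi>(1)]]
      using one by (simp add: \<eta>_def photon01_zero)
    then have "photon01 0 \<eta> = z *\<^sub>C photon01 0 \<phi>" by (simp add: scaleC_minus_left)
    moreover have "photon01 (of_real m * b + of_real (sqrt \<alpha>) * (c * self_energy w)) (\<lambda>_ :: 'a. 0) + (- z) *\<^sub>C photon01 b (\<lambda>_. 0) = vacuum"
      using two by (simp add: photon01_scaleC photon01_add square_integrable_0 vacuum_eq_photon01)
    then have "photon01 (of_real m * b + of_real (sqrt \<alpha>) * (c * self_energy w)) (\<lambda>_ :: 'a. 0) = vacuum + z *\<^sub>C photon01 b (\<lambda>_. 0)"
      by (simp add: scaleC_minus_left algebra_simps)
    ultimately show "op_app (dicke m f \<alpha>) \<psi> - z *\<^sub>C \<psi> = excited_state"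
      using H(2) by (simp add: \<psi>_def fphi excited_state_def vec2_eq_iff \<eta>_def[abs_def])
  qed
  have uniq: "\<xi> = \<psi>" if \<xi>: "\<xi> \<in> op_dom (dicke m f \<alpha>)" "op_app (dicke m f \<alpha>) \<xi> - z *\<^sub>C \<xi> = excited_state" for \<xi>
  proof -
    have "op_app (dicke m f \<alpha>) \<xi> - op_app (dicke m f \<alpha>) \<psi> = z *\<^sub>C (\<xi> - \<psi>)"
      using \<xi>(2) sol(2) by (simp add: scaleC_diff_right algebra_simps)
    then have "Im (cinner (\<xi> - \<psi>) (z *\<^sub>C (\<xi> - \<psi>))) = 0"
      using symmetric_op_diff_real[OF dicke_symmetric[OF f] \<xi>(1) sol(1)] by simp
    then have "Im z * (norm (\<xi> - \<psi>))\<^sup>2 = 0"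
      by (simp add: cinner_scaleC_right cinner_self)
    then show ?thesis using z by simp
  qed
  have "(THE \<xi>. \<xi> \<in> op_dom (dicke m f \<alpha>) \<and> op_app (dicke m f \<alpha>) \<xi> - z *\<^sub>C \<xi> = excited_state) = \<psi>"
    by (rule the_equality) (simp only: sol simp_thms, elim conjE, rule uniq)
  then have "resolvent_element (dicke m f \<alpha>) excited_state z = cinner excited_state \<psi>"
    by (simp add: resolvent_element_def)
  also have "\<dots> = b"
    by (simp add: \<psi>_def excited_state_def cinner_vec2 vacuum_eq_photon01 cinner_photon01 square_integrable_0)
  finally show ?thesis by (simp add: b_def)
qed

end

context singular_coupling
begin

section \<open>The adiabatic estimate\<close>

text \<open>The vector \<open>\<psi>\<close> is mapped by \<open>H\<close> to the excited state up to the part of \<open>f\<close> below the cutoff \<open>e\<close>.  A cutoff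
  only lowers the energy shift, so \<open>1 / (m - \<alpha>\<^sup>2 \<E>)\<close> bounds the amplitude \<open>a\<close> of the excited state for
  all cutoffs and gaps.\<close>

lemma adiabatic_estimate_with_cutoff:
  assumes \<alpha>: "0 < \<alpha>" and \<tau>: "0 < \<tau>" and m: "\<alpha>\<^sup>2 * coupling_energy f < m" and e: "0 \<le> e" "e < r"
    and L: "integrable lborel (\<lambda>q. (cmod (f q))\<^sup>2 *\<^sub>R (indicator {e<..} (norm q) / (norm q)\<^sup>2))"
    and U\<^sub>A: "adiabatic_evolution (ground_proj :: real \<Rightarrow> ('a fock ^ 2) \<Rightarrow>\<^sub>L ('a fock ^ 2)) U\<^sub>A"
    and U\<^sub>\<tau>: "schroedinger_evolution (\<lambda>s. dicke_at s m f \<alpha>) \<tau> U\<^sub>\<tau>"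
    and s: "s \<in> {0..1}"
  shows "norm ((U\<^sub>A s - U\<^sub>\<tau> s) o\<^sub>L ground_proj 0) \<le> adiabatic_time_scale m f \<alpha> *
    (3 * (1 + \<alpha> * sqrt \<alpha> * sqrt (\<integral>q. (cmod (f q))\<^sup>2 *\<^sub>R (indicator {e<..} (norm q) / (norm q)\<^sup>2) \<partial>lborel)) / \<tau>
      + sqrt \<alpha> * sqrt (\<kappa> * e ^ (DIM('a) - 1) / real (DIM('a) - 1)))"
    (is "_ \<le> _ * (3 * (1 + \<alpha> * sqrt \<alpha> * sqrt ?L) / \<tau> + sqrt \<alpha> * sqrt ?B)")
proof -
  define \<chi>' where "\<chi>' q = (indicator {e<..} (norm q) :: real)" for q :: 'a
  have [measurable]: "\<chi>' \<in> borel_measurable borel" unfolding \<chi>'_def[abs_def] by measurable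
  have \<chi>'_01: "\<chi>' q = 0 \<or> \<chi>' q = 1" for q by (auto simp: \<chi>'_def indicator_def)
  define \<E>' where "\<E>' = (\<integral>q. (cmod (f q))\<^sup>2 *\<^sub>R (\<chi>' q / norm q) \<partial>lborel)"
  have \<E>'_le: "\<E>' \<le> coupling_energy f"
  proof -
    have "integrable lborel (\<lambda>q. (cmod (f q))\<^sup>2 *\<^sub>R (\<chi>' q / norm q))"
      by (rule Bochner_Integration.integrable_bound[OF coupling_energy_integral(1)])
        (auto simp: \<chi>'_def indicator_def)
    then show ?thesis unfolding \<E>'_def coupling_energy_def
      by (rule integral_mono[OF _ coupling_energy_integral(1)]) (auto simp: \<chi>'_def indicator_def)
  qed
  define a where "a = 1 / (m - \<alpha>\<^sup>2 * \<E>')"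
  have m_gap: "m - \<alpha>\<^sup>2 * coupling_energy f \<le> m - \<alpha>\<^sup>2 * \<E>'"
    using \<E>'_le by (simp add: mult_left_mono)
  then have gap: "0 < m - \<alpha>\<^sup>2 * \<E>'" using m by linarith
  have a: "0 < a" using gap by (simp add: a_def)
  have a_le: "a \<le> adiabatic_time_scale m f \<alpha>"
    unfolding a_def adiabatic_time_scale_def using m m_gap gap by (intro divide_left_mono mult_pos_pos) auto
  define bound where "bound = a * (3 * (1 + \<alpha> * sqrt \<alpha> * sqrt ?L) / \<tau> + sqrt \<alpha> * sqrt ?B)"
  have L0: "0 \<le> ?L" by (intro integral_nonneg_AE AE_I2) auto
  have B0: "0 \<le> ?B" using e kappa_nonneg by simp
  have bound0: "0 \<le> bound"
    unfolding bound_def using a \<alpha> \<tau> L0 B0 by (intro mult_nonneg_nonneg add_nonneg_nonneg divide_nonneg_pos) auto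
  have main: "norm (U\<^sub>A s y - U\<^sub>\<tau> s y) \<le> cmod c * bound" if y: "y = vector [photon01 c (\<lambda>_. 0), 0]" for c and y :: "'a fock ^ 2"
  proof -
    \<comment> \<open>Evolutions are real linear only, so the complex amplitude \<open>c\<close> of the ground state is carried along.\<close>
    define \<phi> where "\<phi> q = of_real (- (\<alpha> * sqrt \<alpha> * a)) * c * (of_real (\<chi>' q / norm q) * f q)" for q
    \<comment> \<open>What \<open>H \<psi>\<close> adds to the excited state: the coupling below the cutoff.\<close>
    define \<rho> where "\<rho> q = of_real (sqrt \<alpha> * a) * c * (of_real (1 - \<chi>' q) * f q)" for q
    define \<psi> :: "'a fock ^ 2" where "\<psi> = vector [photon01 0 \<phi>, photon01 (c * of_real a) (\<lambda>_. 0)]"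
    define h :: "'a fock ^ 2" where "h = vector [photon01 0 \<rho>, photon01 c (\<lambda>_. 0)]"
    define t where "t = complex_of_real (- (1 / \<tau>))"
    have cmod_\<phi>: "(cmod (\<phi> q))\<^sup>2 = (\<alpha> * sqrt \<alpha> * a * cmod c)\<^sup>2 * ((cmod (f q))\<^sup>2 *\<^sub>R (indicator {e<..} (norm q) / (norm q)\<^sup>2))" for q
      using \<alpha> a by (simp add: \<phi>_def norm_mult norm_divide power_mult_distrib power_divide \<chi>'_def indicator_def)
    have cmod_\<rho>: "(cmod (\<rho> q))\<^sup>2 = (sqrt \<alpha> * a * cmod c)\<^sup>2 * (indicator {..e} (norm q) * (cmod (f q))\<^sup>2)" for q
      using \<alpha> a by (simp add: \<rho>_def norm_mult power_mult_distrib \<chi>'_def indicator_def)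
    have \<phi>: "square_integrable lborel \<phi>"
      unfolding square_integrable_def cmod_\<phi>
    proof
      show "\<phi> \<in> borel_measurable lborel" unfolding \<phi>_def[abs_def] by measurable
    qed (rule integrable_mult_right[OF L])
    have bdd: "square_integrable lborel (\<lambda>q. of_real (u q) * f q)"
      if [measurable]: "u \<in> borel_measurable borel" and u: "\<And>q. u q = 0 \<or> u q = 1" for u :: "'a \<Rightarrow> real"
    proof -
      have "integrable lborel (\<lambda>q. (cmod (of_real (u q) * f q))\<^sup>2)"
      proof (rule Bochner_Integration.integrable_bound)
        show "integrable lborel (\<lambda>q. (cmod (f q))\<^sup>2)" using f by (simp add: square_integrable_def)
        have "norm ((cmod (of_real (u q) * f q))\<^sup>2) \<le> norm ((cmod (f q))\<^sup>2)" for q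
          using u[of q] by auto
        then show "AE q in lborel. norm ((cmod (of_real (u q) * f q))\<^sup>2) \<le> norm ((cmod (f q))\<^sup>2)" by simp
      qed measurable
      then show ?thesis by (simp add: square_integrable_def)
    qed
    have norm_\<phi>: "of_real (norm q) * \<phi> q = of_real (- (\<alpha> * sqrt \<alpha> * a)) * c * (of_real (\<chi>' q) * f q)" for q
      using e by (auto simp: \<phi>_def \<chi>'_def indicator_def)
    have \<phi>e: "square_integrable lborel (\<lambda>q. of_real (norm q) * \<phi> q)"
      unfolding norm_\<phi> by (intro square_integrable_mult bdd \<chi>'_01) measurable
    have \<rho>: "square_integrable lborel \<rho>"
      unfolding \<rho>_def[abs_def] by (intro square_integrable_mult bdd) (use \<chi>'_01 in auto)
    note fe0 = square_integrable_0 square_integrable_mult[OF \<phi>, of t]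
    have t\<phi>e: "square_integrable lborel (\<lambda>q. of_real (norm q) * (t * \<phi> q))"
      using square_integrable_mult[OF \<phi>e, of t] by (simp add: mult.left_commute)
    have w_eq: "y - (1 / \<tau>) *\<^sub>R \<psi> = vector [photon01 c (\<lambda>q. t * \<phi> q), photon01 (t * (c * of_real a)) (\<lambda>_. 0)]"
    proof -
      have "y - (1 / \<tau>) *\<^sub>R \<psi> = y + t *\<^sub>C \<psi>"
        by (simp add: t_def scaleR_scaleC scaleC_minus_left)
      then show ?thesis
        by (simp add: y \<psi>_def vec2_eq_iff photon01_scaleC photon01_add \<phi> fe0)
    qed
    have y_dom: "y \<in> op_dom (dicke m f \<alpha>)"
      using dicke_photon01(1)[OF f square_integrable_0, of c 0 m \<alpha>] by (simp add: y photon01_zero square_integrable_0)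
    note H = dicke_photon01[OF f fe0(2) t\<phi>e, where a = c and b = "t * (c * of_real a)" and m = m and \<alpha> = \<alpha>]
    have comp1: "of_real (inverse \<alpha>) * (of_real (norm q) * (t * \<phi> q)) + of_real (sqrt \<alpha>) * (t * (c * of_real a) * f q) = t * \<rho> q" for q
    proof -
      have "of_real (inverse \<alpha>) * (of_real (norm q) * (t * \<phi> q)) = t * of_real (inverse \<alpha>) * (of_real (norm q) * \<phi> q)"
        by simp
      also have "\<dots> = - (t * of_real (sqrt \<alpha> * a) * c * of_real (\<chi>' q) * f q)"
        unfolding norm_\<phi> using \<alpha> by (simp add: field_simps)
      finally show ?thesis by (simp add: \<rho>_def algebra_simps)
    qed
    have "(\<integral>q. cnj (f q) * (t * \<phi> q) \<partial>lborel)
        = (\<integral>q. (t * (of_real (- (\<alpha> * sqrt \<alpha> * a)) * c)) * complex_of_real ((cmod (f q))\<^sup>2 *\<^sub>R (\<chi>' q / norm q)) \<partial>lborel)"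
      by (intro Bochner_Integration.integral_cong refl)
        (simp add: \<phi>_def complex_norm_square mult_ac del: of_real_power)
    also have "\<dots> = t * (of_real (- (\<alpha> * sqrt \<alpha> * a)) * c) * of_real \<E>'"
      by (simp only: integral_mult_right_zero integral_complex_of_real \<E>'_def)
    finally have int: "(\<integral>q. cnj (f q) * (t * \<phi> q) \<partial>lborel) = t * (of_real (- (\<alpha> * sqrt \<alpha> * a)) * c) * of_real \<E>'" .
    have comp2: "of_real m * (t * (c * of_real a)) + of_real (sqrt \<alpha>) * (\<integral>q. cnj (f q) * (t * \<phi> q) \<partial>lborel) = t * c"
    proof -
      have "m * a + sqrt \<alpha> * (- (\<alpha> * sqrt \<alpha> * a)) * \<E>' = a * (m - \<alpha>\<^sup>2 * \<E>')"
        using \<alpha> by (simp add: power2_eq_square algebra_simps)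
      also have "\<dots> = 1" using gap by (simp add: a_def)
      finally have "complex_of_real (m * a + sqrt \<alpha> * (- (\<alpha> * sqrt \<alpha> * a)) * \<E>') = 1" by (simp only: of_real_1)
      moreover have "of_real m * (t * (c * of_real a)) + of_real (sqrt \<alpha>) * (t * (of_real (- (\<alpha> * sqrt \<alpha> * a)) * c) * of_real \<E>')
          = t * c * complex_of_real (m * a + sqrt \<alpha> * (- (\<alpha> * sqrt \<alpha> * a)) * \<E>')"
        unfolding of_real_add of_real_mult by (simp only: distrib_left mult_ac)
      ultimately show ?thesis unfolding int by simp
    qed
    have Hw: "op_app (dicke m f \<alpha>) (y - (1 / \<tau>) *\<^sub>R \<psi>) = - (1 / \<tau>) *\<^sub>R h"
    proof -
      have "- (1 / \<tau>) *\<^sub>R h = t *\<^sub>C h" by (simp add: t_def scaleR_scaleC scaleC_minus_left)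
      then show ?thesis
        unfolding w_eq H(2) comp1 comp2 by (simp add: h_def vec2_eq_iff photon01_scaleC \<rho> square_integrable_0)
    qed
    have near: "norm (U\<^sub>\<tau> s y - rotation s y) \<le> 3 * norm \<psi> / \<tau> + norm (i_sigma_x y - \<i> *\<^sub>C h)"
      using U\<^sub>\<tau> unfolding dicke_at_def
      by (rule schroedinger_near_rotated_state[OF _ dicke_symmetric[OF f] \<tau> y_dom _ Hw s])
        (simp add: w_eq H(1))
    have "ground_proj_0 y = y"
      by (simp add: ground_proj_0_apply y vacuum_eq_photon01 cinner_photon01 photon01_scaleC square_integrable_0)
    moreover have "ground_proj_0 (i_sigma_x y) = 0"
      by (simp add: ground_proj_0_apply y i_sigma_x_apply vec2_eq_iff)
    ultimately have UA: "U\<^sub>A s y = rotation s y"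
      by (rule adiabatic_evolution_on_ground_state[OF U\<^sub>A _ _ s])
    have norm_\<psi>: "norm \<psi> \<le> cmod c * (a * (1 + \<alpha> * sqrt \<alpha> * sqrt ?L))"
    proof -
      have "(norm (photon01 0 \<phi>))\<^sup>2 = (\<alpha> * sqrt \<alpha> * a * cmod c)\<^sup>2 * ?L"
        unfolding norm_photon01[OF \<phi>] cmod_\<phi> integral_mult_right_zero by simp
      also have "\<dots> = (\<alpha> * sqrt \<alpha> * a * cmod c * sqrt ?L)\<^sup>2"
        using L0 by (simp add: power_mult_distrib)
      finally have 1: "norm (photon01 0 \<phi>) = \<alpha> * sqrt \<alpha> * a * cmod c * sqrt ?L"
        using \<alpha> a L0 by (subst (asm) power2_eq_iff_nonneg) auto
      have "(norm (photon01 (c * of_real a) (\<lambda>_. 0) :: 'a fock))\<^sup>2 = (cmod c * a)\<^sup>2"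
        using a by (simp add: norm_photon01 square_integrable_0 norm_mult)
      then have 2: "norm (photon01 (c * of_real a) (\<lambda>_. 0) :: 'a fock) = cmod c * a"
        using a by (subst (asm) power2_eq_iff_nonneg) auto
      show ?thesis
        using norm_vector_2_le[of "photon01 0 \<phi>" "photon01 (c * of_real a) (\<lambda>_. 0)"]
        unfolding \<psi>_def 1 2 by (simp add: algebra_simps)
    qed
    have norm_r: "norm (i_sigma_x y - \<i> *\<^sub>C h) = cmod c * (a * (sqrt \<alpha> * sqrt ?B))"
    proof -
      have "(norm (i_sigma_x y - \<i> *\<^sub>C h))\<^sup>2 = (norm (photon01 0 \<rho>))\<^sup>2"
        by (simp add: norm_vec2_sq i_sigma_x_apply y h_def)
      also have "\<dots> = (sqrt \<alpha> * a * cmod c)\<^sup>2 * ?B"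
        unfolding norm_photon01[OF \<rho>] cmod_\<rho> integral_mult_right_zero small_momentum_weight[OF e] by simp
      also have "\<dots> = (cmod c * (a * (sqrt \<alpha> * sqrt ?B)))\<^sup>2"
        using B0 by (simp add: power_mult_distrib mult_ac)
      finally show ?thesis using \<alpha> a B0 by (subst (asm) power2_eq_iff_nonneg) auto
    qed
    have "3 * norm \<psi> / \<tau> \<le> 3 * (cmod c * (a * (1 + \<alpha> * sqrt \<alpha> * sqrt ?L))) / \<tau>"
      using norm_\<psi> \<tau> by (intro divide_right_mono mult_left_mono) auto
    then have "norm (U\<^sub>\<tau> s y - rotation s y) \<le> cmod c * bound"
      using near unfolding norm_r bound_def by (simp add: algebra_simps)
    then show ?thesis unfolding UA by (simp add: norm_minus_commute)
  qed
  have "norm ((U\<^sub>A s - U\<^sub>\<tau> s) o\<^sub>L ground_proj 0) \<le> bound"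
  proof (rule norm_blinfun_bound[OF bound0])
    fix x :: "'a fock ^ 2"
    define c where "c = cinner vacuum (x $ 1)"
    have c: "cmod c \<le> norm x"
    proof -
      have "(norm (vacuum :: 'a fock))\<^sup>2 = 1"
        by (simp add: vacuum_eq_photon01 norm_photon01 square_integrable_0)
      then have "norm (vacuum :: 'a fock) = 1" by (simp add: power2_eq_1_iff) (metis norm_ge_zero not_one_le_zero le_minus_iff minus_zero zero_neq_neg_one neg_0_le_iff_le)
      then have "cmod c \<le> norm (x $ 1)"
        using norm_cinner_le[of vacuum "x $ 1"] by (simp add: c_def)
      also have "\<dots> \<le> norm x" by (rule Finite_Cartesian_Product.norm_nth_le)
      finally show ?thesis .
    qed
    have "ground_proj 0 x = vector [photon01 c (\<lambda>_. 0), 0]"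
      by (simp add: ground_proj_apply ground_proj_0_apply c_def vacuum_eq_photon01 photon01_scaleC square_integrable_0)
    then have "norm (((U\<^sub>A s - U\<^sub>\<tau> s) o\<^sub>L ground_proj 0) x) \<le> cmod c * bound"
      using main[of "ground_proj 0 x" c] by (simp add: blinfun.diff_left)
    also have "cmod c * bound \<le> norm x * bound" by (rule mult_right_mono[OF c bound0])
    finally show "norm (((U\<^sub>A s - U\<^sub>\<tau> s) o\<^sub>L ground_proj 0) x) \<le> bound * norm x"
      by (simp only: mult.commute)
  qed
  also have "bound \<le> adiabatic_time_scale m f \<alpha> * (3 * (1 + \<alpha> * sqrt \<alpha> * sqrt ?L) / \<tau> + sqrt \<alpha> * sqrt ?B)"
    unfolding bound_def using a_le \<alpha> \<tau> L0 B0
    by (intro mult_right_mono add_nonneg_nonneg divide_nonneg_pos) auto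
  finally show ?thesis .
qed

text \<open>Without cutoff for \<open>d > 3\<close>; for \<open>d = 3\<close> the cutoff \<open>1/\<tau>\<close> balances \<open>\<surd>(log (1/e)) / \<tau>\<close> against \<open>e\<close>.\<close>

lemma adiabatic_bound:
  assumes \<alpha>: "0 < \<alpha>"
  shows "\<exists>C. \<forall>\<^sub>F \<tau> in at_top. \<forall>m > \<alpha>\<^sup>2 * coupling_energy f. \<forall>U\<^sub>A U\<^sub>\<tau>.
            adiabatic_evolution (ground_proj :: real \<Rightarrow> ('a fock ^ 2) \<Rightarrow>\<^sub>L ('a fock ^ 2)) U\<^sub>A \<and>
            schroedinger_evolution (\<lambda>s. dicke_at s m f \<alpha>) \<tau> U\<^sub>\<tau> \<longrightarrow>
            (\<forall>s\<in>{0..1}. norm ((U\<^sub>A s - U\<^sub>\<tau> s) o\<^sub>L ground_proj 0)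
               \<le> C * adiabatic_time_scale m f \<alpha> * adiabatic_rate DIM('a) \<tau>)"
proof (cases "DIM('a) = 3")
  case False
  then have d: "3 < DIM('a)" using dim by simp
  define L where "L = (\<integral>q. (cmod (f q))\<^sup>2 *\<^sub>R (indicator {0<..} (norm q) / (norm q)\<^sup>2) \<partial>lborel)"
  have ind: "(indicator {0<..} (norm q) / (norm q)\<^sup>2 :: real) = 1 / (norm q)\<^sup>2" for q :: 'a
    by (auto simp: indicator_def)
  have i: "integrable lborel (\<lambda>q. (cmod (f q))\<^sup>2 *\<^sub>R (indicator {0<..} (norm q) / (norm q)\<^sup>2))"
    unfolding ind by (rule f_over_norm_sq_dim_gt_3[OF d])
  have "norm ((U\<^sub>A s - U\<^sub>\<tau> s) o\<^sub>L ground_proj 0)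
      \<le> 3 * (1 + \<alpha> * sqrt \<alpha> * sqrt L) * adiabatic_time_scale m f \<alpha> * adiabatic_rate DIM('a) \<tau>"
    if "0 < \<tau>" "\<alpha>\<^sup>2 * coupling_energy f < m"
      "adiabatic_evolution (ground_proj :: real \<Rightarrow> ('a fock ^ 2) \<Rightarrow>\<^sub>L ('a fock ^ 2)) U\<^sub>A"
      "schroedinger_evolution (\<lambda>s. dicke_at s m f \<alpha>) \<tau> U\<^sub>\<tau>" "s \<in> {0..1}" for \<tau> m U\<^sub>A U\<^sub>\<tau> s
    using adiabatic_estimate_with_cutoff[OF \<alpha> that(1,2) order_refl r i that(3-5)] False dim
    unfolding L_def by (simp add: adiabatic_rate_def power_0_left mult_ac)
  then show ?thesis
    by (intro exI[of _ "3 * (1 + \<alpha> * sqrt \<alpha> * sqrt L)"] eventually_mono[OF eventually_gt_at_top[of 0]]) blast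
next
  case d: True
  define Far where "Far = (\<integral>q. (indicator {r..} (norm q) * (cmod (f q))\<^sup>2) *\<^sub>R (1 / (norm q)\<^sup>2) \<partial>lborel)"
  have Far: "0 \<le> Far" unfolding Far_def by (intro integral_nonneg_AE AE_I2) auto
  define M where "M = \<kappa> * (\<bar>ln r\<bar> + 1) + Far"
  define C where "C = 3 * (1 + \<alpha> * sqrt \<alpha> * sqrt M) + sqrt \<alpha> * sqrt (\<kappa> / 2)"
  have "norm ((U\<^sub>A s - U\<^sub>\<tau> s) o\<^sub>L ground_proj 0)
      \<le> C * adiabatic_time_scale m f \<alpha> * adiabatic_rate DIM('a) \<tau>"
    if \<tau>: "max (exp 1) (1 / r) < \<tau>" and m: "\<alpha>\<^sup>2 * coupling_energy f < m"
      and U: "adiabatic_evolution (ground_proj :: real \<Rightarrow> ('a fock ^ 2) \<Rightarrow>\<^sub>L ('a fock ^ 2)) U\<^sub>A"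
      "schroedinger_evolution (\<lambda>s. dicke_at s m f \<alpha>) \<tau> U\<^sub>\<tau>" "s \<in> {0..1}" for \<tau> m U\<^sub>A U\<^sub>\<tau> s
  proof -
    have \<tau>0: "0 < \<tau>" using \<tau> exp_gt_zero[of 1] by linarith
    have ln: "1 \<le> ln \<tau>" using \<tau> \<tau>0 by (subst ln_ge_iff) auto
    then have sqln: "1 \<le> sqrt (ln \<tau>)" by simp
    have e: "0 < 1 / \<tau>" "1 / \<tau> < r"
      using \<tau> \<tau>0 r by (auto simp: field_simps)
    define L where "L = (\<integral>q. (cmod (f q))\<^sup>2 *\<^sub>R (indicator {1 / \<tau><..} (norm q) / (norm q)\<^sup>2) \<partial>lborel)"
    note fL = f_over_norm_sq_dim_3[OF d e]
    have "L = \<kappa> * (ln r + ln \<tau>) + Far"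
      unfolding L_def fL(2) Far_def using \<tau>0 by (simp add: ln_div)
    also have "\<dots> \<le> \<kappa> * ((\<bar>ln r\<bar> + 1) * ln \<tau>) + Far * ln \<tau>"
    proof -
      have "ln r \<le> \<bar>ln r\<bar> * ln \<tau>" using ln mult_left_mono[of 1 "ln \<tau>" "\<bar>ln r\<bar>"] by linarith
      then have "ln r + ln \<tau> \<le> (\<bar>ln r\<bar> + 1) * ln \<tau>" by (simp add: algebra_simps)
      then have "\<kappa> * (ln r + ln \<tau>) \<le> \<kappa> * ((\<bar>ln r\<bar> + 1) * ln \<tau>)"
        using kappa_nonneg by (rule mult_left_mono)
      moreover have "Far \<le> Far * ln \<tau>" using ln Far mult_left_mono[of 1 "ln \<tau>" Far] by linarith
      ultimately show ?thesis by linarith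
    qed
    also have "\<dots> = M * ln \<tau>" by (simp add: M_def algebra_simps)
    finally have "sqrt L \<le> sqrt M * sqrt (ln \<tau>)"
      by (simp flip: real_sqrt_mult)
    then have "\<alpha> * sqrt \<alpha> * sqrt L \<le> \<alpha> * sqrt \<alpha> * (sqrt M * sqrt (ln \<tau>))"
      using \<alpha> by (intro mult_left_mono) auto
    then have "1 + \<alpha> * sqrt \<alpha> * sqrt L \<le> sqrt (ln \<tau>) + \<alpha> * sqrt \<alpha> * (sqrt M * sqrt (ln \<tau>))"
      using sqln by linarith
    also have "\<dots> = (1 + \<alpha> * sqrt \<alpha> * sqrt M) * sqrt (ln \<tau>)"
      by (simp add: algebra_simps)
    finally have "3 * (1 + \<alpha> * sqrt \<alpha> * sqrt L) / \<tau> \<le> 3 * ((1 + \<alpha> * sqrt \<alpha> * sqrt M) * sqrt (ln \<tau>)) / \<tau>"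
      using \<tau>0 by (intro divide_right_mono mult_left_mono) auto
    moreover have "sqrt \<alpha> * sqrt (\<kappa> * (1 / \<tau>) ^ (DIM('a) - 1) / real (DIM('a) - 1)) \<le> sqrt \<alpha> * (sqrt (\<kappa> / 2) * sqrt (ln \<tau>)) / \<tau>"
    proof -
      have "\<kappa> * (1 / \<tau>) ^ (DIM('a) - 1) / real (DIM('a) - 1) = \<kappa> / 2 * (1 / \<tau>)\<^sup>2"
        by (simp add: d)
      then have "sqrt (\<kappa> * (1 / \<tau>) ^ (DIM('a) - 1) / real (DIM('a) - 1)) = sqrt (\<kappa> / 2) * (1 / \<tau>)"
        using \<tau>0 by (simp only: real_sqrt_mult real_sqrt_abs) simp
      moreover have "sqrt (\<kappa> / 2) * 1 \<le> sqrt (\<kappa> / 2) * sqrt (ln \<tau>)"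
        using sqln kappa_nonneg by (intro mult_left_mono) auto
      ultimately have "sqrt (\<kappa> * (1 / \<tau>) ^ (DIM('a) - 1) / real (DIM('a) - 1)) \<le> sqrt (\<kappa> / 2) * sqrt (ln \<tau>) / \<tau>"
        using \<tau>0 by (simp add: divide_right_mono)
      then show ?thesis using \<alpha> mult_left_mono[of _ "sqrt (\<kappa> / 2) * sqrt (ln \<tau>) / \<tau>" "sqrt \<alpha>"] by simp
    qed
    ultimately have "3 * (1 + \<alpha> * sqrt \<alpha> * sqrt L) / \<tau> + sqrt \<alpha> * sqrt (\<kappa> * (1 / \<tau>) ^ (DIM('a) - 1) / real (DIM('a) - 1))
        \<le> 3 * ((1 + \<alpha> * sqrt \<alpha> * sqrt M) * sqrt (ln \<tau>)) / \<tau> + sqrt \<alpha> * (sqrt (\<kappa> / 2) * sqrt (ln \<tau>)) / \<tau>"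
      by (rule add_mono)
    also have "\<dots> = C * (sqrt (ln \<tau>) / \<tau>)"
      by (simp add: C_def add_divide_distrib distrib_right mult.assoc)
    finally have le: "3 * (1 + \<alpha> * sqrt \<alpha> * sqrt L) / \<tau> + sqrt \<alpha> * sqrt (\<kappa> * (1 / \<tau>) ^ (DIM('a) - 1) / real (DIM('a) - 1))
        \<le> C * (sqrt (ln \<tau>) / \<tau>)" .
    have "norm ((U\<^sub>A s - U\<^sub>\<tau> s) o\<^sub>L ground_proj 0) \<le> adiabatic_time_scale m f \<alpha> *
        (3 * (1 + \<alpha> * sqrt \<alpha> * sqrt L) / \<tau> + sqrt \<alpha> * sqrt (\<kappa> * (1 / \<tau>) ^ (DIM('a) - 1) / real (DIM('a) - 1)))"
      unfolding L_def by (rule adiabatic_estimate_with_cutoff[OF \<alpha> \<tau>0 m less_imp_le[OF e(1)] e(2) fL(1) U])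
    also have "\<dots> \<le> adiabatic_time_scale m f \<alpha> * (C * (sqrt (ln \<tau>) / \<tau>))"
      using m by (intro mult_left_mono le) (simp add: adiabatic_time_scale_def)
    finally show ?thesis by (simp add: adiabatic_rate_def d mult_ac)
  qed
  then show ?thesis
    by (intro exI[of _ C] eventually_mono[OF eventually_gt_at_top[of "max (exp 1) (1 / r)"]]) blast
qed

section \<open>The resonance\<close>

lemma characteristic_eq:
  assumes "0 < Im z" "0 < \<alpha>" "cmod (of_real \<alpha> * z) < r"
  shows "characteristic m \<alpha> continued_self_energy z = characteristic m \<alpha> self_energy z"
  using assms by (simp add: characteristic_def continued_self_energy_eq)

text \<open>For small \<open>\<alpha>\<close>, scaling by \<open>\<alpha>\<close> maps the disc of radius \<open>m/2\<close> around \<open>m\<close> into the region to which the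
  self energy is continued.\<close>

lemma scaled_ball:
  assumes "0 < m" "0 < \<alpha>" "\<alpha> * m < r / 2" "z \<in> ball (complex_of_real m) (m / 2)"
  shows "0 < Re z" "cmod (of_real \<alpha> * z) < r" "cmod (of_real \<alpha> * z) \<le> 2 * m * \<alpha>"
proof -
  have d: "cmod (complex_of_real m - z) < m / 2" using assms(4) by (simp add: dist_norm)
  have "m - Re z < m / 2" using abs_Re_le_cmod[of "complex_of_real m - z"] d by simp
  then show "0 < Re z" using assms(1) by linarith
  have "cmod z < 2 * m"
    using norm_triangle_ineq2[of z "complex_of_real m"] d assms(1) by (simp add: norm_minus_commute)
  then have "\<alpha> * cmod z < \<alpha> * (2 * m)" using assms(2) by (intro mult_strict_left_mono)
  moreover have "cmod (of_real \<alpha> * z) = \<alpha> * cmod z" using assms(2) by (simp add: norm_mult)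
  moreover have "\<alpha> * (2 * m) = 2 * m * \<alpha>" "2 * m * \<alpha> < r" using assms(3) by (simp_all add: mult_ac)
  ultimately show "cmod (of_real \<alpha> * z) < r" "cmod (of_real \<alpha> * z) \<le> 2 * m * \<alpha>"
    by linarith+
qed

lemma continued_self_energy_scaled_holomorphic:
  assumes "0 < m" "0 < \<alpha>" "\<alpha> * m < r / 2"
  shows "(\<lambda>z. continued_self_energy (of_real \<alpha> * z)) holomorphic_on ball (complex_of_real m) (m / 2)"
proof -
  have "(\<lambda>z. of_real \<alpha> * z) ` ball (complex_of_real m) (m / 2) \<subseteq> {w. 0 < Re w \<and> cmod w < r}"
    using scaled_ball[OF assms] assms(2) by auto
  then show ?thesis
    using holomorphic_on_compose_gen[OF _ continued_self_energy_holomorphic, of "\<lambda>z. of_real \<alpha> * z"]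
    by (auto simp: o_def intro: holomorphic_intros)
qed

lemma characteristic_holomorphic:
  assumes "0 < m" "0 < \<alpha>" "\<alpha> * m < r / 2"
  shows "characteristic m \<alpha> continued_self_energy holomorphic_on ball (complex_of_real m) (m / 2)"
  unfolding characteristic_def[abs_def]
  by (intro holomorphic_intros continued_self_energy_scaled_holomorphic[OF assms])

text \<open>By the identity theorem the continuation \<open>g\<close> of the resolvent element is the reciprocal of the
  characteristic function on a punctured disc, and the reciprocal of a pole tends to \<open>0\<close>.\<close>

lemma resonance_zero:
  assumes res: "resonance (dicke m f \<alpha>) excited_state m E"
    and m: "0 < m" and \<alpha>: "0 < \<alpha>" "\<alpha> * m < r / 2"
    and E: "E \<in> ball (complex_of_real m) (m / 2)"
  shows "characteristic m \<alpha> continued_self_energy E = 0"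
proof -
  define G where "G = characteristic m \<alpha> continued_self_energy"
  from res obtain r' g where r': "0 < r'" "E \<in> ball (complex_of_real m) r'"
    and g: "g holomorphic_on (ball (complex_of_real m) r' - {E})" "is_pole g E"
    and eq: "\<And>z. z \<in> ball (complex_of_real m) r' \<Longrightarrow> 0 < Im z \<Longrightarrow>
      g z = resolvent_element (dicke m f \<alpha>) excited_state z"
    unfolding resonance_def by blast
  define \<rho> where "\<rho> = min r' (m / 2)"
  define D where "D = ball (complex_of_real m) \<rho> - {E}"
  have \<rho>: "0 < \<rho>" using r' m by (simp add: \<rho>_def)
  have Gh: "G holomorphic_on ball (complex_of_real m) (m / 2)"
    unfolding G_def by (rule characteristic_holomorphic[OF m \<alpha>])
  have gG: "g z * G z = 1" if z: "z \<in> D" for z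
  proof (rule analytic_continuation_open[where s = "D \<inter> {z. 0 < Im z}" and s' = D and f = "\<lambda>z. g z * G z" and g = "\<lambda>_. 1"])
    show "open D" unfolding D_def by (intro open_delete open_ball)
    then show "open (D \<inter> {z. 0 < Im z})"
      by (intro open_Int open_halfspace_Im_gt)
    show "connected D" unfolding D_def by (intro connected_open_delete) auto
    show "D \<inter> {z. 0 < Im z} \<noteq> {}"
    proof -
      \<comment> \<open>Of two points of the upper half disc, at most one is \<open>E\<close>.\<close>
      define p where "p x = complex_of_real m + \<i> * of_real x" for x
      have p: "p x \<in> ball (complex_of_real m) \<rho> \<inter> {z. 0 < Im z}" if "0 < x" "x < \<rho>" for x
        using that by (simp add: p_def dist_norm norm_mult)
      have "p (\<rho> / 2) \<noteq> p (\<rho> / 3)" using \<rho> by (simp add: p_def)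
      then have "p (\<rho> / 2) \<noteq> E \<or> p (\<rho> / 3) \<noteq> E" by auto
      then show ?thesis using p[of "\<rho> / 2"] p[of "\<rho> / 3"] \<rho> by (auto simp: D_def)
    qed
    show "(\<lambda>z. g z * G z) holomorphic_on D"
      by (intro holomorphic_on_mult holomorphic_on_subset[OF g(1)] holomorphic_on_subset[OF Gh])
        (auto simp: D_def \<rho>_def)
    show "g z * G z = 1" if z: "z \<in> D \<inter> {z. 0 < Im z}" for z
    proof -
      have z': "z \<in> ball (complex_of_real m) (m / 2)" "z \<in> ball (complex_of_real m) r'" "0 < Im z"
        using z by (auto simp: D_def \<rho>_def)
      note small = scaled_ball(2)[OF m \<alpha> z'(1)]
      show ?thesis
        unfolding G_def eq[OF z'(2,3)] resolvent_element_dicke[OF z'(3) \<alpha>(1) small] characteristic_eq[OF z'(3) \<alpha>(1) small]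
        using characteristic_nonzero[OF z'(3) \<alpha>(1) small] by simp
    qed
  qed (use z in auto)
  have "((inverse \<circ> g) \<longlongrightarrow> 0) (at E)" by (rule is_pole_tendsto[OF g(2)])
  moreover have "eventually (\<lambda>z. (inverse \<circ> g) z = G z) (at E)"
  proof -
    have "eventually (\<lambda>z. z \<in> ball (complex_of_real m) \<rho> - {E}) (at E)"
      using r' E by (intro eventually_at_in_open) (auto simp: \<rho>_def)
    then show ?thesis
    proof (rule eventually_mono)
      fix z assume "z \<in> ball (complex_of_real m) \<rho> - {E}"
      then have "g z * G z = 1" using gG by (simp add: D_def)
      then show "(inverse \<circ> g) z = G z" by (simp add: inverse_unique)
    qed
  qed
  ultimately have "(G \<longlongrightarrow> 0) (at E)" by (rule Lim_transform_eventually)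
  moreover have "(G \<longlongrightarrow> G E) (at E)"
    using holomorphic_on_imp_continuous_on[OF Gh] E
    by (simp add: continuous_on_eq_continuous_at continuous_at)
  ultimately show ?thesis unfolding G_def by (meson tendsto_unique at_neq_bot)
qed

lemma resonance_of_zero:
  assumes m: "0 < m" and \<alpha>: "0 < \<alpha>" "\<alpha> * m < r / 2" and \<rho>: "\<rho> \<le> m / 2"
    and E: "E \<in> ball (complex_of_real m) \<rho>" "characteristic m \<alpha> continued_self_energy E = 0"
    and uniq: "\<And>z. z \<in> ball (complex_of_real m) \<rho> \<Longrightarrow> characteristic m \<alpha> continued_self_energy z = 0 \<Longrightarrow> z = E"
  shows "resonance (dicke m f \<alpha>) excited_state m E"
  unfolding resonance_def
proof (intro exI conjI ballI impI)
  define G where "G = characteristic m \<alpha> continued_self_energy"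
  show "0 < \<rho>" using E(1) by (metis mem_ball zero_le_dist order_le_less_trans)
  show "E \<in> ball (complex_of_real m) \<rho>" by fact
  have Gh: "G holomorphic_on ball (complex_of_real m) \<rho>"
    unfolding G_def by (rule holomorphic_on_subset[OF characteristic_holomorphic[OF m \<alpha>]]) (use \<rho> in auto)
  have nz: "G z \<noteq> 0" if "z \<in> ball (complex_of_real m) \<rho> - {E}" for z
    using uniq that by (auto simp: G_def)
  show "(\<lambda>z. inverse (G z)) holomorphic_on ball (complex_of_real m) \<rho> - {E}"
    using nz by (intro holomorphic_on_inverse holomorphic_on_subset[OF Gh]) auto
  have "(G \<longlongrightarrow> G E) (at E)"
    using holomorphic_on_imp_continuous_on[OF Gh] E(1)
    by (simp add: continuous_on_eq_continuous_at continuous_at)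
  moreover have "eventually (\<lambda>z. z \<in> ball (complex_of_real m) \<rho> - {E}) (at E)"
    using E(1) by (intro eventually_at_in_open) auto
  then have "eventually (\<lambda>z. G z \<noteq> 0) (at E)" by (rule eventually_mono) (rule nz)
  ultimately have "filterlim G (at 0) (at E)"
    using E(2) by (simp add: filterlim_at G_def)
  then show "is_pole (\<lambda>z. inverse (G z)) E"
    unfolding is_pole_def by (rule filterlim_compose[OF filterlim_inverse_at_infinity])
  fix z assume z: "z \<in> ball (complex_of_real m) \<rho>" "0 < Im z"
  have "z \<in> ball (complex_of_real m) (m / 2)" using z(1) \<rho> by auto
  note small = scaled_ball(2)[OF m \<alpha> this]
  show "inverse (G z) = resolvent_element (dicke m f \<alpha>) excited_state z"
    unfolding G_def resolvent_element_dicke[OF z(2) \<alpha>(1) small] characteristic_eq[OF z(2) \<alpha>(1) small]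
    by (simp add: inverse_eq_divide)
qed

lemma continued_self_energy_bounded:
  obtains \<delta> M where "0 < \<delta>" "0 < M" "\<And>w. w \<noteq> 0 \<Longrightarrow> cmod w < \<delta> \<Longrightarrow> cmod (continued_self_energy w) \<le> M"
proof -
  have "eventually (\<lambda>w. dist (continued_self_energy w) (of_real (coupling_energy f)) < 1) (at 0)"
    using continued_self_energy_tendsto by (rule tendstoD) simp
  then obtain \<delta> where \<delta>: "0 < \<delta>" "\<And>w. w \<noteq> 0 \<Longrightarrow> cmod w < \<delta> \<Longrightarrow>
      dist (continued_self_energy w) (of_real (coupling_energy f)) < 1"
    unfolding eventually_at by auto
  have "cmod (continued_self_energy w) \<le> \<bar>coupling_energy f\<bar> + 1" if "w \<noteq> 0" "cmod w < \<delta>" for w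
    using \<delta>(2)[OF that] norm_triangle_ineq2[of "continued_self_energy w" "of_real (coupling_energy f)"]
    by (simp add: dist_norm)
  then show ?thesis by (intro that[of \<delta> "\<bar>coupling_energy f\<bar> + 1"] \<delta>(1)) auto
qed

text \<open>A zero is a fixed point of \<open>h(z) = m - \<alpha>\<^sup>2 S(\<alpha> z)\<close>.  On the disc of radius \<open>m/8\<close>, Cauchy's estimate
  with radius \<open>m/8\<close> bounds the derivative of \<open>h\<close> by \<open>8 \<alpha>\<^sup>2 M / m \<le> 1/4\<close>, so \<open>h\<close> is a contraction.\<close>

lemma characteristic_zero_exists:
  assumes m: "0 < m" and \<alpha>: "0 < \<alpha>" "\<alpha> * m < r / 2" and M: "0 < M" "\<alpha>\<^sup>2 * M \<le> m / 32"
    and bound: "\<And>z. z \<in> ball (complex_of_real m) (m / 2) \<Longrightarrow> cmod (continued_self_energy (of_real \<alpha> * z)) \<le> M"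
  obtains E where "cmod (E - of_real m) \<le> \<alpha>\<^sup>2 * M" "characteristic m \<alpha> continued_self_energy E = 0"
    "\<And>z. z \<in> cball (complex_of_real m) (m / 8) \<Longrightarrow> characteristic m \<alpha> continued_self_energy z = 0 \<Longrightarrow> z = E"
proof -
  define h where "h z = of_real m - of_real (\<alpha>\<^sup>2) * continued_self_energy (of_real \<alpha> * z)" for z
  have fix_iff: "characteristic m \<alpha> continued_self_energy z = 0 \<longleftrightarrow> h z = z" for z
    by (auto simp: characteristic_def h_def algebra_simps)
  have h_near: "cmod (h z - of_real m) \<le> \<alpha>\<^sup>2 * M" if "z \<in> ball (complex_of_real m) (m / 2)" for z
    using mult_left_mono[OF bound[OF that], of "\<alpha>\<^sup>2"] by (simp add: h_def norm_mult norm_power)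
  have hh: "h holomorphic_on ball (complex_of_real m) (m / 2)"
    unfolding h_def by (intro holomorphic_intros continued_self_energy_scaled_holomorphic[OF m \<alpha>])
  have der: "cmod (deriv h z) \<le> 1 / 2" if z: "z \<in> cball (complex_of_real m) (m / 8)" for z
  proof -
    have sub: "cball z (m / 8) \<subseteq> ball (complex_of_real m) (m / 2)"
    proof
      fix u assume "u \<in> cball z (m / 8)"
      then show "u \<in> ball (complex_of_real m) (m / 2)"
        using z dist_triangle[of "complex_of_real m" u z] m by auto
    qed
    have "cmod ((deriv ^^ 1) (\<lambda>u. h u - of_real m) z) \<le> fact 1 * (\<alpha>\<^sup>2 * M) / (m / 8) ^ 1"
    proof (rule Cauchy_inequality)
      have *: "(\<lambda>u. h u - of_real m) holomorphic_on cball z (m / 8)"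
        by (intro holomorphic_intros holomorphic_on_subset[OF hh sub])
      then show "continuous_on (cball z (m / 8)) (\<lambda>u. h u - of_real m)"
        by (rule holomorphic_on_imp_continuous_on)
      show "(\<lambda>u. h u - of_real m) holomorphic_on ball z (m / 8)"
        by (rule holomorphic_on_subset[OF *]) auto
      show "cmod (h u - of_real m) \<le> \<alpha>\<^sup>2 * M" if "cmod (z - u) = m / 8" for u
        using that sub by (intro h_near) (auto simp: dist_norm)
    qed (use m in simp)
    also have "(deriv ^^ 1) (\<lambda>u. h u - of_real m) z = deriv h z"
    proof -
      have "h field_differentiable at z"
        using hh z m by (intro holomorphic_on_imp_differentiable_at[OF hh]) auto
      then show ?thesis by simp
    qed
    also have "fact 1 * (\<alpha>\<^sup>2 * M) / (m / 8) ^ 1 \<le> 1 / 2"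
      using M(2) m by (simp add: field_simps)
    finally show ?thesis .
  qed
  have lip: "cmod (h x - h y) \<le> 1 / 2 * cmod (x - y)"
    if "x \<in> cball (complex_of_real m) (m / 8)" "y \<in> cball (complex_of_real m) (m / 8)" for x y
  proof (rule field_differentiable_bound[OF convex_cball _ der that])
    fix z assume z: "z \<in> cball (complex_of_real m) (m / 8)"
    have "h field_differentiable at z"
      using z m by (intro holomorphic_on_imp_differentiable_at[OF hh]) auto
    then show "(h has_field_derivative deriv h z) (at z within cball (complex_of_real m) (m / 8))"
      by (rule has_field_derivative_at_within[OF field_differentiable_derivI])
  qed
  have sub: "cball (complex_of_real m) (m / 8) \<subseteq> ball (complex_of_real m) (m / 2)"
    using m by auto
  have "\<exists>!z. z \<in> cball (complex_of_real m) (m / 8) \<and> h z = z"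
  proof (rule Banach_fix[where c = "1 / 2"])
    show "complete (cball (complex_of_real m) (m / 8))"
      by (intro compact_imp_complete compact_cball)
    show "cball (complex_of_real m) (m / 8) \<noteq> {}" using m by simp
    show "h ` cball (complex_of_real m) (m / 8) \<subseteq> cball (complex_of_real m) (m / 8)"
    proof
      fix y assume "y \<in> h ` cball (complex_of_real m) (m / 8)"
      then obtain x where x: "x \<in> cball (complex_of_real m) (m / 8)" "y = h x" by auto
      have "cmod (h x - of_real m) \<le> \<alpha>\<^sup>2 * M" using x sub by (intro h_near) auto
      then show "y \<in> cball (complex_of_real m) (m / 8)"
        using M(2) m x(2) by (simp add: dist_norm norm_minus_commute)
    qed
    show "dist (h x) (h y) \<le> 1 / 2 * dist x y"
      if "x \<in> cball (complex_of_real m) (m / 8)" "y \<in> cball (complex_of_real m) (m / 8)" for x y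
      unfolding dist_norm by (rule lip[OF that])
  qed auto
  then obtain E where E: "E \<in> cball (complex_of_real m) (m / 8)" "h E = E"
    and uniq: "\<And>z. z \<in> cball (complex_of_real m) (m / 8) \<Longrightarrow> h z = z \<Longrightarrow> z = E"
    by metis
  show ?thesis
  proof (rule that)
    show "cmod (E - of_real m) \<le> \<alpha>\<^sup>2 * M" using h_near[of E] E sub by auto
    show "characteristic m \<alpha> continued_self_energy E = 0" using E(2) by (simp add: fix_iff)
    show "z = E" if "z \<in> cball (complex_of_real m) (m / 8)" "characteristic m \<alpha> continued_self_energy z = 0" for z
      using that uniq by (simp add: fix_iff)
  qed
qed

lemma dicke_resonance_exists:
  assumes m: "0 < m"
  shows "\<exists>E. dicke_resonance m f E"
proof -
  obtain \<delta> M where \<delta>: "0 < \<delta>" and M: "0 < M"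
    and bound: "\<And>w. w \<noteq> 0 \<Longrightarrow> cmod w < \<delta> \<Longrightarrow> cmod (continued_self_energy w) \<le> M"
    using continued_self_energy_bounded by metis
  have small: "eventually (\<lambda>\<alpha>. 0 < \<alpha> \<and> \<alpha> * m < r / 2 \<and> 2 * m * \<alpha> < \<delta> \<and> \<alpha>\<^sup>2 * M < m / 32) (at_right 0)"
  proof (intro eventually_conj)
    show "eventually (\<lambda>\<alpha> :: real. 0 < \<alpha>) (at_right 0)" by (simp add: eventually_at_right_less)
    show "eventually (\<lambda>\<alpha>. \<alpha> * m < r / 2) (at_right 0)"
      by (rule order_tendstoD(2)[where y = 0]) (use r in \<open>auto intro!: tendsto_eq_intros\<close>)
    show "eventually (\<lambda>\<alpha>. 2 * m * \<alpha> < \<delta>) (at_right 0)"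
      by (rule order_tendstoD(2)[where y = 0]) (use \<delta> in \<open>auto intro!: tendsto_eq_intros\<close>)
    show "eventually (\<lambda>\<alpha>. \<alpha>\<^sup>2 * M < m / 32) (at_right 0)"
      by (rule order_tendstoD(2)[where y = 0]) (use m in \<open>auto intro!: tendsto_eq_intros\<close>)
  qed
  have ex: "\<exists>E. resonance (dicke m f \<alpha>) excited_state m E \<and> cmod (E - of_real m) \<le> \<alpha>\<^sup>2 * M"
    if \<alpha>: "0 < \<alpha>" "\<alpha> * m < r / 2" "2 * m * \<alpha> < \<delta>" "\<alpha>\<^sup>2 * M < m / 32" for \<alpha>
  proof -
    have "cmod (continued_self_energy (of_real \<alpha> * z)) \<le> M" if z: "z \<in> ball (complex_of_real m) (m / 2)" for z
    proof (rule bound)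
      show "of_real \<alpha> * z \<noteq> 0" using scaled_ball(1)[OF m \<alpha>(1,2) z] \<alpha>(1) by auto
      show "cmod (of_real \<alpha> * z) < \<delta>" using scaled_ball(3)[OF m \<alpha>(1,2) z] \<alpha>(3) by linarith
    qed
    then obtain E where E: "cmod (E - of_real m) \<le> \<alpha>\<^sup>2 * M" "characteristic m \<alpha> continued_self_energy E = 0"
      "\<And>z. z \<in> cball (complex_of_real m) (m / 8) \<Longrightarrow> characteristic m \<alpha> continued_self_energy z = 0 \<Longrightarrow> z = E"
      using characteristic_zero_exists[OF m \<alpha>(1,2) M less_imp_le[OF \<alpha>(4)]] by metis
    have "resonance (dicke m f \<alpha>) excited_state m E"
    proof (rule resonance_of_zero[OF m \<alpha>(1,2), of "m / 8"])
      show "E \<in> ball (complex_of_real m) (m / 8)"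
        using E(1) \<alpha>(4) m by (simp add: dist_norm norm_minus_commute)
    qed (use m E in auto)
    with E(1) show ?thesis by blast
  qed
  define E where "E \<alpha> = (SOME E. resonance (dicke m f \<alpha>) excited_state m E \<and> cmod (E - of_real m) \<le> \<alpha>\<^sup>2 * M)" for \<alpha>
  have E: "eventually (\<lambda>\<alpha>. resonance (dicke m f \<alpha>) excited_state m (E \<alpha>) \<and> cmod (E \<alpha> - of_real m) \<le> \<alpha>\<^sup>2 * M) (at_right 0)"
    using small
  proof (rule eventually_mono)
    fix \<alpha> assume "0 < \<alpha> \<and> \<alpha> * m < r / 2 \<and> 2 * m * \<alpha> < \<delta> \<and> \<alpha>\<^sup>2 * M < m / 32"
    then have "\<exists>E. resonance (dicke m f \<alpha>) excited_state m E \<and> cmod (E - of_real m) \<le> \<alpha>\<^sup>2 * M"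
      by (intro ex) auto
    then show "resonance (dicke m f \<alpha>) excited_state m (E \<alpha>) \<and> cmod (E \<alpha> - of_real m) \<le> \<alpha>\<^sup>2 * M"
      unfolding E_def by (rule someI_ex)
  qed
  have "((\<lambda>\<alpha>. E \<alpha> - of_real m) \<longlongrightarrow> 0) (at_right 0)"
  proof (rule Lim_null_comparison)
    show "eventually (\<lambda>\<alpha>. cmod (E \<alpha> - of_real m) \<le> \<alpha>\<^sup>2 * M) (at_right 0)"
      using E by (rule eventually_mono) blast
    show "((\<lambda>\<alpha>. \<alpha>\<^sup>2 * M) \<longlongrightarrow> 0) (at_right 0)" by (auto intro!: tendsto_eq_intros)
  qed
  then have "(E \<longlongrightarrow> of_real m) (at_right 0)" by (rule LIM_zero_cancel)
  moreover have "eventually (\<lambda>\<alpha>. resonance (dicke m f \<alpha>) excited_state m (E \<alpha>)) (at_right 0)"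
    using E by (rule eventually_mono) blast
  ultimately show ?thesis unfolding dicke_resonance_def by blast
qed

text \<open>At the zero \<open>E\<close>, \<open>m - \<alpha>\<^sup>2 \<E> - Re E = \<alpha>\<^sup>2 (Re S(\<alpha> E) - \<E>)\<close>, and \<open>\<alpha> E\<close> tends to \<open>0\<close>.\<close>

lemma dicke_resonance_lamb_shift:
  assumes m: "0 < m" and E: "dicke_resonance m f E"
  shows "(\<lambda>a. 1 / adiabatic_time_scale m f a - (m + lamb_shift m (E a))) \<in> o[at_right 0](\<lambda>a. a\<^sup>2)"
proof (rule smalloI_tendsto)
  have lim: "(E \<longlongrightarrow> of_real m) (at_right 0)"
    and res: "eventually (\<lambda>\<alpha>. resonance (dicke m f \<alpha>) excited_state m (E \<alpha>)) (at_right 0)"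
    using E by (auto simp: dicke_resonance_def)
  have near: "eventually (\<lambda>\<alpha>. E \<alpha> \<in> ball (complex_of_real m) (m / 2)) (at_right 0)"
    using tendstoD[OF lim, of "m / 2"] m by (simp add: dist_commute)
  have pos: "eventually (\<lambda>\<alpha> :: real. 0 < \<alpha>) (at_right 0)" by (simp add: eventually_at_right_less)
  have small: "eventually (\<lambda>\<alpha>. \<alpha> * m < r / 2) (at_right 0)"
    by (rule order_tendstoD(2)[where y = 0]) (use r in \<open>auto intro!: tendsto_eq_intros\<close>)
  have "((\<lambda>\<alpha>. of_real \<alpha> * E \<alpha>) \<longlongrightarrow> 0) (at_right 0)"
    by (rule tendsto_eq_intros lim refl | simp)+
  moreover have "eventually (\<lambda>\<alpha>. of_real \<alpha> * E \<alpha> \<noteq> 0) (at_right 0)"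
    using near pos small
  proof eventually_elim
    case (elim \<alpha>)
    then show ?case using scaled_ball(1)[OF m elim(2,3,1)] by auto
  qed
  ultimately have "filterlim (\<lambda>\<alpha>. of_real \<alpha> * E \<alpha>) (at 0) (at_right 0)"
    by (simp add: filterlim_at)
  from filterlim_compose[OF continued_self_energy_tendsto this]
  have "((\<lambda>\<alpha>. continued_self_energy (of_real \<alpha> * E \<alpha>)) \<longlongrightarrow> of_real (coupling_energy f)) (at_right 0)" .
  from tendsto_diff[OF tendsto_Re[OF this] tendsto_const[of "coupling_energy f"]]
  have "((\<lambda>\<alpha>. Re (continued_self_energy (of_real \<alpha> * E \<alpha>)) - coupling_energy f) \<longlongrightarrow> 0) (at_right 0)"
    by simp
  moreover have "eventually (\<lambda>\<alpha>. Re (continued_self_energy (of_real \<alpha> * E \<alpha>)) - coupling_energy f =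
      (1 / adiabatic_time_scale m f \<alpha> - (m + lamb_shift m (E \<alpha>))) / \<alpha>\<^sup>2) (at_right 0)"
    using near pos small res
  proof eventually_elim
    case (elim \<alpha>)
    have "characteristic m \<alpha> continued_self_energy (E \<alpha>) = 0"
      by (rule resonance_zero[OF elim(4) m elim(2,3,1)])
    then have "E \<alpha> = of_real m - of_real (\<alpha>\<^sup>2) * continued_self_energy (of_real \<alpha> * E \<alpha>)"
      by (simp add: characteristic_def algebra_simps)
    from arg_cong[OF this, of Re]
    have "Re (E \<alpha>) = m - \<alpha>\<^sup>2 * Re (continued_self_energy (of_real \<alpha> * E \<alpha>))"
      by (simp del: of_real_power)
    then have "1 / adiabatic_time_scale m f \<alpha> - (m + lamb_shift m (E \<alpha>))
        = \<alpha>\<^sup>2 * (Re (continued_self_energy (of_real \<alpha> * E \<alpha>)) - coupling_energy f)"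
      by (simp add: adiabatic_time_scale_def lamb_shift_def algebra_simps)
    then show ?case using elim(2) by simp
  qed
  ultimately show "((\<lambda>\<alpha>. (1 / adiabatic_time_scale m f \<alpha> - (m + lamb_shift m (E \<alpha>))) / \<alpha>\<^sup>2) \<longlongrightarrow> 0) (at_right 0)"
    by (rule Lim_transform_eventually)
  show "eventually (\<lambda>\<alpha> :: real. \<alpha>\<^sup>2 \<noteq> 0) (at_right 0)"
    using pos by (rule eventually_mono) simp
qed

end

section \<open>Adiabatic theorem and Lamb shift\<close>

theorem mainTheorem4:
  fixes f :: "'a::euclidean_space \<Rightarrow> complex" and \<alpha> :: real
  assumes "3 \<le> DIM('a)"
    and "square_integrable lborel f"
    and "sqrt_singularity f"
    and "0 < \<alpha>"
  shows "(\<exists>C. \<forall>\<^sub>F \<tau> in at_top. \<forall>m > \<alpha>\<^sup>2 * coupling_energy f. \<forall>U\<^sub>A U\<^sub>\<tau>.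
            adiabatic_evolution (ground_proj :: real \<Rightarrow> ('a fock ^ 2) \<Rightarrow>\<^sub>L ('a fock ^ 2)) U\<^sub>A \<and>
            schroedinger_evolution (\<lambda>s. dicke_at s m f \<alpha>) \<tau> U\<^sub>\<tau> \<longrightarrow>
            (\<forall>s\<in>{0..1}. norm ((U\<^sub>A s - U\<^sub>\<tau> s) o\<^sub>L ground_proj 0)
               \<le> C * adiabatic_time_scale m f \<alpha> * adiabatic_rate DIM('a) \<tau>))
       \<and> (\<forall>m>0. (\<exists>E. dicke_resonance m f E) \<and>
            (\<forall>E. dicke_resonance m f E \<longrightarrow>
               (\<lambda>a. 1 / adiabatic_time_scale m f a - (m + lamb_shift m (E a)))
                  \<in> o[at_right 0](\<lambda>a. a\<^sup>2)))"
proof -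
  from assms(3) obtain K r where "0 < r"
    "\<And>k. 0 < norm k \<Longrightarrow> norm k < r \<Longrightarrow> f k = K * complex_of_real (sqrt (1 / norm k))"
    unfolding sqrt_singularity_def by blast
  then interpret singular_coupling f K r
    using assms(1,2) by unfold_locales
  show ?thesis
    using adiabatic_bound[OF assms(4)] dicke_resonance_exists dicke_resonance_lamb_shift by blast
qed

end
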